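(* Let $X$ be a non-negative random variable with distribution $F_X$ such that $\mathbb{E}[\log(1+\lambda X)]<\infty$ for all $\lambda>0$. Let $\theta>0$ and let $(\zeta_\theta(t);\,t\le 1/\theta)$ be a $\mathrm{GGC}(\theta,F_X)$ subordinator on $[0,1/\theta]$. Let $(C_1,\dots,C_k)$ be an arbitrary disjoint (measurable) partition of the interval $[0,1/\theta]$ into sets of positive length, and put $\sigma_i=\theta|C_i|>0$, so that $\sum_{i=1}^k\sigma_i=1$. For each $i$ let $Y_{\sigma_i}$ be a Bernoulli random variable with success probability $\sigma_i$ independent of $X$, and assume that $F_{XY_{\sigma_i}}$ has no jump of size one. Then $(\zeta_\theta(C_1),\dots,\zeta_\theta(C_k))$ has joint density $$\prod_{i=1}^k g_{\sigma_i,F_X}(x_i),\qquad x_1,\dots,x_k>0,$$ where $$g_{\sigma,F_X}(x)=\frac1\pi\int_0^\infty e^{-x/y}\,y^{\sigma-2}\sin\big(\pi F_{XY_\sigma}(y)\big)\,e^{-\sigma\Phi_{F_X}(y)}\,dy .$$ That is, the variables $\zeta_\theta(C_i)\overset{d}{=}G_1M_1(F_{XY_{\sigma_i}})$ are independent for $i=1,\dots,k$, where $M_1(F_{XY_{\sigma_i}})\overset{d}{=}\beta_{\sigma_i,1-\sigma_i}M_{\sigma_i}(F_X)$ has density $$\frac1\pi x^{\sigma_i-1}\sin\big(\pi F_{XY_{\sigma_i}}(x)\big)\,e^{-\sigma_i\Phi_{F_X}(x)},\qquad x>0.$$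
   Context: $F_R$ denotes both the distribution and the cdf of a random variable $R$; thus $F_{XY_\sigma}(x)=\sigma F_X(x)+(1-\sigma)\mathbb{I}(x\ge0)$. Also $\Phi_{F_X}(t)=\mathbb{E}[\log(|t-X|)\,\mathbb{I}(t\ne X)]$ and $\psi_{F_X}(\lambda)=\mathbb{E}[\log(1+\lambda X)]$. $|C|$ denotes the Lebesgue measure of $C$. A $\mathrm{GGC}(\theta,F_X)$ subordinator is a non-decreasing, non-negative Lévy process $(\zeta_\theta(t))$ with $\mathbb{E}[e^{-\lambda\zeta_\theta(t)}]=e^{-t\theta\psi_{F_X}(\lambda)}$ for $\lambda\ge0$. For a measurable set $C$, $\zeta_\theta(C)=\int_0^\infty\mathbb{I}(s\in C)\,\zeta_\theta(ds)$. Dirichlet process and Dirichlet mean: for $\theta>0$ and a probability distribution $F$ on $[0,\infty)$, a Dirichlet process $P_\theta$ with total mass $\theta$ and parameter $F$ is a random probability measure on $[0,\infty)$ such that for every finite measurable partition $(D_1,\dots,D_m)$ of $[0,\infty)$ the vector $(P_\theta(D_1),\dots,P_\theta(D_m))$ is Dirichlet distributed with parameters $(\theta F(D_1),\dots,\theta F(D_m))$. The Dirichlet mean is $M_\theta(F)\overset{d}{=}\int_0^\infty x\,P_\theta(dx)$. $G_a$ denotes a gamma$(a,1)$ random variable and $\beta_{a,b}$ a beta$(a,b)$ random variable, with $\beta_{1,0}:=1$. In all products of random variables the factors are independent. Densities are with respect to Lebesgue measure, up to null sets. *)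

theory Defs
  imports "HOL-Probability.Probability"
begin

definition psi :: "real measure \<Rightarrow> real \<Rightarrow> real" where
  "psi F l = (LINT x|F. ln (1 + l * x))"

text \<open>For Lebesgue-almost every \<open>t\<close> the integral below exists. On the remaining null set, where it
  may be \<open>-\<infinity>\<close>, the Bochner integral is 0; this does not affect any density.\<close>
definition Phi :: "real measure \<Rightarrow> real \<Rightarrow> real" where
  "Phi F t = (LINT x|F. (if x = t then 0 else ln \<bar>t - x\<bar>))"

text \<open>The law of \<open>U V\<close> for independent \<open>U\<close>, \<open>V\<close> with laws \<open>\<mu>\<close>, \<open>\<nu>\<close>.\<close>
definition indep_prod_law :: "real measure \<Rightarrow> real measure \<Rightarrow> real measure" where
  "indep_prod_law \<mu> \<nu> = distr (\<mu> \<Otimes>\<^sub>M \<nu>) borel (\<lambda>(u, v). u * v)"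

definition bernoulli_law :: "real \<Rightarrow> real measure" where
  "bernoulli_law s = distr (measure_pmf (bernoulli_pmf s)) borel of_bool"

definition XY_law :: "real measure \<Rightarrow> real \<Rightarrow> real measure" where
  "XY_law F s = indep_prod_law F (bernoulli_law s)"

definition g_dens :: "real \<Rightarrow> real measure \<Rightarrow> real \<Rightarrow> real" where
  "g_dens s F x = 1 / pi * (LBINT y:{0<..}. exp (- x / y) * y powr (s - 2)
                      * sin (pi * cdf (XY_law F s) y) * exp (- s * Phi F y))"

definition mean_dens :: "real \<Rightarrow> real measure \<Rightarrow> real \<Rightarrow> real" where
  "mean_dens s F x = 1 / pi * x powr (s - 1) * sin (pi * cdf (XY_law F s) x) * exp (- s * Phi F x)"

text \<open>The convention \<open>G\<^sub>0 = 0\<close> allows vanishing parameters in the Dirichlet distribution.\<close>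
definition gamma_law :: "real \<Rightarrow> real measure" where
  "gamma_law a = (if a = 0 then return borel 0
     else density lborel (\<lambda>x. ennreal (indicator {0<..} x * x powr (a - 1) * exp (- x) / Gamma a)))"

text \<open>The case \<open>b = 0\<close> is the convention \<open>\<beta>\<^bsub>1,0\<^esub> = 1\<close>.\<close>
definition beta_law :: "real \<Rightarrow> real \<Rightarrow> real measure" where
  "beta_law a b = (if b = 0 then return borel 1
     else density lborel
       (\<lambda>x. ennreal (indicator {0<..<1} x * x powr (a - 1) * (1 - x) powr (b - 1) / Beta a b)))"

text \<open>Ferguson's definition by normalised independent gamma variables; it coincides with the usual
  density on the simplex when all parameters are positive, and a component with parameter 0 vanishes.\<close>
definition dirichlet_law :: "nat \<Rightarrow> (nat \<Rightarrow> real) \<Rightarrow> (nat \<Rightarrow> real) measure" where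
  "dirichlet_law m a =
     distr (\<Pi>\<^sub>M j\<in>{1..m}. gamma_law (a j)) (\<Pi>\<^sub>M j\<in>{1..m}. borel)
           (\<lambda>G. \<lambda>j\<in>{1..m}. G j / (\<Sum>l=1..m. G l))"

definition dirichlet_process ::
  "'b measure \<Rightarrow> real \<Rightarrow> real measure \<Rightarrow> ('b \<Rightarrow> real measure) \<Rightarrow> bool" where
  "dirichlet_process N \<theta> F P \<longleftrightarrow>
     prob_space N \<and>
     P \<in> N \<rightarrow>\<^sub>M prob_algebra borel \<and>
     (\<forall>\<omega>\<in>space N. measure (P \<omega>) {0..} = 1) \<and>
     (\<forall>m (D :: nat \<Rightarrow> real set).
        (\<forall>j\<in>{1..m}. D j \<in> sets borel) \<and> disjoint_family_on D {1..m} \<and> (\<Union>j\<in>{1..m}. D j) = {0..} \<longrightarrow>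
        distr N (\<Pi>\<^sub>M j\<in>{1..m}. borel) (\<lambda>\<omega>. \<lambda>j\<in>{1..m}. measure (P \<omega>) (D j))
          = dirichlet_law m (\<lambda>j. \<theta> * measure F (D j)))"

text \<open>The Bochner integral would be 0 on the event that \<open>P \<omega>\<close> has no first moment; under
  \<open>\<integral> log (1 + x) dF < \<infinity>\<close> that event is null.\<close>
definition mean_law :: "'b measure \<Rightarrow> ('b \<Rightarrow> real measure) \<Rightarrow> real measure" where
  "mean_law N P = distr N borel (\<lambda>\<omega>. LINT x|P \<omega>. x)"

definition cadlag_on :: "real \<Rightarrow> (real \<Rightarrow> real) \<Rightarrow> bool" where
  "cadlag_on T f \<longleftrightarrow>
     (\<forall>t\<in>{0..<T}. continuous (at_right t) f) \<and>
     (\<forall>t\<in>{0<..T}. \<exists>l. (f \<longlongrightarrow> l) (at_left t))"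

text \<open>Path regularity is only required almost surely, so path functionals are in general random
  variables on the completion of \<open>M\<close> rather than on \<open>M\<close> itself.\<close>
definition levy_process_on :: "'a measure \<Rightarrow> real \<Rightarrow> (real \<Rightarrow> 'a \<Rightarrow> real) \<Rightarrow> bool" where
  "levy_process_on M T \<zeta> \<longleftrightarrow>
     prob_space M \<and>
     (\<forall>t\<in>{0..T}. \<zeta> t \<in> borel_measurable M) \<and>
     (AE \<omega> in M. \<zeta> 0 \<omega> = 0) \<and>
     (AE \<omega> in M. cadlag_on T (\<lambda>t. \<zeta> t \<omega>)) \<and>
     (\<forall>n (t :: nat \<Rightarrow> real). mono_on {..n} t \<and> t ` {..n} \<subseteq> {0..T} \<longrightarrow>
        prob_space.indep_vars M (\<lambda>_. borel) (\<lambda>j \<omega>. \<zeta> (t (Suc j)) \<omega> - \<zeta> (t j) \<omega>) {..<n}) \<and>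
     (\<forall>s h. 0 \<le> s \<and> 0 \<le> h \<and> s + h \<le> T \<longrightarrow>
        distr M borel (\<lambda>\<omega>. \<zeta> (s + h) \<omega> - \<zeta> s \<omega>) = distr M borel (\<zeta> h))"

definition GGC_subordinator_on ::
  "'a measure \<Rightarrow> real \<Rightarrow> real \<Rightarrow> real measure \<Rightarrow> (real \<Rightarrow> 'a \<Rightarrow> real) \<Rightarrow> bool" where
  "GGC_subordinator_on M T \<theta> F \<zeta> \<longleftrightarrow>
     levy_process_on M T \<zeta> \<and>
     (AE \<omega> in M. mono_on {0..T} (\<lambda>t. \<zeta> t \<omega>) \<and> (\<forall>t\<in>{0..T}. 0 \<le> \<zeta> t \<omega>)) \<and>
     (\<forall>t\<in>{0..T}. \<forall>l\<ge>0. (LINT \<omega>|M. exp (- l * \<zeta> t \<omega>)) = exp (- t * \<theta> * psi F l))"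

text \<open>The Lebesgue--Stieltjes integral of the indicator of \<open>C \<subseteq> {0..T}\<close> along the path
  of \<open>\<omega>\<close>. The path is extended from \<open>{0..T}\<close> to the line by constants, so it puts no mass outside
  \<open>{0..T}\<close>, nor at \<open>0\<close> (where it starts from the value \<open>0\<close> almost surely).\<close>
definition stieltjes_on :: "real \<Rightarrow> (real \<Rightarrow> 'a \<Rightarrow> real) \<Rightarrow> real set \<Rightarrow> 'a \<Rightarrow> real" where
  "stieltjes_on T \<zeta> C \<omega> =
     (LINT s|interval_measure (\<lambda>s. \<zeta> (max 0 (min T s)) \<omega>). indicator C s)"

end

theory Submission
  imports Defs "HOL-Complex_Analysis.Conformal_Mappings"
begin

text \<open>
  Write \<open>\<psi> = psi F\<close> and let \<open>\<nu> = XY_law F s\<close>, so that \<open>psi \<nu> l = s * \<psi> l\<close>. Everything is read off from the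
  one function \<open>exp (- s * \<psi> l)\<close>, which occurs as a transform in three ways.

  It is the Laplace transform of \<open>\<zeta>(C)\<close> when \<open>\<theta> |C| = s\<close>. More generally
  \<open>E exp (- \<integral> f d\<zeta>) = exp (- \<theta> \<integral> \<psi> (f x) dx)\<close> (\<open>GGC_Laplace_functional\<close>): for dyadic step functions
  this is independence and stationarity of the increments, and both sides pass to bounded pointwise limits,
  which reach all bounded nonnegative Borel functions of interest (\<open>step_limit_indicator\<close>). For \<open>f\<close> constant on
  each \<open>C\<^sub>i\<close> the right-hand side factorises, and independence follows because Laplace transforms determine
  finite measures (\<open>finite_measure_eqI_Laplace\<close>, \<open>Laplace_imp_distr_eq_PiM\<close>).

  It is the Stieltjes transform \<open>E (1 + l M)\<^sup>-\<^sup>1\<close> of the mean \<open>M\<close> of a Dirichlet process with parameter \<open>\<nu>\<close> and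
  total mass 1, and it is the transform \<open>E (1 + l M)\<^sup>-\<^sup>s\<close> of the mean for parameter \<open>F\<close> and total mass
  \<open>s\<close>. This is the Markov--Krein identity. For a Dirichlet vector, obtained by normalising independent gamma
  variables, it expresses that the vector is independent of the sum \<open>T\<close> of these variables
  (\<open>Markov_Krein_Dirichlet\<close>); in general it follows by monotone approximation with simple functions
  (\<open>dirichlet_process_mean_transform\<close>). The beta factor turns the exponent \<open>s\<close> into 1 because
  \<open>E (1 + c \<beta>)\<^sup>-\<^sup>1 = (1 + c) powr (- s)\<close> for a beta\<open>(s, 1 - s)\<close> variable \<open>\<beta>\<close> (\<open>beta_law_Stieltjes\<close>), and an
  independent standard exponential factor turns a Stieltjes transform into a Laplace transform.

  Finally a probability measure \<open>\<mu>\<close> with Stieltjes transform \<open>exp (- psi \<nu> l)\<close> has the density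
  \<open>exp (- Phi \<nu> x) * sin (pi * cdf \<nu> x) / pi\<close> (\<open>Stieltjes_inversion\<close>). Both sides of
  \<open>\<integral> 1 / (z + x) d\<mu> = exp (- \<integral> Ln (z + x) d\<nu>)\<close> are holomorphic off the negative half-line, hence agree there, and
  the imaginary parts at \<open>z = - y + \<i> e\<close> tend to the two descriptions of the density as \<open>e\<close> tends to 0. Such a
  \<open>\<mu>\<close> exists by Helly's theorem applied to the means of discretised Dirichlet vectors
  (\<open>Stieltjes_pair_exists\<close>), so the density formulas hold without reference to any Dirichlet process.
\<close>

section \<open>Uniqueness of Laplace transforms\<close>

lemma integrable_AE_bounded:
  fixes f :: "real \<Rightarrow> real"
  assumes "finite_measure M" "sets M = sets borel" "AE x in M. \<bar>f x\<bar> \<le> B" "f \<in> borel_measurable borel"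
  shows "integrable M f"
  using assms by (intro finite_measure.integrable_const_bound[where B=B]) (auto cong: measurable_cong_sets)

text \<open>Pushing forward along \<open>x \<mapsto> exp (- x)\<close> turns the Laplace transform at integer arguments into the
  moments of a measure on the compact set \<open>{0..1}\<close>. By Weierstrass these determine the integrals of all
  continuous functions of \<open>exp (- x)\<close>, and ramp functions recover the distribution function.\<close>
lemma finite_measure_eqI_Laplace:
  fixes \<mu> \<nu> :: "real measure"
  assumes fin: "finite_measure \<mu>" "finite_measure \<nu>"
    and sets[measurable_cong]: "sets \<mu> = sets borel" "sets \<nu> = sets borel"
    and nn: "AE x in \<mu>. 0 \<le> x" "AE x in \<nu>. 0 \<le> x"
    and L: "\<And>n::nat. (LINT x|\<mu>. exp (- real n * x)) = (LINT x|\<nu>. exp (- real n * x))"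
  shows "\<mu> = \<nu>"
proof -
  interpret m: finite_measure \<mu> by fact
  interpret n: finite_measure \<nu> by fact
  have cont: "(LINT x|\<mu>. f (exp (- x))) = (LINT x|\<nu>. f (exp (- x)))"
    if f: "continuous_on UNIV f" for f :: "real \<Rightarrow> real"
  proof -
    have f'[measurable]: "f \<in> borel_measurable borel"
      using f by (rule borel_measurable_continuous_onI)
    have "bounded (f ` {0..1})"
      by (meson compact_Icc compact_continuous_image compact_imp_bounded continuous_on_subset f subset_UNIV)
    then obtain B where B: "\<And>x. 0 \<le> x \<Longrightarrow> x \<le> 1 \<Longrightarrow> \<bar>f x\<bar> \<le> B"
      unfolding bounded_iff by (metis atLeastAtMost_iff imageI real_norm_def)
    have intf: "integrable \<mu> (\<lambda>x. f (exp (- x)))" "integrable \<nu> (\<lambda>x. f (exp (- x)))"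
      using nn by (auto intro!: integrable_AE_bounded[where B=B] fin sets B elim!: eventually_mono)
    define A where "A = measure \<mu> UNIV + measure \<nu> UNIV"
    have *: "\<bar>(LINT x|\<mu>. f (exp (- x))) - (LINT x|\<nu>. f (exp (- x)))\<bar> \<le> e * A" if "e > 0" for e
    proof -
      from f have "continuous_on {0..1} f" using continuous_on_subset by blast
      from Stone_Weierstrass_real_polynomial_function[OF compact_Icc this \<open>e > 0\<close>]
      obtain g where g: "real_polynomial_function g" "\<And>x. x \<in> {0..1} \<Longrightarrow> \<bar>f x - g x\<bar> < e" by blast
      from g(1) obtain a k where gs: "g = (\<lambda>x. \<Sum>i\<le>k. a i * x ^ i)"
        using real_polynomial_function_iff_sum by blast
      have ii: "integrable \<mu> (\<lambda>x. exp (- x) ^ i)" "integrable \<nu> (\<lambda>x. exp (- x) ^ i)" for i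
        using nn by (auto intro!: integrable_AE_bounded[where B=1] fin sets power_le_one elim!: eventually_mono)
      have pw: "exp (- x) ^ i = exp (- real i * x)" for x :: real and i :: nat
        by (simp add: exp_of_nat_mult[symmetric])
      have ig: "integrable \<mu> (\<lambda>x. g (exp (- x)))" "integrable \<nu> (\<lambda>x. g (exp (- x)))"
        unfolding gs by (auto intro!: ii)
      have eq: "(LINT x|\<mu>. g (exp (- x))) = (LINT x|\<nu>. g (exp (- x)))"
        unfolding gs using ii by (simp add: Bochner_Integration.integral_sum pw L[simplified])
      have bd: "\<bar>(LINT x|M. f (exp (- x))) - (LINT x|M. g (exp (- x)))\<bar> \<le> e * measure M UNIV"
        if "finite_measure M" "AE x in M. 0 \<le> x" "sets M = sets borel"
          "integrable M (\<lambda>x. f (exp (- x)))" "integrable M (\<lambda>x. g (exp (- x)))" for M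
      proof -
        interpret M: finite_measure M by fact
        have sp: "space M = UNIV" using that(3)[THEN sets_eq_imp_space_eq] by simp
        have "\<bar>(LINT x|M. f (exp (- x))) - (LINT x|M. g (exp (- x)))\<bar> = \<bar>(LINT x|M. f (exp (- x)) - g (exp (- x)))\<bar>"
          using that by simp
        also have "\<dots> \<le> (LINT x|M. \<bar>f (exp (- x)) - g (exp (- x))\<bar>)" by (rule integral_abs_bound)
        also have "\<dots> \<le> (LINT x|M. e)"
          using that(2) g(2) that by (intro integral_mono_AE) (auto elim!: eventually_mono intro!: less_imp_le)
        finally show ?thesis by (simp add: sp mult.commute)
      qed
      show ?thesis using bd[of \<mu>] bd[of \<nu>] eq fin nn sets intf ig unfolding A_def
        by (simp add: algebra_simps)
    qed
    have "A \<ge> 0" by (simp add: A_def)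
    have "\<bar>(LINT x|\<mu>. f (exp (- x))) - (LINT x|\<nu>. f (exp (- x)))\<bar> \<le> 0 + e" if "e > 0" for e
    proof -
      have "e / (A + 1) > 0" using \<open>A \<ge> 0\<close> that by simp
      from *[OF this] have "\<bar>(LINT x|\<mu>. f (exp (- x))) - (LINT x|\<nu>. f (exp (- x)))\<bar> \<le> e / (A + 1) * A" .
      also have "\<dots> \<le> e" using \<open>A \<ge> 0\<close> that by (simp add: field_simps)
      finally show ?thesis by simp
    qed
    then have "\<bar>(LINT x|\<mu>. f (exp (- x))) - (LINT x|\<nu>. f (exp (- x)))\<bar> \<le> 0"
      by (rule field_le_epsilon)
    then show ?thesis by simp
  qed
  have m: "measure \<mu> {..a} = measure \<nu> {..a}" for a
  proof -
    \<comment> \<open>Ramps in \<open>u = exp (- x)\<close> that decrease to the indicator of \<open>u \<ge> exp (- a)\<close>, that is, of \<open>x \<le> a\<close>.\<close>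
    define f where "f n u = max 0 (min 1 (1 - real n * (exp (- a) - u)))" for n :: nat and u :: real
    have fb: "\<bar>f n u\<bar> \<le> 1" for n u by (auto simp: f_def)
    have lim: "(\<lambda>n. f n (exp (- x))) \<longlonglongrightarrow> indicator {..a} x" for x
    proof (cases "x \<le> a")
      case True then have "exp (- a) - exp (- x) \<le> 0" by simp
      then have "f n (exp (- x)) = 1" for n
        by (auto simp: f_def mult_nonneg_nonpos)
      then show ?thesis using True by simp
    next
      case False
      then have d: "exp (- a) - exp (- x) > 0" by simp
      have "eventually (\<lambda>n. real n \<ge> 1 / (exp (- a) - exp (- x))) sequentially"
        by (rule eventually_sequentiallyI[of "nat \<lceil>1 / (exp (- a) - exp (- x))\<rceil>"]) linarith
      then have "eventually (\<lambda>n. f n (exp (- x)) = 0) sequentially"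
      proof eventually_elim
        case (elim n)
        then have "1 \<le> real n * (exp (- a) - exp (- x))" using d by (simp add: field_simps)
        then show ?case by (simp add: f_def)
      qed
      then show ?thesis using False tendsto_eventually by fastforce
    qed
    have c: "(\<lambda>n. LINT x|M. f n (exp (- x))) \<longlonglongrightarrow> measure M {..a}" if "finite_measure M" "sets M = sets borel" for M
    proof -
      interpret M: finite_measure M by fact
      have [measurable_cong]: "sets M = sets borel" by fact
      have sp: "space M = UNIV" using that(2)[THEN sets_eq_imp_space_eq] by simp
      have "(\<lambda>n. LINT x|M. f n (exp (- x))) \<longlonglongrightarrow> (LINT x|M. indicator {..a} x)"
        by (rule integral_dominated_convergence[where w="\<lambda>_. 1"]) (use lim fb in \<open>auto simp: f_def[abs_def]\<close>)
      then show ?thesis by (simp add: sp)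
    qed
    have "(LINT x|\<mu>. f n (exp (- x))) = (LINT x|\<nu>. f n (exp (- x)))" for n
      by (rule cont) (auto simp: f_def intro!: continuous_intros)
    with c[OF fin(1) sets(1)] c[OF fin(2) sets(2)] show ?thesis
      by (simp add: LIMSEQ_unique)
  qed
  have "finite_borel_measure \<mu>" "finite_borel_measure \<nu>"
    using fin sets by (simp_all add: finite_borel_measure_def finite_borel_measure_axioms_def)
  moreover have "cdf \<mu> = cdf \<nu>" using m by (auto simp: cdf_def)
  ultimately show ?thesis by (rule cdf_unique')
qed

section \<open>Analytic continuation of the Stieltjes identity\<close>

text \<open>The difference quotients are dominated by \<open>B\<close> because of the mean value inequality on the ball, so
  the derivative may be taken under the integral.\<close>
lemma has_field_derivative_LINT:
  fixes f :: "complex \<Rightarrow> real \<Rightarrow> complex"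
  assumes M: "finite_measure M" "sets M = sets borel" and "r > 0"
    and D: "\<And>w x. w \<in> ball z r \<Longrightarrow> ((\<lambda>w. f w x) has_field_derivative f' w x) (at w)"
    and B: "\<And>w x. w \<in> ball z r \<Longrightarrow> norm (f' w x) \<le> B"
    and int: "\<And>w. w \<in> ball z r \<Longrightarrow> integrable M (f w)"
    and meas: "f' z \<in> borel_measurable borel"
  shows "((\<lambda>w. LINT x|M. f w x) has_field_derivative (LINT x|M. f' z x)) (at z)"
proof -
  interpret finite_measure M by fact
  have [measurable_cong]: "sets M = sets borel" by fact
  note [measurable] = meas
  have z: "z \<in> ball z r" using \<open>r > 0\<close> by simp
  have "((\<lambda>w. ((LINT x|M. f w x) - (LINT x|M. f z x)) / (w - z)) \<longlongrightarrow> (LINT x|M. f' z x)) (at z within ball z r)"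
    unfolding tendsto_at_iff_sequentially
  proof (safe, unfold comp_def)
    fix s :: "nat \<Rightarrow> complex"
    assume s: "\<forall>i. s i \<in> ball z r - {z}" and lim: "s \<longlonglongrightarrow> z"
    have [measurable]: "f (s i) \<in> borel_measurable M" "f z \<in> borel_measurable M" for i
      using int[of "s i"] int[OF z] s by (auto dest: borel_measurable_integrable)
    have "(\<lambda>i. LINT x|M. (f (s i) x - f z x) / (s i - z)) \<longlonglongrightarrow> (LINT x|M. f' z x)"
    proof (rule integral_dominated_convergence[where w="\<lambda>_. B"])
      show "AE x in M. (\<lambda>i. (f (s i) x - f z x) / (s i - z)) \<longlonglongrightarrow> f' z x"
      proof (rule AE_I2)
        fix x
        have "((\<lambda>w. (f w x - f z x) / (w - z)) \<longlongrightarrow> f' z x) (at z)"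
          using D[OF z] by (simp add: has_field_derivative_iff)
        then show "(\<lambda>i. (f (s i) x - f z x) / (s i - z)) \<longlonglongrightarrow> f' z x"
          using s lim unfolding tendsto_at_iff_sequentially comp_def by auto
      qed
      show "AE x in M. norm ((f (s i) x - f z x) / (s i - z)) \<le> B" for i
      proof (rule AE_I2)
        fix x
        have "norm (f (s i) x - f z x) \<le> B * norm (s i - z)"
          by (rule field_differentiable_bound[of "ball z r" "\<lambda>w. f w x" "\<lambda>w. f' w x"])
             (use s z B D in \<open>auto intro: has_field_derivative_at_within\<close>)
        then show "norm ((f (s i) x - f z x) / (s i - z)) \<le> B"
          using s by (auto simp: norm_divide divide_le_eq)
      qed
    qed auto
    moreover have "(LINT x|M. (f (s i) x - f z x) / (s i - z)) = ((LINT x|M. f (s i) x) - (LINT x|M. f z x)) / (s i - z)" for i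
      using int[of "s i"] int[OF z] s by (simp add: Bochner_Integration.integral_diff)
    ultimately show "(\<lambda>i. ((LINT x|M. f (s i) x) - (LINT x|M. f z x)) / (s i - z)) \<longlonglongrightarrow> (LINT x|M. f' z x)"
      by (simp only:)
  qed
  then show ?thesis
    using \<open>r > 0\<close> by (simp add: has_field_derivative_iff at_within_open[of z "ball z r"])
qed

lemma slit_plane_add_nonneg:
  fixes w :: complex
  assumes "w \<notin> \<real>\<^sub>\<le>\<^sub>0" and "0 \<le> x"
  shows "w + of_real x \<notin> \<real>\<^sub>\<le>\<^sub>0"
  using assms by (auto simp: complex_nonpos_Reals_iff)

text \<open>Translation by a nonnegative real cannot bring a point near the negative half-line unless the point
  was already near it: \<open>norm (w + x)\<close> is the distance of \<open>w\<close> from \<open>- x\<close>. So one radius serves all shifts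
  at once, which gives the uniform bounds for differentiating under the integral.\<close>
lemma slit_plane_ball_bound:
  fixes z :: complex
  assumes "z \<notin> \<real>\<^sub>\<le>\<^sub>0"
  obtains r where "r > 0" "\<And>w. w \<in> ball z r \<Longrightarrow> w \<notin> \<real>\<^sub>\<le>\<^sub>0"
    "\<And>w x. w \<in> ball z r \<Longrightarrow> 0 \<le> x \<Longrightarrow> r \<le> norm (w + of_real x)"
proof -
  have "open (- \<real>\<^sub>\<le>\<^sub>0 :: complex set)" by (simp add: closed_nonpos_Reals_complex open_Compl)
  then obtain d where d: "d > 0" "ball z d \<subseteq> - \<real>\<^sub>\<le>\<^sub>0"
    using assms by (meson ComplI openE)
  show ?thesis
  proof
    show "d / 2 > 0" using d by simp
    show "w \<notin> \<real>\<^sub>\<le>\<^sub>0" if "w \<in> ball z (d/2)" for w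
      using d that subset_ball[of "d/2" d z] by auto
    show "d / 2 \<le> norm (w + of_real x)" if "w \<in> ball z (d/2)" "0 \<le> x" for w x
    proof (rule ccontr)
      assume "\<not> ?thesis"
      then have "dist w (- of_real x) < d / 2" by (simp add: dist_norm)
      moreover have "dist z w < d / 2" using that by simp
      ultimately have "dist z (- of_real x) < d" using dist_triangle[of z "- of_real x" w] by simp
      then have "- of_real x \<in> (- \<real>\<^sub>\<le>\<^sub>0 :: complex set)" using d by auto
      then show False using that by (auto simp: complex_nonpos_Reals_iff)
    qed
  qed
qed

lemma borel_measurable_Ln_shift [measurable]:
  "(\<lambda>x::real. Ln (w + of_real \<bar>x\<bar>)) \<in> borel_measurable borel" if "w \<notin> \<real>\<^sub>\<le>\<^sub>0"
  by (intro borel_measurable_continuous_onI continuous_intros)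
     (use slit_plane_add_nonneg[OF that abs_ge_zero] in blast)

text \<open>The imaginary part of a logarithm is bounded by \<open>pi\<close>; its real part is bounded below because the
  argument stays away from 0, and above through \<open>norm w + x \<le> (1 + norm w) * (1 + x)\<close>.\<close>
lemma integrable_Ln_shift:
  assumes M: "finite_measure M" "sets M = sets borel"
    and int: "integrable M (\<lambda>x. ln (1 + \<bar>x\<bar>))" and w: "w \<notin> \<real>\<^sub>\<le>\<^sub>0"
  shows "integrable M (\<lambda>x. Ln (w + of_real \<bar>x\<bar>))"
proof -
  interpret finite_measure M by fact
  have [measurable_cong]: "sets M = sets borel" by fact
  obtain r where r: "r > 0" "\<And>u x. u \<in> ball w r \<Longrightarrow> 0 \<le> x \<Longrightarrow> r \<le> norm (u + of_real x)"
    using slit_plane_ball_bound[OF w] by metis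
  show ?thesis
  proof (rule Bochner_Integration.integrable_bound[where f="\<lambda>x. \<bar>ln r\<bar> + ln (1 + norm w) + ln (1 + \<bar>x\<bar>) + pi"])
    show "integrable M (\<lambda>x. \<bar>ln r\<bar> + ln (1 + norm w) + ln (1 + \<bar>x\<bar>) + pi)"
      using int by simp
    show "(\<lambda>x. Ln (w + of_real \<bar>x\<bar>)) \<in> borel_measurable M" using w by simp
    show "AE x in M. norm (Ln (w + of_real \<bar>x\<bar>)) \<le> norm (\<bar>ln r\<bar> + ln (1 + norm w) + ln (1 + \<bar>x\<bar>) + pi)"
    proof (rule AE_I2)
      fix x
      define v where "v = w + of_real \<bar>x\<bar>"
      have v: "r \<le> norm v" unfolding v_def using r by simp
      then have v0: "v \<noteq> 0" "norm v > 0" using r(1) by auto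
      have "norm v \<le> norm w + \<bar>x\<bar>" unfolding v_def by (metis norm_of_real norm_triangle_ineq abs_abs)
      also have "\<dots> \<le> (1 + norm w) * (1 + \<bar>x\<bar>)" by (simp add: algebra_simps)
      finally have "ln (norm v) \<le> ln ((1 + norm w) * (1 + \<bar>x\<bar>))"
        using v0(2) by (intro ln_mono) auto
      also have "\<dots> = ln (1 + norm w) + ln (1 + \<bar>x\<bar>)"
        by (subst ln_mult_pos) (auto simp: add_pos_nonneg)
      finally have u: "ln (norm v) \<le> ln (1 + norm w) + ln (1 + \<bar>x\<bar>)" .
      have l: "ln r \<le> ln (norm v)" using v v0 r(1) by simp
      have nn: "0 \<le> ln (1 + norm w)" "0 \<le> ln (1 + \<bar>x\<bar>)" by auto
      have "norm (Ln v) \<le> \<bar>Re (Ln v)\<bar> + \<bar>Im (Ln v)\<bar>" by (rule cmod_le)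
      also have "\<bar>Im (Ln v)\<bar> \<le> pi" using v0 mpi_less_Im_Ln[of v] Im_Ln_le_pi[of v] by auto
      also have "\<bar>Re (Ln v)\<bar> \<le> \<bar>ln r\<bar> + ln (1 + norm w) + ln (1 + \<bar>x\<bar>)"
        unfolding Re_Ln[OF v0(1)] using u l nn by linarith
      finally show "norm (Ln (w + of_real \<bar>x\<bar>)) \<le> norm (\<bar>ln r\<bar> + ln (1 + norm w) + ln (1 + \<bar>x\<bar>) + pi)"
        using nn by (simp add: v_def)
    qed
  qed
qed

lemma holomorphic_LINT_Ln:
  assumes M: "finite_measure M" "sets M = sets borel"
    and int: "integrable M (\<lambda>x. ln (1 + \<bar>x\<bar>))"
  shows "(\<lambda>z. LINT x|M. Ln (z + of_real \<bar>x\<bar>)) holomorphic_on (- \<real>\<^sub>\<le>\<^sub>0)"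
proof (rule holomorphic_onI)
  fix z :: complex assume "z \<in> - \<real>\<^sub>\<le>\<^sub>0"
  then have z: "z \<notin> \<real>\<^sub>\<le>\<^sub>0" by simp
  obtain r where r: "r > 0" "\<And>w. w \<in> ball z r \<Longrightarrow> w \<notin> \<real>\<^sub>\<le>\<^sub>0"
    "\<And>w x. w \<in> ball z r \<Longrightarrow> 0 \<le> x \<Longrightarrow> r \<le> norm (w + of_real x)"
    using slit_plane_ball_bound[OF z] by metis
  have "((\<lambda>w. LINT x|M. Ln (w + of_real \<bar>x\<bar>)) has_field_derivative (LINT x|M. 1 / (z + of_real \<bar>x\<bar>))) (at z)"
  proof (rule has_field_derivative_LINT[OF M r(1), where B = "1 / r"])
    show "((\<lambda>w. Ln (w + of_real \<bar>x\<bar>)) has_field_derivative 1 / (w + of_real \<bar>x\<bar>)) (at w)"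
      if "w \<in> ball z r" for w x
      using slit_plane_add_nonneg[OF r(2)[OF that], of "\<bar>x\<bar>"]
      by (auto intro!: derivative_eq_intros simp: divide_inverse)
    show "norm (1 / (w + of_real \<bar>x\<bar>)) \<le> 1 / r" if "w \<in> ball z r" for w x
      using r(3)[OF that, of "\<bar>x\<bar>"] r(1) by (auto simp: norm_divide intro!: divide_left_mono mult_pos_pos)
    show "integrable M (\<lambda>x. Ln (w + of_real \<bar>x\<bar>))" if "w \<in> ball z r" for w
      by (rule integrable_Ln_shift[OF M int r(2)[OF that]])
  qed measurable
  then show "(\<lambda>z. LINT x|M. Ln (z + of_real \<bar>x\<bar>)) field_differentiable at z within - \<real>\<^sub>\<le>\<^sub>0"
    using field_differentiable_at_within field_differentiable_def by blast
qed

lemma integrable_Stieltjes_kernel: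
  assumes M: "finite_measure M" "sets M = sets borel" and z: "z \<notin> \<real>\<^sub>\<le>\<^sub>0"
  shows "integrable M (\<lambda>x. 1 / (z + complex_of_real \<bar>x\<bar>))"
proof -
  interpret finite_measure M by fact
  have [measurable_cong]: "sets M = sets borel" by fact
  obtain r where r: "r > 0" "\<And>w x. w \<in> ball z r \<Longrightarrow> 0 \<le> x \<Longrightarrow> r \<le> norm (w + of_real x)"
    using slit_plane_ball_bound[OF z] by metis
  have "norm (1 / (z + complex_of_real \<bar>x\<bar>)) \<le> 1 / r" for x
    using r(2)[of z "\<bar>x\<bar>"] r(1) by (auto simp: norm_divide intro!: divide_left_mono mult_pos_pos)
  then show ?thesis by (intro integrable_const_bound[where B="1/r"]) auto
qed

lemma holomorphic_LINT_Stieltjes_kernel: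
  assumes M: "finite_measure M" "sets M = sets borel"
  shows "(\<lambda>z. LINT x|M. 1 / (z + complex_of_real \<bar>x\<bar>)) holomorphic_on (- \<real>\<^sub>\<le>\<^sub>0)"
proof (rule holomorphic_onI)
  fix z :: complex assume "z \<in> - \<real>\<^sub>\<le>\<^sub>0"
  then have z: "z \<notin> \<real>\<^sub>\<le>\<^sub>0" by simp
  obtain r where r: "r > 0" "\<And>w. w \<in> ball z r \<Longrightarrow> w \<notin> \<real>\<^sub>\<le>\<^sub>0"
    "\<And>w x. w \<in> ball z r \<Longrightarrow> 0 \<le> x \<Longrightarrow> r \<le> norm (w + of_real x)"
    using slit_plane_ball_bound[OF z] by metis
  have "((\<lambda>w. LINT x|M. 1 / (w + complex_of_real \<bar>x\<bar>)) has_field_derivative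
      (LINT x|M. - (1 / (z + complex_of_real \<bar>x\<bar>)\<^sup>2))) (at z)"
  proof (rule has_field_derivative_LINT[OF M r(1), where B = "1 / r\<^sup>2"])
    show "((\<lambda>w. 1 / (w + complex_of_real \<bar>x\<bar>)) has_field_derivative - (1 / (w + complex_of_real \<bar>x\<bar>)\<^sup>2)) (at w)"
      if "w \<in> ball z r" for w x
      using r(3)[OF that, of "\<bar>x\<bar>"] r(1)
      by (auto intro!: derivative_eq_intros simp: power2_eq_square)
    show "norm (- (1 / (w + complex_of_real \<bar>x\<bar>)\<^sup>2)) \<le> 1 / r\<^sup>2" if "w \<in> ball z r" for w x
      using r(3)[OF that, of "\<bar>x\<bar>"] r(1)
      by (auto simp: norm_divide norm_power intro!: divide_left_mono mult_pos_pos power_mono)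
    show "integrable M (\<lambda>x. 1 / (w + complex_of_real \<bar>x\<bar>))" if "w \<in> ball z r" for w
      by (rule integrable_Stieltjes_kernel[OF M r(2)[OF that]])
  qed measurable
  then show "(\<lambda>z. LINT x|M. 1 / (z + complex_of_real \<bar>x\<bar>)) field_differentiable at z within - \<real>\<^sub>\<le>\<^sub>0"
    using field_differentiable_at_within field_differentiable_def by blast
qed

lemma connected_slit_plane: "connected (- \<real>\<^sub>\<le>\<^sub>0 :: complex set)"
proof -
  have "(\<real>\<^sub>\<le>\<^sub>0 :: complex set) = complex_of_real ` {..0}"
    by (auto simp: nonpos_Reals_def image_iff)
  then show ?thesis
    using starlike_slotted_complex_plane_left[of 0] starlike_imp_connected by auto
qed

text \<open>Both sides are holomorphic on the slit plane and agree on the positive half-line, so the identity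
  theorem applies. Writing \<open>\<bar>x\<bar>\<close> instead of \<open>x\<close> makes the integrands holomorphic in \<open>z\<close> for every real
  \<open>x\<close>; for measures on the nonnegative half-line the two forms agree almost everywhere.\<close>
lemma Stieltjes_transform_continuation:
  fixes \<mu> \<nu> :: "real measure"
  assumes M: "finite_measure \<mu>" "sets \<mu> = sets borel"
    and N: "finite_measure \<nu>" "sets \<nu> = sets borel" "integrable \<nu> (\<lambda>x. ln (1 + \<bar>x\<bar>))"
    and H: "\<And>t. 0 < t \<Longrightarrow> (LINT x|\<mu>. 1 / (t + \<bar>x\<bar>)) = exp (- (LINT x|\<nu>. ln (t + \<bar>x\<bar>)))"
    and z: "z \<notin> \<real>\<^sub>\<le>\<^sub>0"
  shows "(LINT x|\<mu>. 1 / (z + complex_of_real \<bar>x\<bar>)) = exp (- (LINT x|\<nu>. Ln (z + of_real \<bar>x\<bar>)))"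
proof -
  let ?S = "- \<real>\<^sub>\<le>\<^sub>0 :: complex set"
  let ?f = "\<lambda>z. (LINT x|\<mu>. 1 / (z + complex_of_real \<bar>x\<bar>)) - exp (- (LINT x|\<nu>. Ln (z + of_real \<bar>x\<bar>)))"
  have "?f z = 0"
  proof (rule analytic_continuation[of ?f ?S "complex_of_real ` {0<..}" 1])
    show "?f holomorphic_on ?S"
      by (intro holomorphic_intros holomorphic_LINT_Ln holomorphic_LINT_Stieltjes_kernel M N)
    show "open ?S" by (simp add: closed_nonpos_Reals_complex open_Compl)
    show "connected ?S" by (rule connected_slit_plane)
    show "complex_of_real ` {0<..} \<subseteq> ?S" by auto
    show "1 \<in> ?S" by simp
    show "1 islimpt complex_of_real ` {0<..}"
      unfolding islimpt_approachable
    proof (intro allI impI)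
      fix e :: real assume "e > 0"
      then have "dist (complex_of_real (1 + e/2)) 1 < e"
        unfolding dist_norm by (simp add: norm_divide)
      then show "\<exists>x'\<in>complex_of_real ` {0<..}. x' \<noteq> 1 \<and> dist x' 1 < e"
        using \<open>e > 0\<close> by (intro bexI[of _ "complex_of_real (1 + e/2)"]) (auto simp del: of_real_add simp add: of_real_eq_1_iff)
    qed
    show "z \<in> ?S" using z by simp
    fix w assume "w \<in> complex_of_real ` {0<..}"
    then obtain t where t: "t > 0" "w = of_real t" by auto
    have 1: "(LINT x|\<mu>. 1 / (w + complex_of_real \<bar>x\<bar>)) = of_real (LINT x|\<mu>. 1 / (t + \<bar>x\<bar>))"
      unfolding t integral_complex_of_real[symmetric] by simp
    have "(LINT x|\<nu>. Ln (w + of_real \<bar>x\<bar>)) = (LINT x|\<nu>. complex_of_real (ln (t + \<bar>x\<bar>)))"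
      using t by (intro Bochner_Integration.integral_cong) (simp_all add: Ln_of_real[symmetric])
    then have 2: "(LINT x|\<nu>. Ln (w + of_real \<bar>x\<bar>)) = of_real (LINT x|\<nu>. ln (t + \<bar>x\<bar>))"
      by simp
    show "?f w = 0" unfolding 1 2 H[OF t(1)] by (simp flip: exp_of_real)
  qed
  then show ?thesis by simp
qed

text \<open>At \<open>z = - y + \<i> e\<close> the imaginary part of the Stieltjes kernel is, up to sign, the Poisson kernel of
  the upper half-plane at height \<open>e\<close>. The exponential on the other side splits into a modulus, which is a
  smoothed form of \<open>exp (- Phi \<nu> y)\<close>, and the sine of an averaged argument, which is a smoothed form of
  \<open>pi * cdf \<nu> y\<close>.\<close>
lemma Poisson_integral_Stieltjes_pair:
  fixes \<mu> \<nu> :: "real measure"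
  assumes M: "finite_measure \<mu>" "sets \<mu> = sets borel"
    and N: "finite_measure \<nu>" "sets \<nu> = sets borel" "integrable \<nu> (\<lambda>x. ln (1 + \<bar>x\<bar>))"
    and H: "\<And>t. 0 < t \<Longrightarrow> (LINT x|\<mu>. 1 / (t + \<bar>x\<bar>)) = exp (- (LINT x|\<nu>. ln (t + \<bar>x\<bar>)))"
    and e: "e > 0"
  shows "(LINT x|\<mu>. e / ((\<bar>x\<bar> - y)\<^sup>2 + e\<^sup>2)) =
      exp (- (LINT x|\<nu>. ln ((\<bar>x\<bar> - y)\<^sup>2 + e\<^sup>2) / 2)) * sin (LINT x|\<nu>. Im (Ln (Complex (\<bar>x\<bar> - y) e)))"
    and "integrable \<nu> (\<lambda>x. ln ((\<bar>x\<bar> - y)\<^sup>2 + e\<^sup>2) / 2)"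
    and "integrable \<nu> (\<lambda>x. Im (Ln (Complex (\<bar>x\<bar> - y) e)))"
proof -
  define z where "z = Complex (- y) e"
  have z: "z \<notin> \<real>\<^sub>\<le>\<^sub>0" using e by (auto simp: z_def complex_nonpos_Reals_iff)
  have zx: "z + of_real \<bar>x\<bar> = Complex (\<bar>x\<bar> - y) e" for x by (simp add: z_def complex_eq_iff)
  have nz: "Complex (\<bar>x\<bar> - y) e \<noteq> 0" for x using e by (simp add: complex_eq_iff)
  have re: "Re (Ln (Complex (\<bar>x\<bar> - y) e)) = ln ((\<bar>x\<bar> - y)\<^sup>2 + e\<^sup>2) / 2" for x
    using e by (simp add: Re_Ln[OF nz] cmod_def ln_sqrt add_nonneg_pos)
  have im: "Im (1 / Complex (\<bar>x\<bar> - y) e) = - (e / ((\<bar>x\<bar> - y)\<^sup>2 + e\<^sup>2))" for x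
    by (simp add: Im_divide)
  note iL = integrable_Ln_shift[OF N z, unfolded zx]
  note iS = integrable_Stieltjes_kernel[OF M z, unfolded zx]
  show "integrable \<nu> (\<lambda>x. ln ((\<bar>x\<bar> - y)\<^sup>2 + e\<^sup>2) / 2)"
    using integrable_Re[OF iL] by (simp only: re)
  show "integrable \<nu> (\<lambda>x. Im (Ln (Complex (\<bar>x\<bar> - y) e)))"
    using integrable_Im[OF iL] .
  have "Im (LINT x|\<mu>. 1 / Complex (\<bar>x\<bar> - y) e) = Im (exp (- (LINT x|\<nu>. Ln (Complex (\<bar>x\<bar> - y) e))))"
    using Stieltjes_transform_continuation[OF M N H z] by (simp add: zx)
  then have "- (LINT x|\<mu>. e / ((\<bar>x\<bar> - y)\<^sup>2 + e\<^sup>2)) =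
      - (exp (- (LINT x|\<nu>. ln ((\<bar>x\<bar> - y)\<^sup>2 + e\<^sup>2) / 2)) * sin (LINT x|\<nu>. Im (Ln (Complex (\<bar>x\<bar> - y) e))))"
    unfolding Im_exp integral_Im[OF iS, symmetric] im uminus_complex.sel
      integral_Im[OF iL, symmetric] integral_Re[OF iL, symmetric] re by simp
  then show "(LINT x|\<mu>. e / ((\<bar>x\<bar> - y)\<^sup>2 + e\<^sup>2)) =
      exp (- (LINT x|\<nu>. ln ((\<bar>x\<bar> - y)\<^sup>2 + e\<^sup>2) / 2)) * sin (LINT x|\<nu>. Im (Ln (Complex (\<bar>x\<bar> - y) e)))"
    by simp
qed

lemma Im_Ln_upper_half_plane:
  assumes e: "e > 0"
  shows "Im (Ln (Complex u e)) = pi / 2 - arctan (u / e)"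
proof -
  have nz: "Complex u e \<noteq> 0" using e by (simp add: complex_eq_iff)
  consider "u = 0" | "u > 0" | "u < 0" by linarith
  then show ?thesis
  proof cases
    case 1
    then show ?thesis using nz e Im_Ln_eq_pi_half(1)[of "Complex 0 e"] by simp
  next
    case 2
    then have "arctan (e / u) = pi / 2 - arctan (u / e)"
      using arctan_inverse[of "u / e"] e by simp
    then show ?thesis using 2 by (subst Im_Ln_eq[OF nz]) simp
  next
    case 3
    then have "u / e < 0" using e by (simp add: divide_neg_pos)
    then have "arctan (e / u) = - (pi / 2) - arctan (u / e)"
      using arctan_inverse[of "- u / e"] e by (simp add: arctan_minus)
    then show ?thesis using 3 e by (subst Im_Ln_eq[OF nz]) simp
  qed
qed

section \<open>Boundary values on the negative half-line\<close>

text \<open>The hypothesis in terms of \<open>1 + l x\<close> becomes the one in terms of \<open>t + x\<close> under \<open>t = 1 / l\<close>: since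
  \<open>\<nu>\<close> has mass 1, the factor \<open>1 / t\<close> on the left matches the summand \<open>ln t\<close> under the logarithmic
  integral on the right.\<close>
lemma Stieltjes_pair_Poisson:
  fixes \<mu> \<nu> :: "real measure"
  assumes M: "finite_measure \<mu>" "sets \<mu> = sets borel" "AE x in \<mu>. 0 \<le> x"
    and N: "prob_space \<nu>" "sets \<nu> = sets borel" "AE x in \<nu>. 0 \<le> x"
    and int: "\<And>l. 0 < l \<Longrightarrow> integrable \<nu> (\<lambda>x. ln (1 + l * x))"
    and H: "\<And>l. 0 < l \<Longrightarrow> (LINT x|\<mu>. 1 / (1 + l * x)) = exp (- (LINT x|\<nu>. ln (1 + l * x)))"
    and e: "e > 0"
  shows "(LINT x|\<mu>. e / ((x - y)\<^sup>2 + e\<^sup>2)) =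
      exp (- (LINT x|\<nu>. ln ((x - y)\<^sup>2 + e\<^sup>2) / 2)) * sin (LINT x|\<nu>. pi / 2 - arctan ((x - y) / e))"
    and "integrable \<nu> (\<lambda>x. ln ((x - y)\<^sup>2 + e\<^sup>2) / 2)"
proof -
  interpret m: finite_measure \<mu> by fact
  interpret n: prob_space \<nu> by fact
  have [measurable_cong]: "sets \<mu> = sets borel" "sets \<nu> = sets borel" by fact+
  have abs: "AE x in \<mu>. \<bar>x\<bar> = x" "AE x in \<nu>. \<bar>x\<bar> = x" using M(3) N(3) by auto
  have i: "integrable \<nu> (\<lambda>x. ln (1 + l * \<bar>x\<bar>))" if "0 < l" for l
    using int[OF that] abs(2)
    by (subst integrable_cong_AE[where g="\<lambda>x. ln (1 + l * x)"]) (auto elim: eventually_mono)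
  have H': "(LINT x|\<mu>. 1 / (t + \<bar>x\<bar>)) = exp (- (LINT x|\<nu>. ln (t + \<bar>x\<bar>)))" if t: "0 < t" for t
  proof -
    have "(LINT x|\<mu>. 1 / (t + \<bar>x\<bar>)) = (LINT x|\<mu>. 1 / t * (1 / (1 + 1 / t * x)))"
      using abs(1) t by (intro integral_cong_AE) (auto elim!: eventually_mono simp: field_simps)
    also have "\<dots> = 1 / t * (LINT x|\<mu>. 1 / (1 + 1 / t * x))"
      by (rule integral_mult_right_zero)
    also have "(LINT x|\<mu>. 1 / (1 + 1 / t * x)) = exp (- (LINT x|\<nu>. ln (1 + 1 / t * x)))"
      using t by (intro H) simp
    also have "1 / t * exp (- (LINT x|\<nu>. ln (1 + 1 / t * x))) = exp (- (ln t + (LINT x|\<nu>. ln (1 + 1 / t * x))))"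
      using t by (simp add: exp_add exp_diff exp_minus field_simps)
    also have "ln t + (LINT x|\<nu>. ln (1 + 1 / t * x)) = (LINT x|\<nu>. ln t + ln (1 + 1 / t * x))"
      using int[of "1 / t"] t by (simp add: n.prob_space)
    also have "\<dots> = (LINT x|\<nu>. ln (t + \<bar>x\<bar>))"
    proof (intro integral_cong_AE)
      show "AE x in \<nu>. ln t + ln (1 + 1 / t * x) = ln (t + \<bar>x\<bar>)"
        using N(3)
      proof eventually_elim
        case (elim x)
        have "ln t + ln (1 + 1 / t * x) = ln (t * (1 + 1 / t * x))"
          using t elim by (subst ln_mult_pos) (auto intro!: add_pos_nonneg)
        moreover have "t * (1 + 1 / t * x) = t + x" using t by (simp add: distrib_left)
        ultimately show ?case using elim by simp
      qed
    qed auto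
    finally show ?thesis .
  qed
  have fin: "finite_measure \<nu>" by unfold_locales
  note P = Poisson_integral_Stieltjes_pair[OF M(1,2) fin N(2) _ H' e, of y, unfolded Im_Ln_upper_half_plane[OF e]]
  have i1: "integrable \<nu> (\<lambda>x. ln (1 + \<bar>x\<bar>))" using i[of 1] by simp
  have "(LINT x|\<mu>. e / ((x - y)\<^sup>2 + e\<^sup>2)) = (LINT x|\<mu>. e / ((\<bar>x\<bar> - y)\<^sup>2 + e\<^sup>2))"
  proof (rule integral_cong_AE)
    show "AE x in \<mu>. e / ((x - y)\<^sup>2 + e\<^sup>2) = e / ((\<bar>x\<bar> - y)\<^sup>2 + e\<^sup>2)"
      using abs(1) by eventually_elim simp
  qed auto
  also have "\<dots> = exp (- (LINT x|\<nu>. ln ((\<bar>x\<bar> - y)\<^sup>2 + e\<^sup>2) / 2)) * sin (LINT x|\<nu>. pi / 2 - arctan ((\<bar>x\<bar> - y) / e))"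
    by (rule P(1)[OF i1])
  also have "(LINT x|\<nu>. ln ((\<bar>x\<bar> - y)\<^sup>2 + e\<^sup>2) / 2) = (LINT x|\<nu>. ln ((x - y)\<^sup>2 + e\<^sup>2) / 2)"
    by (intro integral_cong_AE) (use abs(2) in \<open>auto elim!: eventually_mono\<close>)
  also have "(LINT x|\<nu>. pi / 2 - arctan ((\<bar>x\<bar> - y) / e)) = (LINT x|\<nu>. pi / 2 - arctan ((x - y) / e))"
    by (intro integral_cong_AE) (use abs(2) in \<open>auto elim!: eventually_mono\<close>)
  finally show "(LINT x|\<mu>. e / ((x - y)\<^sup>2 + e\<^sup>2)) =
      exp (- (LINT x|\<nu>. ln ((x - y)\<^sup>2 + e\<^sup>2) / 2)) * sin (LINT x|\<nu>. pi / 2 - arctan ((x - y) / e))" .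
  show "integrable \<nu> (\<lambda>x. ln ((x - y)\<^sup>2 + e\<^sup>2) / 2)"
    using P(2)[OF i1] abs(2)
    by (subst integrable_cong_AE[where g="\<lambda>x. ln ((\<bar>x\<bar> - y)\<^sup>2 + e\<^sup>2) / 2"]) (auto elim: eventually_mono)
qed

lemma arctan_scaled_limit:
  "(\<lambda>n. arctan (u / inverse (real (Suc n)))) \<longlonglongrightarrow> pi / 2 * sgn u"
proof -
  have T: "filterlim (\<lambda>n. real (Suc n)) at_top sequentially"
    using filterlim_Suc filterlim_real_sequentially filterlim_compose by blast
  consider "u = 0" | "u > 0" | "u < 0" by linarith
  then show ?thesis
  proof cases
    case 2
    have "filterlim (\<lambda>n. u * real (Suc n)) at_top sequentially"
      using T 2 by (intro filterlim_tendsto_pos_mult_at_top[OF tendsto_const]) auto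
    from filterlim_compose[OF tendsto_arctan_at_top this] 2 show ?thesis by (simp add: field_simps)
  next
    case 3
    have "filterlim (\<lambda>n. u * real (Suc n)) at_bot sequentially"
      using T 3 by (intro filterlim_tendsto_neg_mult_at_bot[OF tendsto_const]) auto
    from filterlim_compose[OF tendsto_arctan_at_bot this] 3 show ?thesis by (simp add: field_simps)
  qed simp
qed

text \<open>These bounds do not depend on \<open>e\<close>, so they dominate the regularised logarithms as \<open>e\<close> tends to 0.\<close>
lemma log_kernel_bounds:
  fixes x y e :: real
  assumes "x \<noteq> y" "0 < e" "e \<le> 1"
  shows "ln \<bar>x - y\<bar> \<le> ln ((x - y)\<^sup>2 + e\<^sup>2) / 2"
    and "ln ((x - y)\<^sup>2 + e\<^sup>2) / 2 \<le> ln (1 + \<bar>x\<bar>) + ln (1 + \<bar>y\<bar>)"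
proof -
  have "ln (\<bar>x - y\<bar>\<^sup>2) = 2 * ln \<bar>x - y\<bar>" using assms(1) by (subst ln_realpow) auto
  then have "ln \<bar>x - y\<bar> = ln (\<bar>x - y\<bar>\<^sup>2) / 2" by linarith
  also have "\<dots> \<le> ln ((x - y)\<^sup>2 + e\<^sup>2) / 2" using assms by (intro divide_right_mono ln_mono) auto
  finally show "ln \<bar>x - y\<bar> \<le> ln ((x - y)\<^sup>2 + e\<^sup>2) / 2" .
  have "e\<^sup>2 \<le> 1" using assms by (simp add: power_le_one)
  then have "(x - y)\<^sup>2 + e\<^sup>2 \<le> (1 + \<bar>x - y\<bar>)\<^sup>2"
  proof -
    have "(1 + \<bar>x - y\<bar>)\<^sup>2 = 1 + 2 * \<bar>x - y\<bar> + (x - y)\<^sup>2" by (simp add: power2_sum)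
    moreover have "e\<^sup>2 \<le> 1 + 2 * \<bar>x - y\<bar>" using \<open>e\<^sup>2 \<le> 1\<close> by (rule order_trans) simp
    ultimately show ?thesis by simp
  qed
  also have "\<dots> \<le> ((1 + \<bar>x\<bar>) * (1 + \<bar>y\<bar>))\<^sup>2"
  proof (rule power_mono)
    have "1 + \<bar>x - y\<bar> \<le> 1 + \<bar>x\<bar> + \<bar>y\<bar>" by linarith
    also have "\<dots> \<le> (1 + \<bar>x\<bar>) * (1 + \<bar>y\<bar>)" by (simp add: algebra_simps)
    finally show "1 + \<bar>x - y\<bar> \<le> (1 + \<bar>x\<bar>) * (1 + \<bar>y\<bar>)" .
  qed auto
  finally have "ln ((x - y)\<^sup>2 + e\<^sup>2) / 2 \<le> ln (((1 + \<bar>x\<bar>) * (1 + \<bar>y\<bar>))\<^sup>2) / 2"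
    using assms by (intro divide_right_mono ln_mono) (auto intro: add_nonneg_pos)
  also have "\<dots> = ln ((1 + \<bar>x\<bar>) * (1 + \<bar>y\<bar>))" by (simp add: ln_realpow add_pos_nonneg)
  also have "\<dots> = ln (1 + \<bar>x\<bar>) + ln (1 + \<bar>y\<bar>)" by (subst ln_mult_pos) auto
  finally show "ln ((x - y)\<^sup>2 + e\<^sup>2) / 2 \<le> ln (1 + \<bar>x\<bar>) + ln (1 + \<bar>y\<bar>)" .
qed

text \<open>The argument of \<open>(x - y) + \<i> e\<close> tends to \<open>pi\<close> for \<open>x < y\<close> and to 0 for \<open>x > y\<close>, so its average over
  \<open>\<nu>\<close> tends to \<open>pi * cdf \<nu> y\<close>. This is where the sine of the distribution function in the density comes
  from. The point \<open>x = y\<close>, where the limit would be \<open>pi / 2\<close>, is excluded because \<open>y\<close> is not an atom.\<close>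
lemma Stieltjes_boundary_value:
  fixes \<nu> :: "real measure"
  assumes N: "prob_space \<nu>" "sets \<nu> = sets borel"
    and i1: "integrable \<nu> (\<lambda>x. ln (1 + \<bar>x\<bar>))"
    and y: "measure \<nu> {y} = 0" "integrable \<nu> (\<lambda>x. ln \<bar>x - y\<bar>)"
  shows "(\<lambda>n. exp (- (LINT x|\<nu>. ln ((x - y)\<^sup>2 + (inverse (real (Suc n)))\<^sup>2) / 2)) *
              sin (LINT x|\<nu>. pi / 2 - arctan ((x - y) / inverse (real (Suc n)))))
         \<longlonglongrightarrow> exp (- (LINT x|\<nu>. ln \<bar>x - y\<bar>)) * sin (pi * cdf \<nu> y)"
proof -
  interpret n: prob_space \<nu> by fact
  have [measurable_cong]: "sets \<nu> = sets borel" by fact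
  have sp: "space \<nu> = UNIV" using N(2)[THEN sets_eq_imp_space_eq] by simp
  have ne: "AE x in \<nu>. x \<noteq> y"
    using AE_not_in[of "{y}" \<nu>] y(1) by (auto simp: null_sets_def n.emeasure_eq_measure)
  define e where "e n = inverse (real (Suc n))" for n
  have e: "0 < e n" "e n \<le> 1" for n by (auto simp: e_def field_simps)
  have elim: "e \<longlonglongrightarrow> 0" unfolding e_def by (rule LIMSEQ_inverse_real_of_nat)
  have A: "(\<lambda>n. LINT x|\<nu>. ln ((x - y)\<^sup>2 + (e n)\<^sup>2) / 2) \<longlonglongrightarrow> (LINT x|\<nu>. ln \<bar>x - y\<bar>)"
  proof (rule integral_dominated_convergence[where w="\<lambda>x. \<bar>ln \<bar>x - y\<bar>\<bar> + ln (1 + \<bar>x\<bar>) + ln (1 + \<bar>y\<bar>)"])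
    show "AE x in \<nu>. (\<lambda>n. ln ((x - y)\<^sup>2 + (e n)\<^sup>2) / 2) \<longlonglongrightarrow> ln \<bar>x - y\<bar>"
      using ne
    proof eventually_elim
      case (elim x)
      have "(\<lambda>n. ln ((x - y)\<^sup>2 + (e n)\<^sup>2) / 2) \<longlonglongrightarrow> ln ((x - y)\<^sup>2 + 0\<^sup>2) / 2"
        using elim \<open>e \<longlonglongrightarrow> 0\<close> by (intro tendsto_intros) auto
      also have "ln ((x - y)\<^sup>2 + 0\<^sup>2) / 2 = ln \<bar>x - y\<bar>"
        using elim ln_realpow[of "\<bar>x - y\<bar>" 2] by simp
      finally show ?case .
    qed
    show "AE x in \<nu>. norm (ln ((x - y)\<^sup>2 + (e n)\<^sup>2) / 2) \<le> \<bar>ln \<bar>x - y\<bar>\<bar> + ln (1 + \<bar>x\<bar>) + ln (1 + \<bar>y\<bar>)" for n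
      using ne
    proof eventually_elim
      case (elim x)
      have "0 \<le> ln (1 + \<bar>x\<bar>)" "0 \<le> ln (1 + \<bar>y\<bar>)" by auto
      with log_kernel_bounds[OF elim e, of n] show ?case unfolding real_norm_def by linarith
    qed
  qed (use i1 y(2) in auto)
  have B: "(\<lambda>n. LINT x|\<nu>. pi / 2 - arctan ((x - y) / e n)) \<longlonglongrightarrow> (LINT x|\<nu>. pi * indicator {..y} x)"
  proof (rule integral_dominated_convergence[where w="\<lambda>x. pi"])
    show "AE x in \<nu>. (\<lambda>n. pi / 2 - arctan ((x - y) / e n)) \<longlonglongrightarrow> pi * indicator {..y} x"
      using ne
    proof eventually_elim
      case (elim x)
      have "(\<lambda>n. pi / 2 - arctan ((x - y) / e n)) \<longlonglongrightarrow> pi / 2 - pi / 2 * sgn (x - y)"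
        unfolding e_def by (intro tendsto_intros arctan_scaled_limit)
      also have "pi / 2 - pi / 2 * sgn (x - y) = pi * indicator {..y} x"
        using elim by (auto simp: sgn_if indicator_def)
      finally show ?case .
    qed
    show "AE x in \<nu>. norm (pi / 2 - arctan ((x - y) / e n)) \<le> pi" for n
    proof (rule AE_I2)
      fix x
      show "norm (pi / 2 - arctan ((x - y) / e n)) \<le> pi"
        using arctan_bounded[of "(x - y) / e n"] unfolding real_norm_def by linarith
    qed
  qed auto
  have "(LINT x|\<nu>. pi * indicator {..y} x) = pi * cdf \<nu> y" by (simp add: cdf_def sp)
  with B have B': "(\<lambda>n. LINT x|\<nu>. pi / 2 - arctan ((x - y) / e n)) \<longlonglongrightarrow> pi * cdf \<nu> y" by simp
  show ?thesis unfolding e_def[symmetric] by (intro tendsto_intros A B')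
qed

section \<open>Domination of the boundary values\<close>

text \<open>A distribution function with values 0 and 1 only belongs to a unit mass at the place where it
  jumps. Otherwise some \<open>{..c}\<close> and some \<open>{d<..}\<close> with \<open>c < d\<close> both have positive mass, and an open
  interval of length at most \<open>d - c\<close> misses one of them. The bound \<open>q\<close> below 1, uniform in the centre, is
  what makes the exponent in the domination below subcritical.\<close>
lemma no_unit_atom_local_mass:
  fixes \<nu> :: "real measure"
  assumes N: "prob_space \<nu>" "sets \<nu> = sets borel" and atom: "\<And>x. measure \<nu> {x} \<noteq> 1"
  obtains r q where "0 < r" "r \<le> 1" "0 < q" "q < 1" "\<And>y. measure \<nu> {x. \<bar>x - y\<bar> < r} \<le> q"
proof -
  interpret real_distribution \<nu>
    using N by (simp add: real_distribution_def real_distribution_axioms_def)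
  have "\<exists>c. 0 < cdf \<nu> c \<and> cdf \<nu> c < 1"
  proof (rule ccontr)
    assume "\<not> ?thesis"
    then have z1: "cdf \<nu> c = 0 \<or> cdf \<nu> c = 1" for c
      using cdf_nonneg[of c] cdf_bounded_prob[of c] by (metis order_le_less)
    define A where "A = {c. cdf \<nu> c = 1}"
    have "eventually (\<lambda>x. cdf \<nu> x > 1/2) at_top"
      using cdf_lim_at_top_prob by (rule order_tendstoD) simp
    then obtain u where "cdf \<nu> u > 1/2" by (auto simp: eventually_at_top_linorder)
    then have A: "u \<in> A" using z1[of u] by (auto simp: A_def)
    have "eventually (\<lambda>x. cdf \<nu> x < 1/2) at_bot"
      using cdf_lim_at_bot by (rule order_tendstoD) simp
    then obtain l where l: "cdf \<nu> l < 1/2" by (auto simp: eventually_at_bot_linorder)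
    have bdd: "bdd_below A"
    proof (rule bdd_belowI[of _ l])
      fix x assume "x \<in> A"
      then show "l \<le> x" using l cdf_nondecreasing[of x l] by (force simp: A_def)
    qed
    define s where "s = Inf A"
    have up: "cdf \<nu> (s + e) = 1" if "e > 0" for e
    proof -
      have "Inf A < s + e" using that by (simp add: s_def)
      then obtain a where "a \<in> A" "a < s + e" using A cInf_lessD by blast
      then show ?thesis using cdf_nondecreasing[of a "s + e"] cdf_bounded_prob[of "s + e"] by (auto simp: A_def)
    qed
    have lo: "cdf \<nu> (s - e) = 0" if "e > 0" for e
    proof -
      have "s - e \<notin> A" using cInf_lower[OF _ bdd, of "s - e"] that by (auto simp: s_def)
      then show ?thesis using z1[of "s - e"] by (auto simp: A_def)
    qed
    define I where "I n = {s - inverse (real (Suc n)) <.. s + inverse (real (Suc n))}" for n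
    have "measure \<nu> (I n) = 1" for n
      unfolding I_def by (subst cdf_diff_eq[symmetric]) (use up[of "inverse (real (Suc n))"] lo[of "inverse (real (Suc n))"] in \<open>auto simp: add_pos_pos intro: order.strict_trans2\<close>)
    moreover have "(\<lambda>n. measure \<nu> (I n)) \<longlonglongrightarrow> measure \<nu> (\<Inter>n. I n)"
    proof (rule finite_Lim_measure_decseq)
      show "decseq I" unfolding I_def decseq_def
      proof (intro allI impI)
        fix m n :: nat assume "m \<le> n"
        then have "inverse (real (Suc n)) \<le> inverse (real (Suc m))" by (simp add: le_imp_inverse_le)
        then show "{s - inverse (real (Suc n))<..s + inverse (real (Suc n))} \<subseteq> {s - inverse (real (Suc m))<..s + inverse (real (Suc m))}"
          unfolding subset_iff greaterThanAtMost_iff by (intro allI impI) linarith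
      qed
    qed (auto simp: I_def)
    moreover have "(\<Inter>n. I n) = {s}"
    proof safe
      fix x assume x: "x \<in> (\<Inter>n. I n)"
      show "x = s"
      proof (rule ccontr)
        assume "x \<noteq> s"
        then obtain n where "inverse (real (Suc n)) < \<bar>x - s\<bar>" using reals_Archimedean[of "\<bar>x - s\<bar>"] by auto
        moreover have "x \<in> I n" using x by blast
        ultimately show False unfolding I_def by auto
      qed
    qed (auto simp: I_def)
    ultimately have "measure \<nu> {s} = 1" by (simp add: LIMSEQ_const_iff)
    with atom show False by blast
  qed
  then obtain c where c: "0 < cdf \<nu> c" "cdf \<nu> c < 1" by blast
  have "(cdf \<nu> \<longlongrightarrow> cdf \<nu> c) (at_right c)"
    using cdf_is_right_cont[of c] by (simp add: continuous_within)
  then have "eventually (\<lambda>x. cdf \<nu> x < 1) (at_right c)" using c(2) by (rule order_tendstoD)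
  then obtain b where "b > c" "\<And>y. c < y \<Longrightarrow> y < b \<Longrightarrow> cdf \<nu> y < 1"
    by (auto simp: eventually_at_right_field)
  then obtain d where d: "d > c" "cdf \<nu> d < 1" using dense by blast
  \<comment> \<open>An interval of radius \<open>r\<close> has length at most \<open>d - c\<close>, so it cannot meet both \<open>{..c}\<close> and \<open>{d<..}\<close>.\<close>
  define r where "r = min 1 ((d - c) / 2)"
  define q where "q = max (1/2) (max (1 - cdf \<nu> c) (cdf \<nu> d))"
  show thesis
  proof
    show "0 < r" "r \<le> 1" "0 < q" "q < 1" using c d by (auto simp: r_def q_def)
    show "measure \<nu> {x. \<bar>x - y\<bar> < r} \<le> q" for y
    proof (cases "\<exists>x. \<bar>x - y\<bar> < r \<and> x \<le> c")
      case True
      then obtain x where x: "\<bar>x - y\<bar> < r" "x \<le> c" by blast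
      have "{x. \<bar>x - y\<bar> < r} \<subseteq> {..d}"
      proof safe
        fix w assume "\<bar>w - y\<bar> < r"
        with x have "w - x < 2 * r" by (auto simp: abs_if split: if_splits)
        moreover have "r \<le> (d - c) / 2" unfolding r_def by (rule min.cobounded2)
        ultimately show "w \<le> d" using x(2) by (simp add: field_simps)
      qed
      then have "measure \<nu> {x. \<bar>x - y\<bar> < r} \<le> cdf \<nu> d"
        unfolding cdf_def by (intro finite_measure_mono) auto
      then show ?thesis by (simp add: q_def)
    next
      case False
      then have "{x. \<bar>x - y\<bar> < r} \<subseteq> space \<nu> - {..c}" by auto
      then have "measure \<nu> {x. \<bar>x - y\<bar> < r} \<le> measure \<nu> (space \<nu> - {..c})"
        by (intro finite_measure_mono) auto
      also have "\<dots> = 1 - cdf \<nu> c" unfolding cdf_def by (intro prob_compl) auto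
      finally show ?thesis by (simp add: q_def)
    qed
  qed
qed

text \<open>This is Jensen's inequality for the restriction of \<open>M\<close> to a set \<open>I\<close> of mass at most \<open>q\<close>, applied to
  \<open>exp (q * L)\<close>: the tangent of \<open>exp\<close> at the integral \<open>J\<close> of \<open>L\<close> gives \<open>exp (q * L) \<ge> exp J * (1 + q * L
  - J)\<close>, which is then integrated over \<open>I\<close>. The mass of \<open>I\<close> may be replaced by \<open>q\<close> only when \<open>1 - J\<close> is
  negative; the summand \<open>exp 1\<close> covers the other case.\<close>
lemma exp_integral_le_subprobability:
  fixes L G :: "'a \<Rightarrow> real"
  assumes "prob_space M" and I[measurable]: "I \<in> sets M" and q: "measure M I \<le> q" "0 < q"
    and L[measurable]: "L \<in> borel_measurable M" and L0: "\<And>x. 0 \<le> L x" and off: "\<And>x. x \<notin> I \<Longrightarrow> L x = 0"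
    and G: "integrable M G" "\<And>x. 0 \<le> G x" and LG: "AE x in M. x \<in> I \<longrightarrow> exp (q * L x) \<le> G x"
  shows "integrable M L" and "exp (LINT x|M. L x) \<le> exp 1 + (LINT x|M. G x) / q"
proof -
  interpret prob_space M by fact
  have [measurable]: "G \<in> borel_measurable M" using G(1) by auto
  show intL: "integrable M L"
  proof (rule Bochner_Integration.integrable_bound[where f="\<lambda>x. G x / q"])
    show "AE x in M. norm (L x) \<le> norm (G x / q)"
      using LG
    proof eventually_elim
      case (elim x)
      show ?case
      proof (cases "x \<in> I")
        case True
        have "q * L x \<le> exp (q * L x)" using exp_ge_add_one_self[of "q * L x"] by linarith
        then show ?thesis using elim True L0[of x] G(2)[of x] q by (simp add: field_simps)
      qed (simp add: off)
    qed
  qed (use G in auto)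
  define J where "J = (LINT x|M. L x)"
  have G0: "0 \<le> (LINT x|M. G x)" using G by (simp add: integral_nonneg_AE)
  have "exp J \<le> exp 1 + (LINT x|M. G x) / q"
  proof (cases "J \<le> 1")
    case True
    then have "exp J \<le> exp 1" by simp
    then show ?thesis using G0 q by (simp add: add_increasing2)
  next
    case False
    have "(LINT x|M. exp J * (1 - J) * indicator I x + exp J * q * L x) \<le> (LINT x|M. G x)"
    proof (rule integral_mono_AE)
      show "integrable M (\<lambda>x. exp J * (1 - J) * indicator I x + exp J * q * L x)"
        using intL by (intro Bochner_Integration.integrable_add integrable_mult_right) (auto simp: emeasure_eq_measure)
      show "AE x in M. exp J * (1 - J) * indicator I x + exp J * q * L x \<le> G x"
        using LG
      proof eventually_elim
        case (elim x)
        show ?case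
        proof (cases "x \<in> I")
          case True
          have "exp J * (1 - J) + exp J * q * L x = exp J * (1 + (q * L x - J))" by (simp add: algebra_simps)
          also have "\<dots> \<le> exp J * exp (q * L x - J)" using exp_ge_add_one_self by (intro mult_left_mono) auto
          also have "\<dots> = exp (q * L x)" by (simp add: exp_diff)
          finally show ?thesis using elim True by simp
        qed (use G in \<open>simp add: off\<close>)
      qed
    qed (use G in auto)
    also have "(LINT x|M. exp J * (1 - J) * indicator I x + exp J * q * L x) = exp J * (1 - J) * measure M I + exp J * q * J"
      using intL by (subst Bochner_Integration.integral_add) (auto simp: J_def emeasure_eq_measure Int_absorb2 sets.sets_into_space)
    finally have "exp J * (1 - J) * measure M I + exp J * q * J \<le> (LINT x|M. G x)" .
    moreover have "exp J * (1 - J) * q \<le> exp J * (1 - J) * measure M I"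
      using False q by (intro mult_left_mono_neg) (auto simp: mult_le_0_iff)
    ultimately have "exp J * q \<le> (LINT x|M. G x)" by (simp add: algebra_simps)
    then have "exp J \<le> (LINT x|M. G x) / q" using q by (simp add: field_simps)
    then show ?thesis by (simp add: add_increasing)
  qed
  then show "exp (LINT x|M. L x) \<le> exp 1 + (LINT x|M. G x) / q" by (simp add: J_def)
qed

text \<open>Applying the preceding inequality to the negative logarithm on the interval of radius \<open>r\<close> bounds
  \<open>exp (- \<integral> ln \<bar>x - y\<bar> d\<nu>)\<close> by the Riesz potential \<open>\<integral> \<bar>x - y\<bar> powr - q d\<nu>\<close>. The exponent is the local
  mass \<open>q\<close> and not 1, which is decisive for integrability in \<open>y\<close>. Outside the interval the logarithm is
  at least \<open>ln r\<close>.\<close>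
lemma log_kernel_domination:
  fixes \<nu> :: "real measure"
  assumes N: "prob_space \<nu>" "sets \<nu> = sets borel"
    and i1: "integrable \<nu> (\<lambda>x. ln (1 + \<bar>x\<bar>))"
    and rq: "0 < r" "r \<le> 1" "0 < q" "measure \<nu> {x. \<bar>x - y\<bar> < r} \<le> q"
    and y: "measure \<nu> {y} = 0"
    and W: "(\<integral>\<^sup>+x. ennreal (indicator {x. \<bar>x - y\<bar> < r} x * \<bar>x - y\<bar> powr - q) \<partial>\<nu>) = ennreal w" "0 \<le> w"
  shows "integrable \<nu> (\<lambda>x. ln \<bar>x - y\<bar>)"
    and "\<And>e. 0 < e \<Longrightarrow> e \<le> 1 \<Longrightarrow> integrable \<nu> (\<lambda>x. ln ((x - y)\<^sup>2 + e\<^sup>2) / 2) \<Longrightarrow>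
      exp (- (LINT x|\<nu>. ln ((x - y)\<^sup>2 + e\<^sup>2) / 2)) \<le> (exp 1 + w / q) / r"
proof -
  interpret n: prob_space \<nu> by fact
  have [measurable_cong]: "sets \<nu> = sets borel" by fact
  have ne: "AE x in \<nu>. x \<noteq> y"
    using AE_not_in[of "{y}" \<nu>] y by (auto simp: null_sets_def n.emeasure_eq_measure)
  define I where "I = {x. \<bar>x - y\<bar> < r}"
  define L where "L x = (if x \<in> I then - ln \<bar>x - y\<bar> else 0)" for x
  define G where "G x = indicator I x * \<bar>x - y\<bar> powr - q" for x
  have [measurable]: "I \<in> sets borel" "L \<in> borel_measurable borel" "G \<in> borel_measurable borel"
    unfolding I_def L_def[abs_def] G_def[abs_def] by measurable
  have L0: "0 \<le> L x" for x
    using rq by (cases "x = y") (auto simp: L_def I_def)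
  have G0: "0 \<le> G x" for x by (simp add: G_def)
  have W': "(\<integral>\<^sup>+x. ennreal (G x) \<partial>\<nu>) = ennreal w" using W by (simp add: G_def I_def)
  have intG: "integrable \<nu> G" by (rule integrableI_nn_integral_finite[OF _ _ W']) (auto simp: G0)
  have wG: "(LINT x|\<nu>. G x) = w" using integral_eq_nn_integral[of G \<nu>] W' G0 W(2) by simp
  have LG: "AE x in \<nu>. x \<in> I \<longrightarrow> exp (q * L x) \<le> G x"
    using ne by eventually_elim (auto simp: L_def G_def powr_def)
  note E = exp_integral_le_subprobability[OF N(1) _ rq(4)[folded I_def] rq(3) _ L0 _ intG G0 LG]
  have intL: "integrable \<nu> L" by (rule E) (auto simp: L_def)
  have expL: "exp (LINT x|\<nu>. L x) \<le> exp 1 + w / q" unfolding wG[symmetric] by (rule E) (auto simp: L_def)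
  have lower: "- L x + ln r \<le> ln \<bar>x - y\<bar>" if "x \<noteq> y" for x
    using that rq by (auto simp: L_def I_def not_less)
  show "integrable \<nu> (\<lambda>x. ln \<bar>x - y\<bar>)"
  proof (rule Bochner_Integration.integrable_bound[where f="\<lambda>x. L x + \<bar>ln r\<bar> + ln (1 + \<bar>x\<bar>) + ln (1 + \<bar>y\<bar>)"])
    show "AE x in \<nu>. norm (ln \<bar>x - y\<bar>) \<le> norm (L x + \<bar>ln r\<bar> + ln (1 + \<bar>x\<bar>) + ln (1 + \<bar>y\<bar>))"
      using ne
    proof eventually_elim
      case (elim x)
      have "0 \<le> ln (1 + \<bar>x\<bar>)" "0 \<le> ln (1 + \<bar>y\<bar>)" by auto
      moreover have "ln \<bar>x - y\<bar> \<le> ln (1 + \<bar>x\<bar>) + ln (1 + \<bar>y\<bar>)"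
        using log_kernel_bounds[OF elim, of 1] by simp
      ultimately show ?case using lower[OF elim] L0[of x] unfolding real_norm_def by linarith
    qed
  qed (use intL i1 in auto)
  fix e :: real assume e: "0 < e" "e \<le> 1" and ie: "integrable \<nu> (\<lambda>x. ln ((x - y)\<^sup>2 + e\<^sup>2) / 2)"
  have "(LINT x|\<nu>. - L x + ln r) \<le> (LINT x|\<nu>. ln ((x - y)\<^sup>2 + e\<^sup>2) / 2)"
  proof (rule integral_mono_AE)
    show "AE x in \<nu>. - L x + ln r \<le> ln ((x - y)\<^sup>2 + e\<^sup>2) / 2"
      using ne
    proof eventually_elim
      case (elim x)
      show ?case using lower[OF elim] log_kernel_bounds(1)[OF elim e] by linarith
    qed
  qed (use intL ie in auto)
  then have "- (LINT x|\<nu>. ln ((x - y)\<^sup>2 + e\<^sup>2) / 2) \<le> (LINT x|\<nu>. L x) - ln r"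
    using intL by (simp add: n.prob_space)
  then have "exp (- (LINT x|\<nu>. ln ((x - y)\<^sup>2 + e\<^sup>2) / 2)) \<le> exp ((LINT x|\<nu>. L x) - ln r)" by simp
  also have "\<dots> = exp (LINT x|\<nu>. L x) / r" using rq by (simp add: exp_diff)
  also have "\<dots> \<le> (exp 1 + w / q) / r" using expL rq by (intro divide_right_mono) auto
  finally show "exp (- (LINT x|\<nu>. ln ((x - y)\<^sup>2 + e\<^sup>2) / 2)) \<le> (exp 1 + w / q) / r" .
qed

text \<open>Since \<open>q < 1\<close>, the kernel \<open>\<bar>u\<bar> powr - q\<close> is integrable near 0, and by Tonelli the potential of a
  probability measure has the same integral as the kernel.\<close>
lemma Riesz_potential_integral_finite:
  fixes \<nu> :: "real measure"
  assumes N: "prob_space \<nu>" "sets \<nu> = sets borel" and rq: "0 < r" "q < 1"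
  shows "(\<integral>\<^sup>+y. (\<integral>\<^sup>+x. ennreal (indicator {x. \<bar>x - y\<bar> < r} x * \<bar>x - y\<bar> powr - q) \<partial>\<nu>) \<partial>lborel) < \<infinity>"
proof -
  interpret n: prob_space \<nu> by fact
  have [measurable_cong]: "sets \<nu> = sets borel" by fact
  interpret P: pair_sigma_finite lborel \<nu> by unfold_locales
  define k where "k u = ennreal (indicator {u. \<bar>u\<bar> < r} u * \<bar>u\<bar> powr - q)" for u :: real
  define k1 where "k1 u = ennreal (indicator {0..r} u * u powr - q)" for u :: real
  have [measurable]: "k \<in> borel_measurable borel" "k1 \<in> borel_measurable borel"
    unfolding k_def[abs_def] k1_def[abs_def] by measurable
  define K where "K = (\<integral>\<^sup>+u. k u \<partial>lborel)"
  have "((\<lambda>u. u powr - q) has_integral (r powr (- q + 1) / (- q + 1))) {0..r}"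
    using rq by (intro has_integral_powr_from_0) auto
  then have "((\<lambda>u. indicator {0..r} u * u powr - q) has_integral (r powr (- q + 1) / (- q + 1))) UNIV"
  proof -
    have "(\<lambda>u. indicator {0..r} u * u powr - q) = (\<lambda>u. if u \<in> {0..r} then u powr - q else 0)"
      by (auto simp: fun_eq_iff indicator_def)
    then show ?thesis
      using has_integral_restrict_UNIV[of "{0..r}" "\<lambda>u. u powr - q"] \<open>(_ has_integral _) {0..r}\<close> by metis
  qed
  then have k1: "(\<integral>\<^sup>+u. k1 u \<partial>lborel) < \<infinity>"
    unfolding k1_def by (subst nn_integral_has_integral_lborel) auto
  have "(\<integral>\<^sup>+u. k1 (- u) \<partial>lborel) = (\<integral>\<^sup>+u. k1 u \<partial>lborel)"
    using nn_integral_real_affine[of k1 "-1" 0] by simp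
  have "K \<le> (\<integral>\<^sup>+u. k1 u + k1 (- u) \<partial>lborel)" unfolding K_def
    by (intro nn_integral_mono) (auto simp: k_def k1_def indicator_def)
  also have "\<dots> = (\<integral>\<^sup>+u. k1 u \<partial>lborel) + (\<integral>\<^sup>+u. k1 u \<partial>lborel)"
    using \<open>(\<integral>\<^sup>+u. k1 (- u) \<partial>lborel) = (\<integral>\<^sup>+u. k1 u \<partial>lborel)\<close> by (subst nn_integral_add) auto
  finally have K: "K < \<infinity>" using k1 by (metis ennreal_add_eq_top infinity_ennreal_def less_top neq_top_trans)
  have "(\<integral>\<^sup>+y. (\<integral>\<^sup>+x. ennreal (indicator {x. \<bar>x - y\<bar> < r} x * \<bar>x - y\<bar> powr - q) \<partial>\<nu>) \<partial>lborel)
      = (\<integral>\<^sup>+y. (\<integral>\<^sup>+x. k (x - y) \<partial>\<nu>) \<partial>lborel)"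
    by (intro nn_integral_cong) (simp add: k_def indicator_def)
  also have "\<dots> = (\<integral>\<^sup>+x. (\<integral>\<^sup>+y. k (x - y) \<partial>lborel) \<partial>\<nu>)"
    by (rule P.Fubini'[symmetric]) measurable
  also have "\<dots> = (\<integral>\<^sup>+x. K \<partial>\<nu>)"
  proof (rule nn_integral_cong)
    fix x :: real
    show "(\<integral>\<^sup>+y. k (x - y) \<partial>lborel) = K"
      using nn_integral_real_affine[of k "-1" x] by (simp add: K_def)
  qed
  also have "\<dots> = K" by (simp add: n.emeasure_space_1)
  finally show ?thesis using K by simp
qed

text \<open>The function \<open>W\<close> is a locally integrable majorant of the regularised densities, uniformly in \<open>e\<close>.
  Its finiteness almost everywhere also shows that \<open>Phi \<nu>\<close> is given by a convergent integral almost
  everywhere.\<close>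
lemma log_potential_domination:
  fixes \<nu> :: "real measure"
  assumes N: "prob_space \<nu>" "sets \<nu> = sets borel" and atom: "\<And>x. measure \<nu> {x} \<noteq> 1"
    and i1: "integrable \<nu> (\<lambda>x. ln (1 + \<bar>x\<bar>))"
  obtains W where "W \<in> borel_measurable borel" "\<And>a b. (\<integral>\<^sup>+y. W y * indicator {a..b} y \<partial>lborel) < \<infinity>"
    "AE y in lborel. measure \<nu> {y} = 0 \<and> integrable \<nu> (\<lambda>x. ln \<bar>x - y\<bar>)"
    "\<And>e. 0 < e \<Longrightarrow> e \<le> 1 \<Longrightarrow> \<forall>y. integrable \<nu> (\<lambda>x. ln ((x - y)\<^sup>2 + e\<^sup>2) / 2) \<Longrightarrow>
      AE y in lborel. ennreal (exp (- (LINT x|\<nu>. ln ((x - y)\<^sup>2 + e\<^sup>2) / 2))) \<le> W y"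
proof -
  interpret D: real_distribution \<nu>
    using N by (simp add: real_distribution_def real_distribution_axioms_def)
  interpret Q: pair_sigma_finite lborel \<nu> by unfold_locales
  have [measurable_cong]: "sets \<nu> = sets borel" by fact
  obtain r q where rq: "0 < r" "r \<le> 1" "0 < q" "q < 1" "\<And>y. measure \<nu> {x. \<bar>x - y\<bar> < r} \<le> q"
    using no_unit_atom_local_mass[OF N atom] by metis
  define R where "R y = (\<integral>\<^sup>+x. ennreal (indicator {x. \<bar>x - y\<bar> < r} x * \<bar>x - y\<bar> powr - q) \<partial>\<nu>)" for y
  have [measurable]: "R \<in> borel_measurable borel" unfolding R_def[abs_def] indicator_def by measurable
  have Rfin: "(\<integral>\<^sup>+y. R y \<partial>lborel) < \<infinity>"
    unfolding R_def by (rule Riesz_potential_integral_finite[OF N rq(1,4)])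
  define W where "W y = ennreal (1 / r) * (ennreal (exp 1) + R y * ennreal (1 / q))" for y
  have "{y. measure \<nu> {y} > 0} \<in> null_sets lborel"
    using D.countable_atoms by (rule countable_imp_null_set_lborel)
  from AE_not_in[OF this] have "AE y in lborel. measure \<nu> {y} = 0"
    by (auto elim!: eventually_mono simp: zero_less_measure_iff)
  moreover have "AE y in lborel. R y \<noteq> \<infinity>" using Rfin by (intro nn_integral_PInf_AE) auto
  ultimately have AE: "AE y in lborel. measure \<nu> {y} = 0 \<and> R y \<noteq> \<infinity>" by eventually_elim simp
  note dom = log_kernel_domination[OF N i1 rq(1-3) rq(5) _ _ enn2real_nonneg, folded R_def]
  show thesis
  proof (rule that)
    show [measurable]: "W \<in> borel_measurable borel" unfolding W_def[abs_def] by measurable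
    fix a b :: real
    have "(\<integral>\<^sup>+y. W y * indicator {a..b} y \<partial>lborel)
       = (\<integral>\<^sup>+y. ennreal (1 / r) * (ennreal (exp 1) * indicator {a..b} y + R y * indicator {a..b} y * ennreal (1 / q)) \<partial>lborel)"
      by (intro nn_integral_cong) (simp add: W_def indicator_def)
    also have "\<dots> = ennreal (1 / r) * (ennreal (exp 1) * emeasure lborel {a..b} + (\<integral>\<^sup>+y. R y * indicator {a..b} y \<partial>lborel) * ennreal (1 / q))"
      by (simp add: nn_integral_cmult nn_integral_multc nn_integral_add nn_integral_cmult_indicator)
    also have "\<dots> < \<infinity>"
    proof -
      have "(\<integral>\<^sup>+y. R y * indicator {a..b} y \<partial>lborel) \<le> (\<integral>\<^sup>+y. R y \<partial>lborel)"
        by (intro nn_integral_mono) (auto simp: indicator_def)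
      then have "(\<integral>\<^sup>+y. R y * indicator {a..b} y \<partial>lborel) < \<infinity>" using Rfin by (rule order.strict_trans1)
      then show ?thesis by (simp add: ennreal_mult_less_top emeasure_lborel_Icc_eq)
    qed
    finally show "(\<integral>\<^sup>+y. W y * indicator {a..b} y \<partial>lborel) < \<infinity>" .
  next
    show "AE y in lborel. measure \<nu> {y} = 0 \<and> integrable \<nu> (\<lambda>x. ln \<bar>x - y\<bar>)"
      using AE
    proof eventually_elim
      case (elim y)
      then have "integrable \<nu> (\<lambda>x. ln \<bar>x - y\<bar>)" by (intro dom(1)[of y "R y"]) (simp_all add: less_top)
      with elim show ?case by simp
    qed
  next
    fix e :: real
    assume e: "0 < e" "e \<le> 1" and ie: "\<forall>y. integrable \<nu> (\<lambda>x. ln ((x - y)\<^sup>2 + e\<^sup>2) / 2)"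
    show "AE y in lborel. ennreal (exp (- (LINT x|\<nu>. ln ((x - y)\<^sup>2 + e\<^sup>2) / 2))) \<le> W y"
      using AE
    proof eventually_elim
      case (elim y)
      define w where "w = enn2real (R y)"
      have w: "R y = ennreal w" "0 \<le> w" using elim by (simp_all add: w_def less_top)
      have "exp (- (LINT x|\<nu>. ln ((x - y)\<^sup>2 + e\<^sup>2) / 2)) \<le> (exp 1 + w / q) / r"
        unfolding w_def using elim by (intro dom(2) e ie[rule_format]) (simp_all add: less_top)
      also have "\<dots> = 1 / r * (exp 1 + w * (1 / q))" by simp
      finally have "ennreal (exp (- (LINT x|\<nu>. ln ((x - y)\<^sup>2 + e\<^sup>2) / 2))) \<le> ennreal (1 / r * (exp 1 + w * (1 / q)))"
        by (rule ennreal_leI)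
      also have "\<dots> = W y"
        using rq w by (simp only: W_def ennreal_mult ennreal_plus divide_nonneg_pos zero_le_one less_imp_le
          exp_ge_zero mult_nonneg_nonneg add_nonneg_nonneg zero_le_divide_1_iff)
      finally show ?case .
    qed
  qed
qed

section \<open>Inversion of the Stieltjes transform\<close>

lemma Phi_eq: "Phi \<nu> y = (LINT x|\<nu>. ln \<bar>x - y\<bar>)"
  unfolding Phi_def by (intro Bochner_Integration.integral_cong) (auto simp: abs_minus_commute)

lemma borel_measurable_Phi:
  assumes "prob_space \<nu>" "sets \<nu> = sets borel"
  shows "Phi \<nu> \<in> borel_measurable borel"
proof -
  interpret prob_space \<nu> by fact
  have [measurable_cong]: "sets \<nu> = sets borel" by fact
  show ?thesis unfolding Phi_eq[abs_def] by measurable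
qed

lemma borel_measurable_cdf:
  assumes "prob_space \<nu>" "sets \<nu> = sets borel"
  shows "cdf \<nu> \<in> borel_measurable borel"
proof -
  interpret real_distribution \<nu>
    using assms by (simp add: real_distribution_def real_distribution_axioms_def)
  show ?thesis using cdf_nondecreasing by (intro borel_measurable_mono monoI)
qed

text \<open>As \<open>l\<close> grows, the transform of \<open>\<mu>\<close> decreases to the mass of \<open>\<mu>\<close> at 0, whereas the logarithmic
  integral of \<open>\<nu>\<close> tends to infinity as soon as \<open>\<nu>\<close> charges \<open>{0<..}\<close>.\<close>
lemma Stieltjes_pair_no_atom_zero:
  fixes \<mu> \<nu> :: "real measure"
  assumes M: "prob_space \<mu>" "sets \<mu> = sets borel" "AE x in \<mu>. 0 \<le> x"
    and N: "prob_space \<nu>" "sets \<nu> = sets borel" "AE x in \<nu>. 0 \<le> x" and atom: "measure \<nu> {0} \<noteq> 1"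
    and int: "\<And>l. 0 < l \<Longrightarrow> integrable \<nu> (\<lambda>x. ln (1 + l * x))"
    and H: "\<And>l. 0 < l \<Longrightarrow> (LINT x|\<mu>. 1 / (1 + l * x)) = exp (- (LINT x|\<nu>. ln (1 + l * x)))"
  shows "measure \<mu> {0} = 0"
proof (rule ccontr)
  interpret m: prob_space \<mu> by fact
  interpret n: prob_space \<nu> by fact
  have [measurable_cong]: "sets \<mu> = sets borel" "sets \<nu> = sets borel" by fact+
  have sp: "space \<mu> = UNIV" "space \<nu> = UNIV" using M(2)[THEN sets_eq_imp_space_eq] N(2)[THEN sets_eq_imp_space_eq] by simp_all
  assume "measure \<mu> {0} \<noteq> 0"
  then have p: "measure \<mu> {0} > 0" using zero_less_measure_iff by metis
  have "\<exists>d>0. measure \<nu> {d<..} > 0"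
  proof (rule ccontr)
    assume "\<not> ?thesis"
    then have z: "measure \<nu> {d<..} = 0" if "d > 0" for d
    proof -
      have "\<not> measure \<nu> {d<..} > 0" using \<open>\<not> (\<exists>d>0. _)\<close> that by blast
      then show ?thesis by (simp add: zero_less_measure_iff)
    qed
    have "AE x in \<nu>. \<forall>n. \<not> inverse (real (Suc n)) < x"
    proof (subst AE_all_countable, rule allI)
      fix n :: nat
      have "{inverse (real (Suc n))<..} \<in> null_sets \<nu>"
        using z[of "inverse (real (Suc n))"] by (auto simp: null_sets_def n.emeasure_eq_measure)
      from AE_not_in[OF this] show "AE x in \<nu>. \<not> inverse (real (Suc n)) < x" by simp
    qed
    then have "AE x in \<nu>. x \<in> {0}"
      using N(3)
    proof eventually_elim
      case (elim x)
      then show ?case using reals_Archimedean[of x] by (cases "x = 0") auto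
    qed
    then have "measure \<nu> {0} = 1" by (subst (asm) n.prob_eq_1[symmetric]) auto
    with atom show False by blast
  qed
  then obtain d where d: "d > 0" "measure \<nu> {d<..} > 0" by blast
  \<comment> \<open>\<open>K\<close> is so large, and \<open>l\<close> such that \<open>ln (1 + l * d) = K\<close>, that the transform at \<open>l\<close> falls below the
    mass at 0.\<close>
  define K where "K = (\<bar>ln (measure \<mu> {0})\<bar> + 1) / measure \<nu> {d<..}"
  have K: "K > 0" using d by (simp add: K_def)
  define l where "l = (exp K - 1) / d"
  have l: "l > 0" using K d by (simp add: l_def)
  have ld: "ln (1 + l * d) = K" using d by (simp add: l_def)
  have "measure \<mu> {0} = (LINT x|\<mu>. indicator {0} x)" by (simp add: sp)
  also have "\<dots> \<le> (LINT x|\<mu>. 1 / (1 + l * x))"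
  proof (rule integral_mono_AE)
    have "AE x in \<mu>. norm (1 / (1 + l * x)) \<le> 1"
      using M(3) l by (auto elim!: eventually_mono simp: divide_le_eq)
    then show "integrable \<mu> (\<lambda>x. 1 / (1 + l * x))" by (intro m.integrable_const_bound) auto
    show "AE x in \<mu>. indicator {0} x \<le> 1 / (1 + l * x)"
      using M(3) l by (auto elim!: eventually_mono simp: indicator_def)
  qed (auto intro!: m.integrable_const_bound[where B=1])
  also have "\<dots> = exp (- (LINT x|\<nu>. ln (1 + l * x)))" by (rule H[OF l])
  also have "\<dots> \<le> exp (- (K * measure \<nu> {d<..}))"
  proof -
    have "(LINT x|\<nu>. K * indicator {d<..} x) \<le> (LINT x|\<nu>. ln (1 + l * x))"
    proof (rule integral_mono_AE)
      show "AE x in \<nu>. K * indicator {d<..} x \<le> ln (1 + l * x)"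
        using N(3)
      proof eventually_elim
        case (elim x)
        show ?case
        proof (cases "x > d")
          case True
          have "l * d \<le> l * x" using True l by simp
          moreover have "0 < 1 + l * d" using l d by (simp add: add_pos_pos)
          ultimately show ?thesis using True unfolding ld[symmetric] by simp
        qed (use elim l in simp)
      qed
    qed (use int[OF l] in \<open>auto intro!: integrable_mult_right n.integrable_const_bound[where B=1]\<close>)
    then show ?thesis by (simp add: sp)
  qed
  also have "\<dots> = exp (- (\<bar>ln (measure \<mu> {0})\<bar> + 1))" using d by (simp add: K_def)
  also have "\<dots> < exp (ln (measure \<mu> {0}))" unfolding exp_less_cancel_iff by linarith
  also have "\<dots> = measure \<mu> {0}" using p by simp
  finally show False by simp
qed

text \<open>Integrating the Poisson kernel in \<open>y\<close> over \<open>{a..b}\<close> gives a difference of arctangents, which tends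
  to \<open>pi\<close> inside the interval, to \<open>pi / 2\<close> at its end points and to 0 outside; the signs on the right
  express these three values. The limit on the left is taken under the integral by
  \<open>log_potential_domination\<close>.\<close>
theorem Stieltjes_inversion_interval:
  fixes \<mu> \<nu> :: "real measure"
  assumes M: "prob_space \<mu>" "sets \<mu> = sets borel" "AE x in \<mu>. 0 \<le> x"
    and N: "prob_space \<nu>" "sets \<nu> = sets borel" "AE x in \<nu>. 0 \<le> x" and atom: "\<And>x. measure \<nu> {x} \<noteq> 1"
    and int: "\<And>l. 0 < l \<Longrightarrow> integrable \<nu> (\<lambda>x. ln (1 + l * x))"
    and H: "\<And>l. 0 < l \<Longrightarrow> (LINT x|\<mu>. 1 / (1 + l * x)) = exp (- (LINT x|\<nu>. ln (1 + l * x)))"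
    and ab: "a < b"
  shows "(\<integral>\<^sup>+y. ennreal (exp (- Phi \<nu> y) * sin (pi * cdf \<nu> y)) * indicator {a..b} y \<partial>lborel) =
    ennreal (LINT x|\<mu>. pi / 2 * (sgn (b - x) - sgn (a - x)))"
proof -
  interpret m: prob_space \<mu> by fact
  interpret n: prob_space \<nu> by fact
  interpret D: real_distribution \<nu>
    using N by (simp add: real_distribution_def real_distribution_axioms_def)
  interpret P: pair_sigma_finite lborel \<mu> by unfold_locales
  interpret Q: pair_sigma_finite lborel \<nu> by unfold_locales
  have [measurable_cong]: "sets \<mu> = sets borel" "sets \<nu> = sets borel" by fact+
  have i1: "integrable \<nu> (\<lambda>x. ln (1 + \<bar>x\<bar>))"
    using int[of 1] N(3) by (subst integrable_cong_AE[where g="\<lambda>x. ln (1 + 1 * x)"]) (auto elim: eventually_mono)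
  obtain W where W[measurable]: "W \<in> borel_measurable borel"
    and Wfin: "\<And>a b. (\<integral>\<^sup>+y. W y * indicator {a..b} y \<partial>lborel) < \<infinity>"
    and AEy: "AE y in lborel. measure \<nu> {y} = 0 \<and> integrable \<nu> (\<lambda>x. ln \<bar>x - y\<bar>)"
    and Wdom: "\<And>e. 0 < e \<Longrightarrow> e \<le> 1 \<Longrightarrow> \<forall>y. integrable \<nu> (\<lambda>x. ln ((x - y)\<^sup>2 + e\<^sup>2) / 2) \<Longrightarrow>
      AE y in lborel. ennreal (exp (- (LINT x|\<nu>. ln ((x - y)\<^sup>2 + e\<^sup>2) / 2))) \<le> W y"
    by (rule log_potential_domination[OF N(1,2) atom i1], rule that)
  define e where "e n = inverse (real (Suc n))" for n
  have e: "0 < e n" "e n \<le> 1" for n by (auto simp: e_def field_simps)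
  define p where "p n y = (LINT x|\<mu>. e n / ((x - y)\<^sup>2 + (e n)\<^sup>2))" for n y
  define h where "h y = exp (- Phi \<nu> y) * sin (pi * cdf \<nu> y)" for y
  have p_eq: "p n y = exp (- (LINT x|\<nu>. ln ((x - y)\<^sup>2 + (e n)\<^sup>2) / 2)) * sin (LINT x|\<nu>. pi / 2 - arctan ((x - y) / e n))" for n y
    unfolding p_def by (rule Stieltjes_pair_Poisson(1)[OF m.finite_measure_axioms M(2,3) N int H e(1)])
  have int_log: "integrable \<nu> (\<lambda>x. ln ((x - y)\<^sup>2 + (e n)\<^sup>2) / 2)" for n y
    by (rule Stieltjes_pair_Poisson(2)[OF m.finite_measure_axioms M(2,3) N int H e(1)])
  have lim: "AE y in lborel. (\<lambda>n. p n y) \<longlonglongrightarrow> h y"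
    using AEy
  proof eventually_elim
    case (elim y)
    then show ?case
      using Stieltjes_boundary_value[OF N(1,2) i1, of y] unfolding p_eq unfolding h_def Phi_eq e_def by blast
  qed
  have bound: "AE y in lborel. ennreal (p n y) \<le> W y" for n
    using Wdom[OF e allI[OF int_log], of n]
  proof eventually_elim
    case (elim y)
    have "p n y \<le> exp (- (LINT x|\<nu>. ln ((x - y)\<^sup>2 + (e n)\<^sup>2) / 2)) * 1"
      unfolding p_eq by (intro mult_left_mono) auto
    then show ?case using elim by (intro order_trans[OF ennreal_leI elim]) simp
  qed
  note [measurable] = borel_measurable_Phi[OF N(1,2)] borel_measurable_cdf[OF N(1,2)]
  have [measurable]: "h \<in> borel_measurable borel" "p n \<in> borel_measurable borel" for n
    unfolding h_def[abs_def] p_def[abs_def] by measurable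
  have L1: "(\<lambda>n. \<integral>\<^sup>+y. ennreal (p n y) * indicator {a..b} y \<partial>lborel) \<longlonglongrightarrow> (\<integral>\<^sup>+y. ennreal (h y) * indicator {a..b} y \<partial>lborel)"
  proof (rule nn_integral_dominated_convergence[where w="\<lambda>y. W y * indicator {a..b} y"])
    show "AE y in lborel. ennreal (p n y) * indicator {a..b} y \<le> W y * indicator {a..b} y" for n
      using bound[of n] by eventually_elim (auto simp: indicator_def)
    show "AE y in lborel. (\<lambda>n. ennreal (p n y) * indicator {a..b} y) \<longlonglongrightarrow> ennreal (h y) * indicator {a..b} y"
      using lim by eventually_elim (auto simp: indicator_def intro!: tendsto_ennrealI)
    show "(\<integral>\<^sup>+y. W y * indicator {a..b} y \<partial>lborel) < \<infinity>" by (rule Wfin)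
  qed measurable
  have kpos: "0 < (x - y)\<^sup>2 + (e n)\<^sup>2" for x y n using e(1)[of n] by (intro add_nonneg_pos) auto
  have R: "(\<integral>\<^sup>+y. ennreal (p n y) * indicator {a..b} y \<partial>lborel) = ennreal (LINT x|\<mu>. arctan ((b - x) / e n) - arctan ((a - x) / e n))" for n
  proof -
    have pn: "ennreal (p n y) = (\<integral>\<^sup>+x. ennreal (e n / ((x - y)\<^sup>2 + (e n)\<^sup>2)) \<partial>\<mu>)" for y
      unfolding p_def
    proof (rule nn_integral_eq_integral[symmetric])
      show "integrable \<mu> (\<lambda>x. e n / ((x - y)\<^sup>2 + (e n)\<^sup>2))"
      proof (rule m.integrable_const_bound[where B="1 / e n"])
        have "e n / ((x - y)\<^sup>2 + (e n)\<^sup>2) \<le> e n / (e n)\<^sup>2" for x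
          using e(1)[of n] kpos[of x y n] by (intro divide_left_mono) auto
        then show "AE x in \<mu>. norm (e n / ((x - y)\<^sup>2 + (e n)\<^sup>2)) \<le> 1 / e n"
          using e(1)[of n] kpos[of _ y n] by (intro AE_I2) (simp add: power2_eq_square less_imp_le)
      qed measurable
    qed (use e(1)[of n] kpos[of _ y n] in \<open>auto intro!: divide_nonneg_nonneg less_imp_le\<close>)
    have "(\<integral>\<^sup>+y. ennreal (p n y) * indicator {a..b} y \<partial>lborel) =
        (\<integral>\<^sup>+y. (\<integral>\<^sup>+x. ennreal (e n / ((x - y)\<^sup>2 + (e n)\<^sup>2)) * indicator {a..b} y \<partial>\<mu>) \<partial>lborel)"
      unfolding pn by (subst nn_integral_multc) auto
    also have "\<dots> = (\<integral>\<^sup>+x. (\<integral>\<^sup>+y. ennreal (e n / ((x - y)\<^sup>2 + (e n)\<^sup>2)) * indicator {a..b} y \<partial>lborel) \<partial>\<mu>)"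
      by (rule P.Fubini'[symmetric]) measurable
    also have "\<dots> = (\<integral>\<^sup>+x. ennreal (arctan ((b - x) / e n) - arctan ((a - x) / e n)) \<partial>\<mu>)"
    proof (rule nn_integral_cong)
      fix x
      show "(\<integral>\<^sup>+y. ennreal (e n / ((x - y)\<^sup>2 + (e n)\<^sup>2)) * indicator {a..b} y \<partial>lborel) = ennreal (arctan ((b - x) / e n) - arctan ((a - x) / e n))"
      proof (rule nn_integral_FTC_Icc)
        fix y
        have "((\<lambda>y. arctan ((y - x) / e n)) has_real_derivative inverse (1 + ((y - x) / e n)\<^sup>2) * (1 / e n)) (at y)"
          using e(1)[of n] by (auto intro!: derivative_eq_intros)
        also have "inverse (1 + ((y - x) / e n)\<^sup>2) * (1 / e n) = e n / ((x - y)\<^sup>2 + (e n)\<^sup>2)"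
        proof -
          have "1 + ((y - x) / e n)\<^sup>2 = ((x - y)\<^sup>2 + (e n)\<^sup>2) / (e n)\<^sup>2"
            using e(1)[of n] by (simp add: power_divide add_divide_distrib power2_commute)
          then show ?thesis using e(1)[of n] by (simp add: power2_eq_square)
        qed
        finally show "((\<lambda>y. arctan ((y - x) / e n)) has_real_derivative e n / ((x - y)\<^sup>2 + (e n)\<^sup>2)) (at y)" .
        show "0 \<le> e n / ((x - y)\<^sup>2 + (e n)\<^sup>2)" using e(1)[of n] kpos[of x y n] by simp
      qed (use ab in auto)
    qed
    also have "\<dots> = ennreal (LINT x|\<mu>. arctan ((b - x) / e n) - arctan ((a - x) / e n))"
    proof (rule nn_integral_eq_integral)
      have bd: "\<bar>arctan ((b - x) / e n) - arctan ((a - x) / e n)\<bar> \<le> pi" for x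
        using arctan_bounded[of "(b - x) / e n"] arctan_bounded[of "(a - x) / e n"] by linarith
      then show "integrable \<mu> (\<lambda>x. arctan ((b - x) / e n) - arctan ((a - x) / e n))"
        by (intro m.integrable_const_bound[where B=pi]) auto
      show "AE x in \<mu>. 0 \<le> arctan ((b - x) / e n) - arctan ((a - x) / e n)"
        using ab e(1)[of n] by (intro AE_I2) (simp add: arctan_le_iff divide_right_mono)
    qed
    finally show ?thesis .
  qed
  have L2: "(\<lambda>n. LINT x|\<mu>. arctan ((b - x) / e n) - arctan ((a - x) / e n)) \<longlonglongrightarrow> (LINT x|\<mu>. pi / 2 * (sgn (b - x) - sgn (a - x)))"
  proof (rule integral_dominated_convergence[where w="\<lambda>_. pi"])
    show "AE x in \<mu>. (\<lambda>n. arctan ((b - x) / e n) - arctan ((a - x) / e n)) \<longlonglongrightarrow> pi / 2 * (sgn (b - x) - sgn (a - x))"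
      unfolding e_def right_diff_distrib by (intro AE_I2 tendsto_diff arctan_scaled_limit)
    show "AE x in \<mu>. norm (arctan ((b - x) / e n) - arctan ((a - x) / e n)) \<le> pi" for n
    proof (rule AE_I2)
      fix x show "norm (arctan ((b - x) / e n) - arctan ((a - x) / e n)) \<le> pi"
        using arctan_bounded[of "(b - x) / e n"] arctan_bounded[of "(a - x) / e n"] unfolding real_norm_def by linarith
    qed
  qed auto
  show ?thesis
    using LIMSEQ_unique[OF L1[unfolded R] tendsto_ennrealI[OF L2]] by (simp add: h_def)
qed

text \<open>The half weights of the end points are squeezed between the open and the closed interval. The
  density does not charge end points, so approximating an open interval from inside by closed ones
  identifies both measures there.\<close>
theorem Stieltjes_inversion:
  fixes \<mu> \<nu> :: "real measure"
  assumes M: "prob_space \<mu>" "sets \<mu> = sets borel" "AE x in \<mu>. 0 \<le> x"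
    and N: "prob_space \<nu>" "sets \<nu> = sets borel" "AE x in \<nu>. 0 \<le> x" and atom: "\<And>x. measure \<nu> {x} \<noteq> 1"
    and int: "\<And>l. 0 < l \<Longrightarrow> integrable \<nu> (\<lambda>x. ln (1 + l * x))"
    and H: "\<And>l. 0 < l \<Longrightarrow> (LINT x|\<mu>. 1 / (1 + l * x)) = exp (- (LINT x|\<nu>. ln (1 + l * x)))"
  shows "\<mu> = density lborel (\<lambda>x. ennreal (indicator {0<..} x * (1 / pi * exp (- Phi \<nu> x) * sin (pi * cdf \<nu> x))))"
    (is "_ = ?K")
proof -
  interpret m: prob_space \<mu> by fact
  interpret n: prob_space \<nu> by fact
  interpret D: real_distribution \<nu>
    using N by (simp add: real_distribution_def real_distribution_axioms_def)
  have [measurable_cong]: "sets \<mu> = sets borel" "sets \<nu> = sets borel" by fact+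
  note [measurable] = borel_measurable_Phi[OF N(1,2)] borel_measurable_cdf[OF N(1,2)]
  define h where "h y = exp (- Phi \<nu> y) * sin (pi * cdf \<nu> y)" for y
  have [measurable]: "h \<in> borel_measurable borel" unfolding h_def[abs_def] by measurable
  have K: "?K = density lborel (\<lambda>x. ennreal (indicator {0<..} x * (1 / pi * h x)))"
    by (simp add: h_def mult.assoc)
  have Kset: "emeasure ?K A = (\<integral>\<^sup>+y. ennreal (1 / pi) * (ennreal (h y) * indicator A y) \<partial>lborel)"
    if A[measurable]: "A \<in> sets borel" and "A \<subseteq> {0<..}" for A
  proof -
    have "emeasure ?K A = (\<integral>\<^sup>+y. ennreal (indicator {0<..} y * (1 / pi * h y)) * indicator A y \<partial>lborel)"
      unfolding K by (subst emeasure_density) auto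
    also have "\<dots> = (\<integral>\<^sup>+y. ennreal (1 / pi) * (ennreal (h y) * indicator A y) \<partial>lborel)"
      using that by (intro nn_integral_cong) (auto simp: indicator_def ennreal_mult'[symmetric])
    finally show ?thesis .
  qed
  have Icc: "emeasure ?K {a..b} = ennreal (LINT x|\<mu>. (sgn (b - x) - sgn (a - x)) / 2)" if "0 < a" "a < b" for a b
  proof -
    have "emeasure ?K {a..b} = ennreal (1 / pi) * (\<integral>\<^sup>+y. ennreal (h y) * indicator {a..b} y \<partial>lborel)"
      using that by (subst Kset) (auto simp: nn_integral_cmult)
    also have "\<dots> = ennreal (1 / pi) * ennreal (LINT x|\<mu>. pi / 2 * (sgn (b - x) - sgn (a - x)))"
      unfolding h_def using Stieltjes_inversion_interval[OF assms that(2)] by simp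
    also have "\<dots> = ennreal (1 / pi * (LINT x|\<mu>. pi / 2 * (sgn (b - x) - sgn (a - x))))"
      by (rule ennreal_mult'[symmetric]) simp
    also have "1 / pi * (LINT x|\<mu>. pi / 2 * (sgn (b - x) - sgn (a - x))) = (LINT x|\<mu>. 1 / pi * (pi / 2 * (sgn (b - x) - sgn (a - x))))"
      by (rule integral_mult_right_zero[symmetric])
    finally show ?thesis by simp
  qed
  have half: "integrable \<mu> (\<lambda>x. (sgn (b - x) - sgn (a - x)) / 2)" for a b
    by (rule m.integrable_const_bound[where B=1]) (auto simp: sgn_if)
  have lower: "emeasure \<mu> {a<..<b} \<le> emeasure ?K {a..b}" if "0 < a" "a < b" for a b
  proof -
    have "(LINT x|\<mu>. indicator {a<..<b} x) \<le> (LINT x|\<mu>. (sgn (b - x) - sgn (a - x)) / 2)"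
      using that half by (intro integral_mono_AE m.integrable_const_bound[where B=1] AE_I2) (auto simp: sgn_if indicator_def)
    then show ?thesis unfolding Icc[OF that] m.emeasure_eq_measure by (simp add: ennreal_leI)
  qed
  have upper: "emeasure ?K {a..b} \<le> emeasure \<mu> {a..b}" if "0 < a" "a < b" for a b
  proof -
    have "(LINT x|\<mu>. (sgn (b - x) - sgn (a - x)) / 2) \<le> (LINT x|\<mu>. indicator {a..b} x)"
      using that half by (intro integral_mono_AE m.integrable_const_bound[where B=1] AE_I2) (auto simp: sgn_if indicator_def)
    then show ?thesis unfolding Icc[OF that] m.emeasure_eq_measure by (simp add: ennreal_leI)
  qed
  have endpoints: "emeasure ?K {a..b} = emeasure ?K {a<..<b}" if "0 < a" "a < b" for a b
  proof -
    have "AE y in lborel. y \<noteq> a" "AE y in lborel. y \<noteq> b" by (rule AE_lborel_singleton)+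
    then have "AE y in lborel. ennreal (1 / pi) * (ennreal (h y) * indicator {a..b} y) = ennreal (1 / pi) * (ennreal (h y) * indicator {a<..<b} y)"
      by eventually_elim (auto simp: indicator_def)
    then show ?thesis using that by (subst (1 2) Kset) (auto intro!: nn_integral_cong_AE)
  qed
  have Ioo: "emeasure ?K {a<..<b} = emeasure \<mu> {a<..<b}" if ab: "0 < a" "a < b" for a b
  proof (rule antisym)
    \<comment> \<open>The factor \<open>(b - a) / 3\<close> keeps the interval from \<open>c n\<close> to \<open>d n\<close> nonempty from \<open>n = 0\<close> on.\<close>
    define c d where "c n = a + (b - a) / 3 * inverse (real (Suc n))" and "d n = b - (b - a) / 3 * inverse (real (Suc n))" for n
    have i: "0 < inverse (real (Suc n))" "inverse (real (Suc n)) \<le> 1" for n by (auto simp: field_simps)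
    have cd: "0 < c n" "c n < d n" "a < c n" "d n < b" for n
    proof -
      have "0 < (b - a) / 3 * inverse (real (Suc n))" using ab i(1) by (intro mult_pos_pos) auto
      moreover have "(b - a) / 3 * inverse (real (Suc n)) \<le> (b - a) / 3 * 1"
        using ab i(2) by (intro mult_left_mono) auto
      ultimately show "0 < c n" "c n < d n" "a < c n" "d n < b" unfolding c_def d_def using ab by argo+
    qed
    have ci: "(b - a) / 3 * inverse (real (Suc n)) \<le> (b - a) / 3 * inverse (real (Suc m))" if "m \<le> n" for m n
      using ab that by (intro mult_left_mono le_imp_inverse_le) auto
    have "incseq (\<lambda>n. {c n..d n})"
    proof (intro monoI)
      fix m n :: nat assume "m \<le> n"
      from ci[OF this] show "{c m..d m} \<subseteq> {c n..d n}" unfolding c_def d_def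
        by (intro atLeastatMost_subset_iff[THEN iffD2] disjI2 conjI) linarith+
    qed
    then have "(SUP n. emeasure ?K {c n..d n}) = emeasure ?K (\<Union>n. {c n..d n})"
      by (intro SUP_emeasure_incseq) auto
    moreover have "(\<Union>n. {c n..d n}) = {a<..<b}"
    proof (intro equalityI subsetI)
      fix x assume "x \<in> {a<..<b}"
      then have x: "a < x" "x < b" by auto
      have "(\<lambda>n. c n) \<longlonglongrightarrow> a + (b - a) / 3 * 0" "(\<lambda>n. d n) \<longlonglongrightarrow> b - (b - a) / 3 * 0" unfolding c_def d_def
        by (intro tendsto_intros LIMSEQ_inverse_real_of_nat)+
      then have "eventually (\<lambda>n. c n < x) sequentially" "eventually (\<lambda>n. x < d n) sequentially"
        using x by (auto dest: order_tendstoD)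
      then have "eventually (\<lambda>n. c n < x \<and> x < d n) sequentially" by eventually_elim simp
      then obtain n where "c n < x \<and> x < d n" by (auto simp: eventually_sequentially)
      then show "x \<in> (\<Union>n. {c n..d n})" by (auto intro: less_imp_le)
    qed (use cd in \<open>auto intro: order.strict_trans2 order.strict_trans1\<close>)
    moreover have "emeasure ?K {c n..d n} \<le> emeasure \<mu> {a<..<b}" for n
    proof -
      have "emeasure ?K {c n..d n} \<le> emeasure \<mu> {c n..d n}" using cd by (intro upper) auto
      also have "\<dots> \<le> emeasure \<mu> {a<..<b}"
        using cd[of n] by (intro emeasure_mono) (auto intro: order.strict_trans2 order.strict_trans1)
      finally show ?thesis .
    qed
    then have "(SUP n. emeasure ?K {c n..d n}) \<le> emeasure \<mu> {a<..<b}" by (intro SUP_least)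
    ultimately show "emeasure ?K {a<..<b} \<le> emeasure \<mu> {a<..<b}" by simp
    show "emeasure \<mu> {a<..<b} \<le> emeasure ?K {a<..<b}" using lower[OF ab] endpoints[OF ab] by simp
  qed
  have pos: "emeasure ?K {y<..} = emeasure \<mu> {y<..}" if "0 \<le> y" for y
  proof -
    define I where "I n = {y + inverse (real (Suc n)) <..< y + real (Suc n) + 1}" for n
    have ie: "inverse (real (Suc n)) \<le> inverse (real (Suc m))" if "m \<le> n" for m n
      using that by (intro le_imp_inverse_le) auto
    have inc: "incseq I"
    proof (intro monoI)
      fix m n :: nat assume mn: "m \<le> n"
      then have "real (Suc m) \<le> real (Suc n)" by simp
      with ie[OF mn] show "I m \<subseteq> I n"
        unfolding I_def subset_iff greaterThanLessThan_iff by (intro allI impI, elim conjE, intro conjI) linarith+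
    qed
    have U: "(\<Union>n. I n) = {y<..}"
    proof (intro equalityI subsetI)
      fix x assume "x \<in> {y<..}"
      then have x: "x - y > 0" by simp
      obtain n1 where n1: "inverse (real (Suc n1)) < x - y" using reals_Archimedean[OF x] by blast
      obtain n2 where n2: "x - y < real n2" using reals_Archimedean2 by blast
      define n where "n = max n1 n2"
      have "inverse (real (Suc n)) \<le> inverse (real (Suc n1))" by (rule ie) (simp add: n_def)
      moreover have "real n2 \<le> real n" by (simp add: n_def)
      ultimately have "x \<in> I n" using n1 n2 unfolding I_def greaterThanLessThan_iff of_nat_Suc[of n] by linarith
      then show "x \<in> (\<Union>n. I n)" by blast
    next
      fix x assume "x \<in> (\<Union>n. I n)"
      then obtain n where "x \<in> I n" by blast
      moreover have "0 < inverse (real (Suc n))" by simp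
      ultimately show "x \<in> {y<..}" unfolding I_def greaterThanLessThan_iff greaterThan_iff by linarith
    qed
    have "emeasure ?K (I n) = emeasure \<mu> (I n)" for n
    proof -
      have i: "0 < inverse (real (Suc n))" "inverse (real (Suc n)) \<le> 1" by (auto simp: field_simps)
      show ?thesis unfolding I_def
      proof (rule Ioo)
        show "0 < y + inverse (real (Suc n))" using that i by (intro add_nonneg_pos)
        have "y + inverse (real (Suc n)) \<le> y + 1" using i(2) by (rule add_left_mono)
        also have "\<dots> < y + real (Suc n) + 1" by simp
        finally show "y + inverse (real (Suc n)) < y + real (Suc n) + 1" .
      qed
    qed
    then have "(SUP n. emeasure ?K (I n)) = (SUP n. emeasure \<mu> (I n))" by (simp only:)
    moreover have "range I \<subseteq> sets ?K" "range I \<subseteq> sets \<mu>" by (auto simp: I_def)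
    ultimately show ?thesis
      using SUP_emeasure_incseq[OF _ inc, of ?K] SUP_emeasure_incseq[OF _ inc, of \<mu>] unfolding U by metis
  qed
  have m0: "emeasure \<mu> {..0} = 0"
  proof -
    have "measure \<mu> {0} = 0" by (rule Stieltjes_pair_no_atom_zero[OF M N atom int H])
    then have "AE x in \<mu>. x \<noteq> 0"
      using AE_not_in[of "{0}" \<mu>] by (auto simp: null_sets_def m.emeasure_eq_measure)
    then have "AE x in \<mu>. x \<notin> {..0}" using M(3) by eventually_elim auto
    then have "{..0} \<in> null_sets \<mu>" by (subst AE_iff_null_sets) auto
    then show ?thesis by (rule null_setsD1)
  qed
  show ?thesis
  proof (rule measure_eqI_lessThan)
    fix y :: real
    show "emeasure \<mu> {y<..} < \<infinity>" by (simp add: m.emeasure_eq_measure)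
    show "emeasure \<mu> {y<..} = emeasure ?K {y<..}"
    proof (cases "0 \<le> y")
      case False
      have "emeasure \<mu> {y<..} = emeasure \<mu> ({y<..0} \<union> {0<..})" using False by (intro arg_cong2[where f=emeasure]) auto
      also have "\<dots> = emeasure \<mu> {y<..0} + emeasure \<mu> {0<..}" by (subst plus_emeasure) auto
      also have "emeasure \<mu> {y<..0} = 0"
      proof -
        have "emeasure \<mu> {y<..0} \<le> emeasure \<mu> {..0}" by (rule emeasure_mono) auto
        then show ?thesis using m0 by simp
      qed
      also have "0 + emeasure \<mu> {0<..} = emeasure ?K {0<..}" using pos[of 0] by simp
      also have "\<dots> = emeasure ?K {y<..}"
        unfolding K using False by (subst (1 2) emeasure_density) (auto intro!: nn_integral_cong simp: indicator_def)
      finally show ?thesis .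
    qed (use pos in simp)
  qed (auto simp: M(2))
qed

section \<open>Gamma variables under exponential tilting\<close>

lemma sets_gamma_law [simp, measurable_cong]: "sets (gamma_law a) = sets borel"
  by (simp add: gamma_law_def)

lemma space_gamma_law [simp]: "space (gamma_law a) = UNIV"
  by (simp add: gamma_law_def)

lemma nn_integral_gamma_law:
  assumes "0 < a" and [measurable]: "f \<in> borel_measurable borel"
  shows "(\<integral>\<^sup>+x. f x \<partial>gamma_law a) =
    (\<integral>\<^sup>+x. ennreal (indicator {0<..} x * x powr (a - 1) * exp (- x) / Gamma a) * f x \<partial>lborel)"
  using assms by (simp add: gamma_law_def nn_integral_density)

lemma prob_space_gamma_law:
  assumes "0 \<le> a"
  shows "prob_space (gamma_law a)"
proof (cases "a = 0")
  case True
  then show ?thesis by (simp add: gamma_law_def prob_space_return)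
next
  case False
  with assms have a: "0 < a" by simp
  have G: "Gamma a > 0" using a by simp
  have "((\<lambda>t. indicator {0..} t * (t powr (a - 1) / exp t)) has_integral Gamma a) UNIV"
  proof -
    have "(\<lambda>t. indicator {0..} t * (t powr (a - 1) / exp t)) = (\<lambda>t. if t \<in> {0..} then t powr (a - 1) / exp t else 0)"
      by (auto simp: fun_eq_iff indicator_def)
    then show ?thesis
      using has_integral_restrict_UNIV[of "{0..}" "\<lambda>t. t powr (a - 1) / exp t"] Gamma_integral_real[OF a] by metis
  qed
  then have I: "(\<integral>\<^sup>+t. ennreal (indicator {0..} t * (t powr (a - 1) / exp t)) \<partial>lborel) = ennreal (Gamma a)"
    by (intro nn_integral_has_integral_lborel) auto
  have "emeasure (gamma_law a) UNIV = (\<integral>\<^sup>+x. 1 \<partial>gamma_law a)" by simp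
  also have "\<dots> = (\<integral>\<^sup>+x. ennreal (indicator {0<..} x * x powr (a - 1) * exp (- x) / Gamma a) \<partial>lborel)"
    using a by (subst nn_integral_gamma_law) auto
  also have "\<dots> = (\<integral>\<^sup>+x. ennreal (1 / Gamma a) * ennreal (indicator {0..} x * (x powr (a - 1) / exp x)) \<partial>lborel)"
  proof (rule nn_integral_cong_AE)
    have "AE x in lborel. x \<noteq> (0::real)" by (rule AE_lborel_singleton)
    then show "AE x in lborel. ennreal (indicator {0<..} x * x powr (a - 1) * exp (- x) / Gamma a)
        = ennreal (1 / Gamma a) * ennreal (indicator {0..} x * (x powr (a - 1) / exp x))"
      by eventually_elim (use G in \<open>auto simp: indicator_def exp_minus field_simps ennreal_mult'[symmetric]\<close>)
  qed
  also have "\<dots> = ennreal (1 / Gamma a) * ennreal (Gamma a)" unfolding I[symmetric] by (rule nn_integral_cmult) measurable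
  also have "\<dots> = 1" using G by (simp add: ennreal_mult'[symmetric])
  finally show ?thesis by (intro prob_spaceI) simp
qed

lemma AE_gamma_law_nonneg:
  assumes "0 \<le> a"
  shows "AE x in gamma_law a. 0 \<le> x"
proof (cases "a = 0")
  case True
  have "AE x in return borel (0::real). 0 \<le> x" by (subst AE_return) auto
  then show ?thesis unfolding gamma_law_def if_P[OF True] .
next
  case False
  show ?thesis unfolding gamma_law_def if_not_P[OF False]
    by (subst AE_density) (auto simp: indicator_def)
qed

text \<open>An exponential tilt of a gamma law is a scaling, up to a constant. All identities for gamma and
  Dirichlet vectors below come from this.\<close>
lemma gamma_law_tilt:
  assumes a: "0 \<le> a" and s: "0 \<le> s" and f[measurable]: "f \<in> borel_measurable borel"
  shows "(\<integral>\<^sup>+x. f x * ennreal (exp (- s * x)) \<partial>gamma_law a) =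
    ennreal ((1 + s) powr - a) * (\<integral>\<^sup>+x. f (x / (1 + s)) \<partial>gamma_law a)"
proof (cases "a = 0")
  case True
  then show ?thesis using s by (simp add: gamma_law_def nn_integral_return)
next
  case False
  with a have a: "0 < a" by simp
  define c where "c = 1 / (1 + s)"
  have c: "c > 0" using s by (simp add: c_def)
  have G: "Gamma a > 0" using a by simp
  have cp: "c powr a = (1 + s) powr - a" using s by (simp add: c_def powr_minus powr_divide field_simps)
  have "(\<integral>\<^sup>+x. f x * ennreal (exp (- s * x)) \<partial>gamma_law a) =
     (\<integral>\<^sup>+x. ennreal (indicator {0<..} x * x powr (a - 1) * exp (- x) / Gamma a) * (f x * ennreal (exp (- s * x))) \<partial>lborel)"
    using a by (subst nn_integral_gamma_law) auto
  also have "\<dots> = ennreal \<bar>c\<bar> * (\<integral>\<^sup>+x. ennreal (indicator {0<..} (0 + c * x) * (0 + c * x) powr (a - 1) * exp (- (0 + c * x)) / Gamma a)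
        * (f (0 + c * x) * ennreal (exp (- s * (0 + c * x)))) \<partial>lborel)"
    using c by (intro nn_integral_real_affine) auto
  also have "\<dots> = (\<integral>\<^sup>+x. ennreal c * (ennreal (indicator {0<..} (0 + c * x) * (0 + c * x) powr (a - 1) * exp (- (0 + c * x)) / Gamma a)
        * (f (0 + c * x) * ennreal (exp (- s * (0 + c * x))))) \<partial>lborel)"
    using c by (subst nn_integral_cmult) auto
  also have "\<dots> = (\<integral>\<^sup>+x. ennreal ((1 + s) powr - a) * (ennreal (indicator {0<..} x * x powr (a - 1) * exp (- x) / Gamma a) * f (x / (1 + s))) \<partial>lborel)"
  proof (rule nn_integral_cong)
    fix x :: real
    show "ennreal c * (ennreal (indicator {0<..} (0 + c * x) * (0 + c * x) powr (a - 1) * exp (- (0 + c * x)) / Gamma a)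
        * (f (0 + c * x) * ennreal (exp (- s * (0 + c * x))))) =
       ennreal ((1 + s) powr - a) * (ennreal (indicator {0<..} x * x powr (a - 1) * exp (- x) / Gamma a) * f (x / (1 + s)))"
    proof (cases "0 < x")
      case True
      have e: "exp (- (c * x)) * exp (- s * (c * x)) = exp (- x)"
      proof -
        have "- (c * x) + - s * (c * x) = - ((1 + s) * c * x)" by (simp add: algebra_simps)
        also have "(1 + s) * c = 1" using s by (simp add: c_def)
        finally show ?thesis by (simp add: exp_add[symmetric])
      qed
      have "c * (c * x) powr (a - 1) = c powr a * x powr (a - 1)"
        using c True by (simp add: powr_mult powr_diff)
      then have "c * ((c * x) powr (a - 1) * exp (- (c * x)) / Gamma a) * exp (- s * (c * x))
          = c powr a * (x powr (a - 1) * (exp (- (c * x)) * exp (- s * (c * x))) / Gamma a)"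
        by (simp add: field_simps)
      also have "\<dots> = (1 + s) powr - a * (x powr (a - 1) * exp (- x) / Gamma a)"
        unfolding e cp ..
      finally have E: "c * ((c * x) powr (a - 1) * exp (- (c * x)) / Gamma a) * exp (- s * (c * x)) = \<dots>" .
      have "ennreal c * (ennreal ((c * x) powr (a - 1) * exp (- (c * x)) / Gamma a) * (f (c * x) * ennreal (exp (- s * (c * x)))))
        = f (c * x) * (ennreal c * ennreal ((c * x) powr (a - 1) * exp (- (c * x)) / Gamma a) * ennreal (exp (- s * (c * x))))"
        by (simp add: ac_simps)
      also have "\<dots> = f (c * x) * ennreal (c * ((c * x) powr (a - 1) * exp (- (c * x)) / Gamma a) * exp (- s * (c * x)))"
        using c G by (simp add: ennreal_mult'[symmetric])
      also have "\<dots> = f (c * x) * (ennreal ((1 + s) powr - a) * ennreal (x powr (a - 1) * exp (- x) / Gamma a))"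
        unfolding E using G by (simp add: ennreal_mult'[symmetric])
      finally show ?thesis using True c by (simp add: c_def ac_simps)
    qed (use c in \<open>simp add: zero_less_mult_iff\<close>)
  qed
  also have "\<dots> = ennreal ((1 + s) powr - a) * (\<integral>\<^sup>+x. f (x / (1 + s)) \<partial>gamma_law a)"
    using a by (subst nn_integral_cmult) (auto simp: nn_integral_gamma_law)
  finally show ?thesis .
qed

lemma gamma_law_Laplace:
  assumes "0 \<le> a" "0 \<le> s"
  shows "(\<integral>\<^sup>+x. ennreal (exp (- s * x)) \<partial>gamma_law a) = ennreal ((1 + s) powr - a)"
proof -
  interpret prob_space "gamma_law a" using assms by (intro prob_space_gamma_law)
  show ?thesis using gamma_law_tilt[OF assms, of "\<lambda>_. 1"] emeasure_space_1 by simp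
qed

text \<open>The coordinates may be tilted differently: equal parameters give the independence of the sum,
  different ones the product in the Markov--Krein identity.\<close>
lemma PiM_gamma_tilt:
  assumes "finite I" and a: "\<And>j. 0 \<le> a j" and s: "\<And>j. 0 \<le> s j"
    and f: "f \<in> borel_measurable (\<Pi>\<^sub>M j\<in>I. borel)"
  shows "(\<integral>\<^sup>+g. f g * ennreal (exp (- (\<Sum>j\<in>I. s j * g j))) \<partial>(\<Pi>\<^sub>M j\<in>I. gamma_law (a j))) =
    ennreal (\<Prod>j\<in>I. (1 + s j) powr - a j) * (\<integral>\<^sup>+g. f (\<lambda>j\<in>I. g j / (1 + s j)) \<partial>(\<Pi>\<^sub>M j\<in>I. gamma_law (a j)))"
  using assms(1,4)
proof (induction I arbitrary: f)
  case empty
  have "g = (\<lambda>x. undefined)" if "g \<in> space (\<Pi>\<^sub>M j\<in>{}. gamma_law (a j))" for g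
    using that by (simp add: space_PiM)
  then have "(\<integral>\<^sup>+g. f g \<partial>(\<Pi>\<^sub>M j\<in>{}. gamma_law (a j))) = (\<integral>\<^sup>+g. f (\<lambda>x. undefined) \<partial>(\<Pi>\<^sub>M j\<in>{}. gamma_law (a j)))"
    by (intro nn_integral_cong) auto
  then show ?case by (simp add: restrict_def)
next
  case (insert i I)
  interpret product_sigma_finite "\<lambda>j. gamma_law (a j)"
    unfolding product_sigma_finite_def using a prob_space_gamma_law prob_space_imp_sigma_finite by blast
  have cg: "sets (\<Pi>\<^sub>M j\<in>J. gamma_law (a j)) = sets (\<Pi>\<^sub>M j\<in>J. borel)" for J
    by (intro sets_PiM_cong) auto
  note [measurable_cong] = cg
  note [measurable] = insert.prems
  have [measurable]: "(\<lambda>p. (fst p)(i := snd p)) \<in> (\<Pi>\<^sub>M j\<in>I. borel) \<Otimes>\<^sub>M borel \<rightarrow>\<^sub>M (\<Pi>\<^sub>M j\<in>insert i I. borel :: real measure)"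
    using measurable_add_dim[of i I "\<lambda>_. borel :: real measure"] by (simp add: case_prod_beta')
  have sc[measurable]: "(\<lambda>g. \<lambda>j\<in>J. g j / (1 + s j)) \<in> (\<Pi>\<^sub>M j\<in>J. borel) \<rightarrow>\<^sub>M (\<Pi>\<^sub>M j\<in>J. borel :: real measure)" for J
    by measurable
  let ?P = "\<Pi>\<^sub>M j\<in>I. gamma_law (a j)"
  have upd: "(\<lambda>y. x(i := y)) \<in> borel \<rightarrow>\<^sub>M (\<Pi>\<^sub>M j\<in>insert i I. borel :: real measure)" if "x \<in> space ?P" for x
    using that insert.hyps by (intro measurable_component_update) (auto simp: space_PiM)
  have "(\<integral>\<^sup>+g. f g * ennreal (exp (- (\<Sum>j\<in>insert i I. s j * g j))) \<partial>(\<Pi>\<^sub>M j\<in>insert i I. gamma_law (a j)))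
      = (\<integral>\<^sup>+x. (\<integral>\<^sup>+y. f (x(i := y)) * ennreal (exp (- (\<Sum>j\<in>insert i I. s j * (x(i := y)) j))) \<partial>gamma_law (a i)) \<partial>?P)"
    using insert.hyps by (intro product_nn_integral_insert) measurable
  also have "\<dots> = (\<integral>\<^sup>+x. ennreal ((1 + s i) powr - a i) * ((\<integral>\<^sup>+y. f (x(i := y / (1 + s i))) \<partial>gamma_law (a i)) * ennreal (exp (- (\<Sum>j\<in>I. s j * x j)))) \<partial>?P)"
  proof (rule nn_integral_cong)
    fix x assume x: "x \<in> space ?P"
    have [measurable]: "(\<lambda>y. f (x(i := y))) \<in> borel_measurable borel"
      using measurable_compose[OF upd[OF x] insert.prems] .
    have "(\<Sum>j\<in>insert i I. s j * (x(i := y)) j) = s i * y + (\<Sum>j\<in>I. s j * x j)" for y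
      using insert.hyps by (simp add: sum.insert) (intro sum.cong, auto)
    then have "f (x(i := y)) * ennreal (exp (- (\<Sum>j\<in>insert i I. s j * (x(i := y)) j)))
        = f (x(i := y)) * ennreal (exp (- s i * y)) * ennreal (exp (- (\<Sum>j\<in>I. s j * x j)))" for y
      by (simp add: exp_diff exp_minus ennreal_mult'[symmetric] mult.assoc exp_add divide_inverse)
    then have "(\<integral>\<^sup>+y. f (x(i := y)) * ennreal (exp (- (\<Sum>j\<in>insert i I. s j * (x(i := y)) j))) \<partial>gamma_law (a i))
      = (\<integral>\<^sup>+y. f (x(i := y)) * ennreal (exp (- s i * y)) * ennreal (exp (- (\<Sum>j\<in>I. s j * x j))) \<partial>gamma_law (a i))"
      by (intro nn_integral_cong)
    also have "\<dots> = (\<integral>\<^sup>+y. f (x(i := y)) * ennreal (exp (- s i * y)) \<partial>gamma_law (a i)) * ennreal (exp (- (\<Sum>j\<in>I. s j * x j)))"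
      by (rule nn_integral_multc) measurable
    also have "(\<integral>\<^sup>+y. f (x(i := y)) * ennreal (exp (- s i * y)) \<partial>gamma_law (a i))
       = ennreal ((1 + s i) powr - a i) * (\<integral>\<^sup>+y. f (x(i := y / (1 + s i))) \<partial>gamma_law (a i))"
      by (rule gamma_law_tilt[OF a s]) measurable
    finally show "(\<integral>\<^sup>+y. f (x(i := y)) * ennreal (exp (- (\<Sum>j\<in>insert i I. s j * (x(i := y)) j))) \<partial>gamma_law (a i))
      = ennreal ((1 + s i) powr - a i) * ((\<integral>\<^sup>+y. f (x(i := y / (1 + s i))) \<partial>gamma_law (a i)) * ennreal (exp (- (\<Sum>j\<in>I. s j * x j))))"
      unfolding mult.assoc .
  qed
  also have "\<dots> = ennreal ((1 + s i) powr - a i) * (\<integral>\<^sup>+x. (\<integral>\<^sup>+y. f (x(i := y / (1 + s i))) \<partial>gamma_law (a i)) * ennreal (exp (- (\<Sum>j\<in>I. s j * x j))) \<partial>?P)"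
    by (rule nn_integral_cmult) measurable
  also have "(\<integral>\<^sup>+x. (\<integral>\<^sup>+y. f (x(i := y / (1 + s i))) \<partial>gamma_law (a i)) * ennreal (exp (- (\<Sum>j\<in>I. s j * x j))) \<partial>?P)
      = ennreal (\<Prod>j\<in>I. (1 + s j) powr - a j) * (\<integral>\<^sup>+x. (\<integral>\<^sup>+y. f ((\<lambda>j\<in>I. x j / (1 + s j))(i := y / (1 + s i))) \<partial>gamma_law (a i)) \<partial>?P)"
    by (rule insert.IH) measurable
  also have "(\<integral>\<^sup>+x. (\<integral>\<^sup>+y. f ((\<lambda>j\<in>I. x j / (1 + s j))(i := y / (1 + s i))) \<partial>gamma_law (a i)) \<partial>?P)
      = (\<integral>\<^sup>+x. (\<integral>\<^sup>+y. f (\<lambda>j\<in>insert i I. (x(i := y)) j / (1 + s j)) \<partial>gamma_law (a i)) \<partial>?P)"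
    using insert.hyps by (intro nn_integral_cong arg_cong[where f=f]) (auto simp: fun_eq_iff restrict_def)
  also have "\<dots> = (\<integral>\<^sup>+g. f (\<lambda>j\<in>insert i I. g j / (1 + s j)) \<partial>(\<Pi>\<^sub>M j\<in>insert i I. gamma_law (a j)))"
    using insert.hyps by (intro product_nn_integral_insert[symmetric]) measurable
  finally have *: "(\<integral>\<^sup>+g. f g * ennreal (exp (- (\<Sum>j\<in>insert i I. s j * g j))) \<partial>(\<Pi>\<^sub>M j\<in>insert i I. gamma_law (a j))) =
      ennreal ((1 + s i) powr - a i) * (ennreal (\<Prod>j\<in>I. (1 + s j) powr - a j) *
      (\<integral>\<^sup>+g. f (\<lambda>j\<in>insert i I. g j / (1 + s j)) \<partial>(\<Pi>\<^sub>M j\<in>insert i I. gamma_law (a j))))" .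
  have "ennreal (\<Prod>j\<in>insert i I. (1 + s j) powr - a j) = ennreal ((1 + s i) powr - a i) * ennreal (\<Prod>j\<in>I. (1 + s j) powr - a j)"
    using insert.hyps by (simp add: ennreal_mult' prod_nonneg)
  with * show ?case by (simp only: mult.assoc)
qed

section \<open>The Markov--Krein identity for Dirichlet vectors\<close>

text \<open>Tilting all coordinates with the same \<open>s\<close> tilts their sum and rescales the vector, which a function
  of degree 0 does not notice. So the expectation splits into a product: such functions are independent
  of the sum.\<close>
lemma gamma_homogeneous_indep_sum:
  assumes I: "finite I" and a: "\<And>j. 0 \<le> a j" and s: "0 \<le> s"
    and h: "h \<in> borel_measurable (\<Pi>\<^sub>M j\<in>I. borel)"
    and hom: "\<And>g c. 0 < c \<Longrightarrow> h (\<lambda>j\<in>I. g j / c) = h g"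
  shows "(\<integral>\<^sup>+g. h g * ennreal (exp (- (s * (\<Sum>j\<in>I. g j)))) \<partial>(\<Pi>\<^sub>M j\<in>I. gamma_law (a j))) =
    ennreal ((1 + s) powr - (\<Sum>j\<in>I. a j)) * (\<integral>\<^sup>+g. h g \<partial>(\<Pi>\<^sub>M j\<in>I. gamma_law (a j)))"
proof -
  have "(\<Prod>j\<in>I. (1 + s) powr - a j) = (1 + s) powr - (\<Sum>j\<in>I. a j)"
    using I s by (simp add: powr_sum sum_negf[symmetric])
  moreover have "h (\<lambda>j\<in>I. g j / (1 + s)) = h g" for g using s by (intro hom) simp
  ultimately show ?thesis
    using PiM_gamma_tilt[OF I a _ h, of "\<lambda>_. s"] s by (simp add: sum_distrib_left)
qed

lemma one_plus_powr_minus_le_1: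
  fixes x a :: real
  assumes "0 \<le> x" "0 \<le> a"
  shows "ennreal ((1 + x) powr - a) \<le> 1"
proof -
  have "(1 + x) powr - a \<le> (1 + x) powr 0" using assms by (intro powr_mono) auto
  also have "\<dots> \<le> 1" by simp
  finally show ?thesis by simp
qed

text \<open>If \<open>R\<close> is independent of the sum \<open>T\<close> of the coordinates, then conditioning on \<open>R\<close> and using the
  Laplace transform of the gamma variable \<open>T\<close> gives the claim. Conditioning is elementary when \<open>R\<close> takes
  countably many values, because the indicators of its level sets are homogeneous of degree 0; rounding
  \<open>R\<close> down to multiples of \<open>(1 / 2) ^ n\<close> reduces to that case.\<close>
lemma gamma_ratio_mixture:
  fixes R :: "('i \<Rightarrow> real) \<Rightarrow> real"
  assumes I: "finite I" and a: "\<And>j. 0 \<le> a j" and s: "0 \<le> s"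
    and R[measurable]: "R \<in> borel_measurable (\<Pi>\<^sub>M j\<in>I. borel)" and R0: "AE g in (\<Pi>\<^sub>M j\<in>I. gamma_law (a j)). 0 \<le> R g"
    and hom: "\<And>g c. 0 < c \<Longrightarrow> R (\<lambda>j\<in>I. g j / c) = R g"
  shows "(\<integral>\<^sup>+g. ennreal ((1 + s * R g) powr - (\<Sum>j\<in>I. a j)) \<partial>(\<Pi>\<^sub>M j\<in>I. gamma_law (a j))) =
    (\<integral>\<^sup>+g. ennreal (exp (- (s * R g * (\<Sum>j\<in>I. g j)))) \<partial>(\<Pi>\<^sub>M j\<in>I. gamma_law (a j)))"
proof -
  let ?P = "\<Pi>\<^sub>M j\<in>I. gamma_law (a j)"
  let ?th = "\<Sum>j\<in>I. a j"
  have th: "0 \<le> ?th" using a by (simp add: sum_nonneg)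
  interpret P: prob_space ?P by (intro prob_space_PiM prob_space_gamma_law a)
  have [measurable_cong]: "sets ?P = sets (\<Pi>\<^sub>M j\<in>I. borel)" by (intro sets_PiM_cong) auto
  have [measurable]: "(\<lambda>g. \<Sum>j\<in>I. g j) \<in> borel_measurable (\<Pi>\<^sub>M j\<in>I. borel :: real measure)"
    using I by (intro borel_measurable_sum measurable_component_singleton)
  have gpos: "AE g in ?P. \<forall>j\<in>I. 0 \<le> g j"
    using I by (intro AE_finite_allI AE_PiM_component prob_space_gamma_law a AE_gamma_law_nonneg)
  define u where "u n r = real (nat \<lfloor>2 ^ n * r\<rfloor>) / 2 ^ n" for n :: nat and r :: real
  have [measurable]: "u n \<in> borel_measurable borel" for n unfolding u_def[abs_def] by measurable
  have u0: "0 \<le> u n r" for n r by (simp add: u_def)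
  have ulim: "(\<lambda>n. u n r) \<longlonglongrightarrow> r" if "0 \<le> r" for r
  proof (rule LIMSEQ_I)
    fix e :: real assume "0 < e"
    then obtain n0 :: nat where n0: "(1/2) ^ n0 < e" using real_arch_pow_inv[of e "1/2"] by auto
    show "\<exists>n0. \<forall>n\<ge>n0. norm (u n r - r) < e"
    proof (intro exI allI impI)
      fix n assume "n0 \<le> n"
      then have "(1/2::real) ^ n \<le> (1/2) ^ n0" by (intro power_decreasing) auto
      moreover have "\<bar>u n r - r\<bar> \<le> (1/2) ^ n"
      proof -
        have nn: "0 \<le> \<lfloor>2 ^ n * r\<rfloor>" using that by simp
        have "\<bar>real (nat \<lfloor>2 ^ n * r\<rfloor>) - 2 ^ n * r\<bar> \<le> 1" using nn by linarith
        moreover have "\<bar>u n r - r\<bar> = \<bar>real (nat \<lfloor>2 ^ n * r\<rfloor>) - 2 ^ n * r\<bar> / 2 ^ n"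
          unfolding u_def by (subst abs_div_pos) (auto simp: field_simps)
        ultimately show ?thesis by (simp add: power_one_over divide_right_mono)
      qed
      ultimately show "norm (u n r - r) < e" using n0 unfolding real_norm_def by linarith
    qed
  qed
  have eq: "(\<integral>\<^sup>+g. ennreal ((1 + s * u n (R g)) powr - ?th) \<partial>?P) = (\<integral>\<^sup>+g. ennreal (exp (- (s * u n (R g) * (\<Sum>j\<in>I. g j)))) \<partial>?P)" for n
  proof -
    define K where "K g = nat \<lfloor>2 ^ n * R g\<rfloor>" for g
    define h where "h k g = (indicator {k} (K g) :: ennreal)" for k g
    have [measurable]: "h k \<in> borel_measurable (\<Pi>\<^sub>M j\<in>I. borel)" for k
      unfolding h_def[abs_def] K_def[abs_def] by measurable
    have split: "F (K g) = (\<Sum>k. h k g * F k)" for F :: "nat \<Rightarrow> ennreal" and g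
    proof -
      have "(\<Sum>k. h k g * F k) = (\<Sum>k\<in>{K g}. h k g * F k)"
        by (rule suminf_finite) (auto simp: h_def indicator_def)
      then show ?thesis by (simp add: h_def)
    qed
    have uK: "u n (R g) = real (K g) / 2 ^ n" for g by (simp add: u_def K_def)
    have "(\<integral>\<^sup>+g. ennreal (exp (- (s * u n (R g) * (\<Sum>j\<in>I. g j)))) \<partial>?P)
      = (\<integral>\<^sup>+g. (\<Sum>k. h k g * ennreal (exp (- (s * (real k / 2 ^ n) * (\<Sum>j\<in>I. g j))))) \<partial>?P)"
      unfolding uK by (subst split[of "\<lambda>k. ennreal (exp (- (s * (real k / 2 ^ n) * (\<Sum>j\<in>I. _ j))))"]) (rule refl)
    also have "\<dots> = (\<Sum>k. (\<integral>\<^sup>+g. h k g * ennreal (exp (- (s * (real k / 2 ^ n) * (\<Sum>j\<in>I. g j)))) \<partial>?P))"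
      by (rule nn_integral_suminf) measurable
    also have "\<dots> = (\<Sum>k. ennreal ((1 + s * (real k / 2 ^ n)) powr - ?th) * (\<integral>\<^sup>+g. h k g \<partial>?P))"
      using s hom by (intro suminf_cong gamma_homogeneous_indep_sum[OF I a]) (auto simp: h_def K_def)
    also have "\<dots> = (\<Sum>k. (\<integral>\<^sup>+g. h k g * ennreal ((1 + s * (real k / 2 ^ n)) powr - ?th) \<partial>?P))"
      by (intro suminf_cong) (simp add: nn_integral_multc mult.commute)
    also have "\<dots> = (\<integral>\<^sup>+g. (\<Sum>k. h k g * ennreal ((1 + s * (real k / 2 ^ n)) powr - ?th)) \<partial>?P)"
      by (rule nn_integral_suminf[symmetric]) measurable
    also have "\<dots> = (\<integral>\<^sup>+g. ennreal ((1 + s * u n (R g)) powr - ?th) \<partial>?P)"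
      unfolding uK by (subst split[of "\<lambda>k. ennreal ((1 + s * (real k / 2 ^ n)) powr - ?th)"]) (rule refl)
    finally show ?thesis by simp
  qed
  have L1: "(\<lambda>n. \<integral>\<^sup>+g. ennreal ((1 + s * u n (R g)) powr - ?th) \<partial>?P) \<longlonglongrightarrow> (\<integral>\<^sup>+g. ennreal ((1 + s * R g) powr - ?th) \<partial>?P)"
  proof (rule nn_integral_dominated_convergence[where w="\<lambda>_. 1"])
    show "AE g in ?P. ennreal ((1 + s * u n (R g)) powr - ?th) \<le> 1" for n
    proof (rule AE_I2)
      fix g
      show "ennreal ((1 + s * u n (R g)) powr - ?th) \<le> 1"
        using s u0 th by (intro one_plus_powr_minus_le_1) auto
    qed
    show "AE g in ?P. (\<lambda>n. ennreal ((1 + s * u n (R g)) powr - ?th)) \<longlonglongrightarrow> ennreal ((1 + s * R g) powr - ?th)"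
      using R0
    proof eventually_elim
      case (elim g)
      have "0 < 1 + s * R g" using s elim by (simp add: add_pos_nonneg)
      then show ?case using ulim[OF elim] by (intro tendsto_ennrealI tendsto_intros) auto
    qed
  qed (use P.emeasure_space_1 in auto)
  have L2: "(\<lambda>n. \<integral>\<^sup>+g. ennreal (exp (- (s * u n (R g) * (\<Sum>j\<in>I. g j)))) \<partial>?P) \<longlonglongrightarrow> (\<integral>\<^sup>+g. ennreal (exp (- (s * R g * (\<Sum>j\<in>I. g j)))) \<partial>?P)"
  proof (rule nn_integral_dominated_convergence[where w="\<lambda>_. 1"])
    show "AE g in ?P. ennreal (exp (- (s * u n (R g) * (\<Sum>j\<in>I. g j)))) \<le> 1" for n
      using gpos
    proof eventually_elim
      case (elim g)
      then show ?case using s u0 by (simp add: sum_nonneg)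
    qed
    show "AE g in ?P. (\<lambda>n. ennreal (exp (- (s * u n (R g) * (\<Sum>j\<in>I. g j))))) \<longlonglongrightarrow> ennreal (exp (- (s * R g * (\<Sum>j\<in>I. g j))))"
      using R0 by eventually_elim (intro tendsto_ennrealI tendsto_intros ulim)
  qed (use P.emeasure_space_1 in auto)
  show ?thesis using LIMSEQ_unique[OF L1[unfolded eq] L2] by simp
qed

text \<open>With \<open>D = g / T\<close> and \<open>R = \<Sum> c\<^sub>j D\<^sub>j\<close> the left-hand side is, by \<open>gamma_ratio_mixture\<close>, the
  expectation of \<open>exp (- s * R * T) = exp (- s * \<Sum> c\<^sub>j g\<^sub>j)\<close>, which factorises over the independent gamma
  variables.\<close>
theorem Markov_Krein_Dirichlet:
  fixes a c :: "nat \<Rightarrow> real"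
  assumes a: "\<And>j. 0 \<le> a j" and c: "\<And>j. 0 \<le> c j" and s: "0 \<le> s"
  shows "(\<integral>\<^sup>+D. ennreal ((1 + s * (\<Sum>j=1..m. c j * D j)) powr - (\<Sum>j=1..m. a j)) \<partial>dirichlet_law m a) =
    ennreal (\<Prod>j=1..m. (1 + s * c j) powr - a j)"
proof -
  let ?I = "{1..m}"
  let ?P = "\<Pi>\<^sub>M j\<in>?I. gamma_law (a j)"
  interpret P: prob_space ?P by (intro prob_space_PiM prob_space_gamma_law a)
  have [measurable_cong]: "sets ?P = sets (\<Pi>\<^sub>M j\<in>?I. borel)" by (intro sets_PiM_cong) auto
  have [measurable]: "(\<lambda>g. \<Sum>j\<in>?I. b j * g j) \<in> borel_measurable (\<Pi>\<^sub>M j\<in>?I. borel :: real measure)" for b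
    by (intro borel_measurable_sum borel_measurable_times borel_measurable_const measurable_component_singleton)
  have T[measurable]: "(\<lambda>g. \<Sum>j\<in>?I. g j) \<in> borel_measurable (\<Pi>\<^sub>M j\<in>?I. borel :: real measure)"
    by (intro borel_measurable_sum measurable_component_singleton)
  have gpos: "AE g in ?P. \<forall>j\<in>?I. 0 \<le> g j"
    by (intro AE_finite_allI AE_PiM_component prob_space_gamma_law a AE_gamma_law_nonneg finite_atLeastAtMost)
  define R where "R g = (\<Sum>j\<in>?I. c j * g j) / (\<Sum>j\<in>?I. g j)" for g
  have [measurable]: "R \<in> borel_measurable (\<Pi>\<^sub>M j\<in>?I. borel)" unfolding R_def[abs_def] by measurable
  have N: "(\<lambda>G. \<lambda>j\<in>?I. G j / (\<Sum>l=1..m. G l)) \<in> ?P \<rightarrow>\<^sub>M (\<Pi>\<^sub>M j\<in>?I. borel)"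
    by measurable
  have "(\<integral>\<^sup>+D. ennreal ((1 + s * (\<Sum>j=1..m. c j * D j)) powr - (\<Sum>j=1..m. a j)) \<partial>dirichlet_law m a)
      = (\<integral>\<^sup>+g. ennreal ((1 + s * R g) powr - (\<Sum>j=1..m. a j)) \<partial>?P)"
    unfolding dirichlet_law_def
    by (subst nn_integral_distr[OF N]) (auto simp: R_def sum_divide_distrib)
  also have "\<dots> = (\<integral>\<^sup>+g. ennreal (exp (- (s * R g * (\<Sum>j\<in>?I. g j)))) \<partial>?P)"
  proof (rule gamma_ratio_mixture[OF _ a s])
    show "AE g in ?P. 0 \<le> R g"
      using gpos by eventually_elim (auto simp: R_def c intro!: divide_nonneg_nonneg sum_nonneg mult_nonneg_nonneg)
    show "R (\<lambda>j\<in>?I. g j / b) = R g" if "0 < b" for g b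
      using that by (simp add: R_def sum_divide_distrib[symmetric])
    show "R \<in> borel_measurable (\<Pi>\<^sub>M j\<in>?I. borel)" by measurable
  qed simp
  also have "\<dots> = (\<integral>\<^sup>+g. 1 * ennreal (exp (- (\<Sum>j\<in>?I. (s * c j) * g j))) \<partial>?P)"
  proof (rule nn_integral_cong_AE)
    show "AE g in ?P. ennreal (exp (- (s * R g * (\<Sum>j\<in>?I. g j)))) = 1 * ennreal (exp (- (\<Sum>j\<in>?I. (s * c j) * g j)))"
      using gpos
    proof eventually_elim
      case (elim g)
      \<comment> \<open>Where the sum vanishes, \<open>R g\<close> has the default value \<open>0\<close>, and all the summands vanish as well.\<close>
      have "R g * (\<Sum>j\<in>?I. g j) = (\<Sum>j\<in>?I. c j * g j)"
      proof (cases "(\<Sum>j\<in>?I. g j) = 0")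
        case True
        then have "\<forall>j\<in>?I. g j = 0" using elim by (subst (asm) sum_nonneg_eq_0_iff) auto
        then show ?thesis by simp
      qed (simp add: R_def)
      moreover have "(\<Sum>j\<in>?I. (s * c j) * g j) = s * (\<Sum>j\<in>?I. c j * g j)"
        by (simp add: sum_distrib_left mult.assoc)
      ultimately show ?case by (simp only: mult.assoc mult_1_left)
    qed
  qed
  also have "\<dots> = ennreal (\<Prod>j\<in>?I. (1 + s * c j) powr - a j) * (\<integral>\<^sup>+g. 1 \<partial>?P)"
    using s c by (intro PiM_gamma_tilt a) auto
  also have "(\<integral>\<^sup>+g. 1 \<partial>?P) = 1" using P.emeasure_space_1 by simp
  finally show ?thesis by simp
qed

section \<open>Level partitions of simple functions\<close>

text \<open>Indexing by \<open>{1..m}\<close> matches the partitions in the definition of a Dirichlet process.\<close>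
definition level_partition :: "(real \<Rightarrow> real) \<Rightarrow> nat \<Rightarrow> (nat \<Rightarrow> real set) \<Rightarrow> (nat \<Rightarrow> real) \<Rightarrow> bool" where
  "level_partition \<phi> m D c \<longleftrightarrow>
     (\<forall>j. D j \<in> sets borel) \<and> disjoint_family_on D {1..m} \<and> (\<Union>j\<in>{1..m}. D j) = {0..} \<and>
     (\<forall>j. 0 \<le> c j) \<and> (\<forall>j. \<forall>x\<in>D j. \<phi> x = c j)"

lemma level_partitionD:
  assumes "level_partition \<phi> m D c"
  shows "\<And>j. D j \<in> sets borel" "disjoint_family_on D {1..m}" "(\<Union>j\<in>{1..m}. D j) = {0..}"
    "\<And>j. 0 \<le> c j" "\<And>j x. x \<in> D j \<Longrightarrow> \<phi> x = c j"
  using assms unfolding level_partition_def by blast+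

lemma simple_function_level_partition:
  fixes \<phi> :: "real \<Rightarrow> real"
  assumes \<phi>: "simple_function borel \<phi>" and \<phi>0: "\<And>x. 0 \<le> \<phi> x"
  shows "\<exists>m D c. level_partition \<phi> m D c"
proof -
  have fin: "finite (\<phi> ` {0..})"
    using simple_functionD(1)[OF \<phi>] by (rule finite_subset[rotated]) auto
  define m where "m = card (\<phi> ` {0..})"
  obtain b where b: "bij_betw b {1..m} (\<phi> ` {0..})"
    using ex_bij_betw_nat_finite_1[OF fin] unfolding m_def by blast
  have bij: "inj_on b {1..m}" "b ` {1..m} = \<phi> ` {0..}" using b by (auto simp: bij_betw_def)
  \<comment> \<open>The absolute value matters only for indices outside \<open>{1..m}\<close>, where \<open>b\<close> is arbitrary.\<close>
  define c where "c j = \<bar>b j\<bar>" for j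
  have cb: "c j = b j" if "j \<in> {1..m}" for j
  proof -
    have "b j \<in> \<phi> ` {0..}" using bij(2) that by blast
    then show ?thesis using \<phi>0 by (auto simp: c_def)
  qed
  define D where "D j = {x. 0 \<le> x \<and> \<phi> x = c j}" for j
  have [measurable]: "\<phi> \<in> borel_measurable borel" using \<phi> by (rule borel_measurable_simple_function)
  have "level_partition \<phi> m D c"
    unfolding level_partition_def
  proof (intro conjI allI ballI)
    show "D j \<in> sets borel" for j unfolding D_def by measurable
    show "disjoint_family_on D {1..m}"
      unfolding disjoint_family_on_def
    proof (intro ballI impI)
      fix i j assume ij: "i \<in> {1..m}" "j \<in> {1..m}" "i \<noteq> j"
      then have "c i \<noteq> c j" using inj_onD[OF bij(1)] cb by metis
      then show "D i \<inter> D j = {}" unfolding D_def by auto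
    qed
    show "(\<Union>j\<in>{1..m}. D j) = {0..}"
    proof (intro equalityI subsetI)
      fix x :: real assume "x \<in> {0..}"
      then have "\<phi> x \<in> b ` {1..m}" unfolding bij(2) by blast
      then obtain j where "j \<in> {1..m}" "\<phi> x = b j" by blast
      then show "x \<in> (\<Union>j\<in>{1..m}. D j)" using \<open>x \<in> {0..}\<close> cb by (auto simp: D_def intro!: bexI[of _ j])
    qed (auto simp: D_def)
    show "0 \<le> c j" for j by (simp add: c_def)
    show "\<phi> x = c j" if "x \<in> D j" for j x using that by (simp add: D_def)
  qed
  then show ?thesis by blast
qed

lemma AE_nonneg_imp_measure_1:
  assumes "AE x in \<nu>. 0 \<le> (x::real)" "prob_space \<nu>" "sets \<nu> = sets borel"
  shows "measure \<nu> {0..} = 1"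
proof -
  interpret prob_space \<nu> by fact
  show ?thesis using assms(1,3) prob_eq_1[of "{0..}"] by simp
qed

lemma integral_level_partition:
  fixes g :: "real \<Rightarrow> real" and D :: "nat \<Rightarrow> real set" and m :: nat
  assumes K: "prob_space \<kappa>" "sets \<kappa> = sets borel" "measure \<kappa> {0..} = 1"
    and D: "\<And>j. D j \<in> sets borel" "disjoint_family_on D {1..m}" "(\<Union>j\<in>{1..m}. D j) = {0..}"
    and c: "\<And>j x. x \<in> D j \<Longrightarrow> \<phi> x = c j" and [measurable]: "\<phi> \<in> borel_measurable borel" "g \<in> borel_measurable borel"
  shows "(LINT x|\<kappa>. g (\<phi> x)) = (\<Sum>j=1..m. g (c j) * measure \<kappa> (D j))"
    and "(\<Sum>j=1..m. measure \<kappa> (D j)) = 1"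
proof -
  interpret prob_space \<kappa> by fact
  have [measurable_cong]: "sets \<kappa> = sets borel" by fact
  have sp: "space \<kappa> = UNIV" using K(2)[THEN sets_eq_imp_space_eq] by simp
  note [measurable] = D(1)
  have "AE x in \<kappa>. x \<in> {0..}" using K(3) by (rule AE_prob_1)
  then have "AE x in \<kappa>. g (\<phi> x) = (\<Sum>j=1..m. g (c j) * indicator (D j) x)"
  proof eventually_elim
    case (elim x)
    then obtain i where i: "i \<in> {1..m}" "x \<in> D i" using D(3) by blast
    then show ?case
      using sum_indicator_disjoint_family[OF D(2) i(2) _ i(1), of "\<lambda>j. g (c j)"] c by simp
  qed
  then have "(LINT x|\<kappa>. g (\<phi> x)) = (LINT x|\<kappa>. (\<Sum>j=1..m. g (c j) * indicator (D j) x))"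
  proof (rule integral_cong_AE[rotated 2])
    show "(\<lambda>x. \<Sum>j=1..m. g (c j) * indicator (D j) x) \<in> borel_measurable \<kappa>" by measurable
  qed measurable
  also have "\<dots> = (\<Sum>j=1..m. g (c j) * measure \<kappa> (D j))"
    by (subst Bochner_Integration.integral_sum) (auto intro!: integrable_mult_right integrable_const_bound[where B=1] simp: sp)
  finally show "(LINT x|\<kappa>. g (\<phi> x)) = (\<Sum>j=1..m. g (c j) * measure \<kappa> (D j))" .
  have "(\<Sum>j=1..m. measure \<kappa> (D j)) = measure \<kappa> (\<Union>j\<in>{1..m}. D j)"
    using D by (intro finite_measure_finite_Union[symmetric]) auto
  then show "(\<Sum>j=1..m. measure \<kappa> (D j)) = 1" using D(3) K(3) by simp
qed

text \<open>The product in \<open>Markov_Krein_Dirichlet\<close> is the exponential of a sum, and this sum is the integral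
  of \<open>ln (1 + s * \<phi>)\<close> because \<open>\<phi>\<close> is constant on the sets of the partition.\<close>
lemma Markov_Krein_partition:
  fixes D :: "nat \<Rightarrow> real set"
  assumes N: "prob_space \<nu>" "sets \<nu> = sets borel" "measure \<nu> {0..} = 1"
    and D: "\<And>j. D j \<in> sets borel" "disjoint_family_on D {1..m}" "(\<Union>j\<in>{1..m}. D j) = {0..}"
    and c: "\<And>j. 0 \<le> c j" "\<And>j x. x \<in> D j \<Longrightarrow> \<phi> x = c j" and \<phi>: "\<phi> \<in> borel_measurable borel"
    and th: "0 < \<theta>" and s: "0 \<le> s"
  shows "(\<integral>\<^sup>+d. ennreal ((1 + s * (\<Sum>j=1..m. c j * d j)) powr - \<theta>) \<partial>dirichlet_law m (\<lambda>j. \<theta> * measure \<nu> (D j))) =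
    ennreal (exp (- \<theta> * (LINT x|\<nu>. ln (1 + s * \<phi> x))))"
proof -
  have *: "(LINT x|\<nu>. g (\<phi> x)) = (\<Sum>j=1..m. g (c j) * measure \<nu> (D j))" if "g \<in> borel_measurable borel" for g :: "real \<Rightarrow> real"
    by (rule integral_level_partition(1)[OF N D c(2) \<phi> that])
  have **: "(\<Sum>j=1..m. measure \<nu> (D j)) = 1"
    by (rule integral_level_partition(2)[OF N D c(2) \<phi> borel_measurable_const])
  have th': "(\<Sum>j=1..m. \<theta> * measure \<nu> (D j)) = \<theta>"
    using ** by (simp add: sum_distrib_left[symmetric])
  have "(\<Prod>j=1..m. (1 + s * c j) powr - (\<theta> * measure \<nu> (D j))) = (\<Prod>j=1..m. exp (- \<theta> * (ln (1 + s * c j) * measure \<nu> (D j))))"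
  proof (rule prod.cong)
    fix j
    have "0 < 1 + s * c j" using s c(1)[of j] by (simp add: add_pos_nonneg)
    then show "(1 + s * c j) powr - (\<theta> * measure \<nu> (D j)) = exp (- \<theta> * (ln (1 + s * c j) * measure \<nu> (D j)))"
      by (simp add: powr_def mult_ac)
  qed simp
  also have "\<dots> = exp (- \<theta> * (\<Sum>j=1..m. ln (1 + s * c j) * measure \<nu> (D j)))"
    by (subst exp_sum[symmetric]) (simp_all add: sum_distrib_left)
  also have "(\<Sum>j=1..m. ln (1 + s * c j) * measure \<nu> (D j)) = (LINT x|\<nu>. ln (1 + s * \<phi> x))"
    by (rule *[of "\<lambda>y. ln (1 + s * y)", symmetric]) measurable
  finally have "(\<Prod>j=1..m. (1 + s * c j) powr - (\<theta> * measure \<nu> (D j))) = exp (- \<theta> * (LINT x|\<nu>. ln (1 + s * \<phi> x)))" .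
  then show ?thesis
    using Markov_Krein_Dirichlet[of "\<lambda>j. \<theta> * measure \<nu> (D j)" c s m] c(1) s th unfolding th' by simp
qed

lemma dirichlet_processD:
  assumes "dirichlet_process N \<theta> \<nu> P"
  shows "prob_space N" "P \<in> N \<rightarrow>\<^sub>M subprob_algebra borel"
    "\<And>\<omega>. \<omega> \<in> space N \<Longrightarrow> measure (P \<omega>) {0..} = 1"
    "\<And>\<omega>. \<omega> \<in> space N \<Longrightarrow> prob_space (P \<omega>)" "\<And>\<omega>. \<omega> \<in> space N \<Longrightarrow> sets (P \<omega>) = sets borel"
proof -
  have P: "prob_space N" "P \<in> N \<rightarrow>\<^sub>M prob_algebra borel" "\<And>\<omega>. \<omega> \<in> space N \<Longrightarrow> measure (P \<omega>) {0..} = 1"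
    using assms by (auto simp: dirichlet_process_def)
  show "prob_space N" "P \<in> N \<rightarrow>\<^sub>M subprob_algebra borel" by (rule P(1), rule measurable_prob_algebraD[OF P(2)])
  fix \<omega> assume w: "\<omega> \<in> space N"
  show "measure (P \<omega>) {0..} = 1" "prob_space (P \<omega>)" "sets (P \<omega>) = sets borel"
    using P(3)[OF w] measurable_space[OF P(2) w] by (auto simp: space_prob_algebra)
qed

lemma dirichlet_process_simple_mean:
  assumes P: "dirichlet_process N \<theta> \<nu> P" and th: "0 < \<theta>"
    and nu: "prob_space \<nu>" "sets \<nu> = sets borel" "measure \<nu> {0..} = 1"
    and \<phi>: "simple_function borel \<phi>" "\<And>x. 0 \<le> \<phi> x" and s: "0 \<le> s"
  shows "(\<integral>\<^sup>+\<omega>. ennreal ((1 + s * (LINT x|P \<omega>. \<phi> x)) powr - \<theta>) \<partial>N) = ennreal (exp (- \<theta> * (LINT x|\<nu>. ln (1 + s * \<phi> x))))"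
proof -
  note P1 = dirichlet_processD[OF P] and Pw = dirichlet_processD(4,5)[OF P]
  obtain m D c where LP: "level_partition \<phi> m D c"
    using simple_function_level_partition[OF \<phi>] by blast
  note D = level_partitionD(1-3)[OF LP] and c = level_partitionD(4,5)[OF LP]
  have \<phi>m: "\<phi> \<in> borel_measurable borel" using \<phi>(1) by (rule borel_measurable_simple_function)
  define V where "V \<omega> = (\<lambda>j\<in>{1..m}. measure (P \<omega>) (D j))" for \<omega>
  have dV: "distr N (\<Pi>\<^sub>M j\<in>{1..m}. borel) V = dirichlet_law m (\<lambda>j. \<theta> * measure \<nu> (D j))"
    using P D unfolding dirichlet_process_def V_def by auto
  have V: "V \<in> N \<rightarrow>\<^sub>M (\<Pi>\<^sub>M j\<in>{1..m}. borel)"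
    unfolding V_def using measurable_compose[OF P1(2) measurable_measure_subprob_algebra[OF D(1)]]
    by (intro measurable_restrict) auto
  have [measurable]: "(\<lambda>d. \<Sum>j=1..m. c j * d j) \<in> borel_measurable (\<Pi>\<^sub>M j\<in>{1..m}. borel :: real measure)"
    by (intro borel_measurable_sum borel_measurable_times borel_measurable_const measurable_component_singleton)
  have "(\<integral>\<^sup>+\<omega>. ennreal ((1 + s * (LINT x|P \<omega>. \<phi> x)) powr - \<theta>) \<partial>N) =
      (\<integral>\<^sup>+\<omega>. ennreal ((1 + s * (\<Sum>j=1..m. c j * V \<omega> j)) powr - \<theta>) \<partial>N)"
  proof (rule nn_integral_cong)
    fix \<omega> assume w: "\<omega> \<in> space N"
    have "(LINT x|P \<omega>. \<phi> x) = (\<Sum>j=1..m. c j * measure (P \<omega>) (D j))"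
      by (rule integral_level_partition(1)[OF Pw[OF w] P1(3)[OF w] D c(2) \<phi>m, of "\<lambda>y. y"]) measurable
    then show "ennreal ((1 + s * (LINT x|P \<omega>. \<phi> x)) powr - \<theta>) = ennreal ((1 + s * (\<Sum>j=1..m. c j * V \<omega> j)) powr - \<theta>)"
      by (simp add: V_def)
  qed
  also have "\<dots> = (\<integral>\<^sup>+d. ennreal ((1 + s * (\<Sum>j=1..m. c j * d j)) powr - \<theta>) \<partial>distr N (\<Pi>\<^sub>M j\<in>{1..m}. borel) V)"
    by (rule nn_integral_distr[OF V, symmetric]) measurable
  also have "\<dots> = ennreal (exp (- \<theta> * (LINT x|\<nu>. ln (1 + s * \<phi> x))))"
    unfolding dV by (rule Markov_Krein_partition[OF nu D c \<phi>m th s])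
  finally show ?thesis .
qed

lemma simple_approximation_identity:
  obtains \<phi> :: "nat \<Rightarrow> real \<Rightarrow> real" where "\<And>n. simple_function borel (\<phi> n)" "\<And>n x. 0 \<le> \<phi> n x"
    "\<And>n x. 0 \<le> x \<Longrightarrow> \<phi> n x \<le> x" "\<And>x. 0 \<le> x \<Longrightarrow> (\<lambda>n. \<phi> n x) \<longlonglongrightarrow> x" "\<And>x. incseq (\<lambda>n. \<phi> n x)"
    "\<And>x. (\<lambda>n. ennreal (\<phi> n x)) \<longlonglongrightarrow> ennreal x"
proof -
  obtain f where f: "\<And>i. simple_function borel (f i)" "incseq f" "\<And>i x. f i x < top" "\<And>x. (SUP i. f i x) = ennreal x"
    using borel_measurable_implies_simple_function_sequence'[of "ennreal :: real \<Rightarrow> ennreal" borel] by auto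
  have inc: "incseq (\<lambda>n. f n x)" for x using f(2) by (auto simp: incseq_def le_fun_def)
  show thesis
  proof
    show "simple_function borel (\<lambda>x. enn2real (f n x))" for n
      by (rule simple_function_compose1[OF f(1)])
    show "enn2real (f n x) \<le> x" if "0 \<le> x" for n x
    proof -
      have "f n x \<le> ennreal x" unfolding f(4)[symmetric] by (rule SUP_upper) simp
      then show ?thesis using that by (simp add: enn2real_leI)
    qed
    show "(\<lambda>n. enn2real (f n x)) \<longlonglongrightarrow> x" if "0 \<le> x" for x
    proof -
      have "(\<lambda>n. f n x) \<longlonglongrightarrow> ennreal x" using LIMSEQ_SUP[OF inc[of x]] f(4) by simp
      from tendsto_enn2real[OF this] that show ?thesis by simp
    qed
    show "incseq (\<lambda>n. enn2real (f n x))" for x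
      using inc[of x] f(3) by (auto simp: incseq_def intro!: enn2real_mono)
    show "(\<lambda>n. ennreal (enn2real (f n x))) \<longlonglongrightarrow> ennreal x" for x
      using LIMSEQ_SUP[OF inc[of x]] f(3,4) by simp
  qed simp
qed

lemma log_integral_simple_approximation:
  assumes nu: "prob_space \<nu>" "sets \<nu> = sets borel" "AE x in \<nu>. 0 \<le> x"
    and \<phi>: "\<And>n. simple_function borel (\<phi> n)" "\<And>n x. 0 \<le> \<phi> n x"
    "\<And>n x. 0 \<le> x \<Longrightarrow> \<phi> n x \<le> x" "\<And>x. 0 \<le> x \<Longrightarrow> (\<lambda>n. \<phi> n x) \<longlonglongrightarrow> x"
    and s: "0 < s" and int: "integrable \<nu> (\<lambda>x. ln (1 + s * x))"
  shows "(\<lambda>n. LINT x|\<nu>. ln (1 + s * \<phi> n x)) \<longlonglongrightarrow> psi \<nu> s"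
    and "\<And>n. (LINT x|\<nu>. ln (1 + s * \<phi> n x)) \<le> psi \<nu> s"
proof -
  have [measurable_cong]: "sets \<nu> = sets borel" by fact
  have [measurable]: "\<phi> n \<in> borel_measurable borel" for n using \<phi>(1) by (rule borel_measurable_simple_function)
  have bd: "\<bar>ln (1 + s * \<phi> n x)\<bar> \<le> ln (1 + s * x)" if "0 \<le> x" for n x
  proof -
    have "1 \<le> 1 + s * \<phi> n x" "1 + s * \<phi> n x \<le> 1 + s * x" using s \<phi>(2)[of n x] \<phi>(3)[OF that] by auto
    then show ?thesis by (subst abs_of_nonneg) (auto intro!: ln_mono)
  qed
  show "(\<lambda>n. LINT x|\<nu>. ln (1 + s * \<phi> n x)) \<longlonglongrightarrow> psi \<nu> s"
    unfolding psi_def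
  proof (rule integral_dominated_convergence[where w="\<lambda>x. ln (1 + s * x)"])
    show "AE x in \<nu>. (\<lambda>n. ln (1 + s * \<phi> n x)) \<longlonglongrightarrow> ln (1 + s * x)"
      using nu(3)
    proof eventually_elim
      case (elim x)
      have "0 < 1 + s * x" using s elim by (simp add: add_pos_nonneg)
      then show ?case using \<phi>(4)[OF elim] by (intro tendsto_intros) auto
    qed
    show "AE x in \<nu>. norm (ln (1 + s * \<phi> n x)) \<le> ln (1 + s * x)" for n
      using nu(3) by eventually_elim (simp add: bd)
  qed (use int in auto)
  fix n
  show "(LINT x|\<nu>. ln (1 + s * \<phi> n x)) \<le> psi \<nu> s" unfolding psi_def
  proof (rule integral_mono_AE)
    show "integrable \<nu> (\<lambda>x. ln (1 + s * \<phi> n x))"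
    proof (rule Bochner_Integration.integrable_bound[OF int])
      show "AE x in \<nu>. norm (ln (1 + s * \<phi> n x)) \<le> norm (ln (1 + s * x))"
        using nu(3) by eventually_elim (metis abs_ge_self bd order_trans real_norm_def)
    qed measurable
    show "AE x in \<nu>. ln (1 + s * \<phi> n x) \<le> ln (1 + s * x)"
      using nu(3) by eventually_elim (metis abs_ge_self bd order_trans)
  qed (rule int)
qed

text \<open>The finiteness of Dirichlet means and the tightness of their approximations both rest on this
  limit.\<close>
lemma psi_limit_zero:
  assumes nu: "prob_space \<nu>" "sets \<nu> = sets borel" "AE x in \<nu>. 0 \<le> x"
    and int: "integrable \<nu> (\<lambda>x. ln (1 + x))"
  shows "(\<lambda>n. psi \<nu> (inverse (real (Suc n)))) \<longlonglongrightarrow> 0"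
proof -
  have [measurable_cong]: "sets \<nu> = sets borel" by fact
  have "(\<lambda>n. LINT x|\<nu>. ln (1 + inverse (real (Suc n)) * x)) \<longlonglongrightarrow> (LINT x|\<nu>. 0)"
  proof (rule integral_dominated_convergence[where w="\<lambda>x. ln (1 + x)"])
    show "AE x in \<nu>. (\<lambda>n. ln (1 + inverse (real (Suc n)) * x)) \<longlonglongrightarrow> 0"
    proof (rule AE_I2)
      fix x :: real
      have "(\<lambda>n. ln (1 + inverse (real (Suc n)) * x)) \<longlonglongrightarrow> ln (1 + 0 * x)"
        by (intro tendsto_intros LIMSEQ_inverse_real_of_nat) simp
      then show "(\<lambda>n. ln (1 + inverse (real (Suc n)) * x)) \<longlonglongrightarrow> 0" by simp
    qed
    show "AE x in \<nu>. norm (ln (1 + inverse (real (Suc n)) * x)) \<le> ln (1 + x)" for n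
      using nu(3)
    proof eventually_elim
      case (elim x)
      have "inverse (real (Suc n)) * x \<le> 1 * x" using elim by (intro mult_right_mono) (auto simp: field_simps)
      moreover have "0 \<le> inverse (real (Suc n)) * x" using elim by simp
      ultimately have "0 \<le> ln (1 + inverse (real (Suc n)) * x)" "ln (1 + inverse (real (Suc n)) * x) \<le> ln (1 + x)"
        by (auto intro!: ln_mono simp del: of_nat_Suc)
      then show ?case by simp
    qed
  qed (use int in auto)
  then show ?thesis by (simp add: psi_def)
qed

section \<open>Means of Dirichlet processes\<close>

text \<open>Simple functions increasing to the identity reduce this to Dirichlet vectors. On the event that the
  mean is infinite the left-hand integrands tend to 0, so the limit identity holds with \<open>H\<close>, which
  vanishes there; letting \<open>s\<close> tend to 0 in it shows that this event is null. Only then may \<open>H\<close> be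
  replaced by the function of the Bochner integral.\<close>
theorem dirichlet_process_mean_transform:
  assumes P: "dirichlet_process N \<theta> \<nu> P" and th: "0 < \<theta>"
    and nu: "prob_space \<nu>" "sets \<nu> = sets borel" "AE x in \<nu>. 0 \<le> x"
    and int: "\<And>l. 0 < l \<Longrightarrow> integrable \<nu> (\<lambda>x. ln (1 + l * x))"
    and l: "0 < l"
  shows "(\<integral>\<^sup>+\<omega>. ennreal ((1 + l * (LINT x|P \<omega>. x)) powr - \<theta>) \<partial>N) = ennreal (exp (- \<theta> * psi \<nu> l))"
proof -
  interpret n: prob_space \<nu> by fact
  note P1 = dirichlet_processD[OF P] and Pw = dirichlet_processD(4,5)[OF P]
  interpret N: prob_space N by (rule P1)
  note Ps[measurable] = P1(2)
  have nu1: "measure \<nu> {0..} = 1" by (rule AE_nonneg_imp_measure_1[OF nu(3,1,2)])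
  obtain \<phi> :: "nat \<Rightarrow> real \<Rightarrow> real" where \<phi>: "\<And>n. simple_function borel (\<phi> n)" "\<And>n x. 0 \<le> \<phi> n x"
    "\<And>n x. 0 \<le> x \<Longrightarrow> \<phi> n x \<le> x" "\<And>x. 0 \<le> x \<Longrightarrow> (\<lambda>n. \<phi> n x) \<longlonglongrightarrow> x" "\<And>x. incseq (\<lambda>n. \<phi> n x)"
    "\<And>x. (\<lambda>n. ennreal (\<phi> n x)) \<longlonglongrightarrow> ennreal x"
    by (rule simple_approximation_identity, rule that)
  have [measurable]: "\<phi> n \<in> borel_measurable borel" for n using \<phi>(1) by (rule borel_measurable_simple_function)
  define Y where "Y \<omega> = (\<integral>\<^sup>+x. ennreal x \<partial>P \<omega>)" for \<omega>
  have [measurable]: "Y \<in> borel_measurable N" unfolding Y_def[abs_def] by measurable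
  have Pnn: "AE x in P \<omega>. 0 \<le> x" if w: "\<omega> \<in> space N" for \<omega>
  proof -
    interpret W: prob_space "P \<omega>" by (rule Pw[OF w])
    from W.AE_prob_1[OF P1(3)[OF w]] show ?thesis by simp
  qed
  have mean: "(LINT x|P \<omega>. x) = enn2real (Y \<omega>)" if w: "\<omega> \<in> space N" for \<omega>
    unfolding Y_def using Pnn[OF w] by (intro integral_eq_nn_integral) (auto simp: measurable_cong_sets[OF Pw(2)[OF w] refl])
  have simple: "ennreal (LINT x|P \<omega>. \<phi> n x) = (\<integral>\<^sup>+x. ennreal (\<phi> n x) \<partial>P \<omega>)" if w: "\<omega> \<in> space N" for n \<omega>
  proof -
    interpret W: prob_space "P \<omega>" by (rule Pw[OF w])
    have [measurable_cong]: "sets (P \<omega>) = sets borel" by (rule Pw[OF w])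
    obtain B where B: "\<And>x. \<phi> n x \<le> B"
    proof -
      have "finite (range (\<phi> n))" using simple_functionD(1)[OF \<phi>(1)[of n]] by simp
      then have "\<phi> n x \<le> Max (range (\<phi> n))" for x by (intro Max_ge) auto
      then show ?thesis using that by blast
    qed
    have "integrable (P \<omega>) (\<phi> n)"
    proof (rule W.integrable_const_bound[where B=B])
      show "\<phi> n \<in> borel_measurable (P \<omega>)" unfolding measurable_cong_sets[OF Pw(2)[OF w] refl] by measurable
    qed (simp add: B \<phi>(2))
    then show ?thesis
      by (intro nn_integral_eq_integral[symmetric]) (auto simp: \<phi>(2))
  qed
  have up: "(\<lambda>n. ennreal (LINT x|P \<omega>. \<phi> n x)) \<longlonglongrightarrow> Y \<omega>" if w: "\<omega> \<in> space N" for \<omega>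
  proof -
    have [measurable_cong]: "sets (P \<omega>) = sets borel" by (rule Pw[OF w])
    have "(\<lambda>n. \<integral>\<^sup>+x. ennreal (\<phi> n x) \<partial>P \<omega>) \<longlonglongrightarrow> (\<integral>\<^sup>+x. ennreal x \<partial>P \<omega>)"
    proof (rule nn_integral_LIMSEQ)
      show "(\<lambda>n. ennreal (\<phi> n x)) \<longlonglongrightarrow> ennreal x" for x by (rule \<phi>(6))
      show "incseq (\<lambda>n x. ennreal (\<phi> n x))"
        using \<phi>(5) by (auto simp: incseq_def le_fun_def intro!: ennreal_leI)
      show "(\<lambda>x. ennreal (\<phi> n x)) \<in> borel_measurable (P \<omega>)" for n unfolding measurable_cong_sets[OF Pw(2)[OF w] refl] by measurable
    qed
    then show ?thesis unfolding Y_def simple[OF w] .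
  qed
  \<comment> \<open>On the event \<open>Y = \<infinity>\<close> the Bochner integral has the default value 0, whereas the limit wanted is 0 for
    the whole integrand.\<close>
  define H where "H s \<omega> = (if Y \<omega> = \<infinity> then 0 else ennreal ((1 + s * enn2real (Y \<omega>)) powr - \<theta>))" for s \<omega>
  have [measurable]: "H s \<in> borel_measurable N" for s unfolding H_def[abs_def] by measurable
  have EH: "(\<integral>\<^sup>+\<omega>. H s \<omega> \<partial>N) = ennreal (exp (- \<theta> * psi \<nu> s))" if s: "0 < s" for s
  proof -
    have "(\<lambda>n. \<integral>\<^sup>+\<omega>. ennreal ((1 + s * (LINT x|P \<omega>. \<phi> n x)) powr - \<theta>) \<partial>N) \<longlonglongrightarrow> (\<integral>\<^sup>+\<omega>. H s \<omega> \<partial>N)"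
    proof (rule nn_integral_dominated_convergence[where w="\<lambda>_. 1"])
      show "AE \<omega> in N. ennreal ((1 + s * (LINT x|P \<omega>. \<phi> n x)) powr - \<theta>) \<le> 1" for n
      proof (rule AE_I2)
        fix \<omega>
        have "0 \<le> (LINT x|P \<omega>. \<phi> n x)" by (intro integral_nonneg_AE AE_I2 \<phi>(2))
        then show "ennreal ((1 + s * (LINT x|P \<omega>. \<phi> n x)) powr - \<theta>) \<le> 1"
          using s th by (intro one_plus_powr_minus_le_1) auto
      qed
      show "AE \<omega> in N. (\<lambda>n. ennreal ((1 + s * (LINT x|P \<omega>. \<phi> n x)) powr - \<theta>)) \<longlonglongrightarrow> H s \<omega>"
      proof (rule AE_I2)
        fix \<omega> assume w: "\<omega> \<in> space N"
        have nn: "0 \<le> (LINT x|P \<omega>. \<phi> n x)" for n by (intro integral_nonneg_AE AE_I2 \<phi>(2))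
        show "(\<lambda>n. ennreal ((1 + s * (LINT x|P \<omega>. \<phi> n x)) powr - \<theta>)) \<longlonglongrightarrow> H s \<omega>"
        proof (cases "Y \<omega> = \<infinity>")
          case True
          have "filterlim (\<lambda>n. LINT x|P \<omega>. \<phi> n x) at_top sequentially"
            using up[OF w] True by (simp add: ennreal_tendsto_top_eq_at_top)
          then have "filterlim (\<lambda>n. 1 + s * (LINT x|P \<omega>. \<phi> n x)) at_top sequentially"
            using s by (intro filterlim_tendsto_add_at_top[OF tendsto_const] filterlim_tendsto_pos_mult_at_top[OF tendsto_const])
          then have "(\<lambda>n. (1 + s * (LINT x|P \<omega>. \<phi> n x)) powr - \<theta>) \<longlonglongrightarrow> 0"
            using th by (intro tendsto_neg_powr) auto
          from tendsto_ennrealI[OF this] show ?thesis using True by (simp add: H_def)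
        next
          case False
          then have "Y \<omega> = ennreal (enn2real (Y \<omega>))" by (simp add: less_top)
          then have "(\<lambda>n. LINT x|P \<omega>. \<phi> n x) \<longlonglongrightarrow> enn2real (Y \<omega>)"
            using up[OF w] nn by (metis enn2real_nonneg tendsto_ennreal_iff always_eventually)
          moreover have "0 < 1 + s * enn2real (Y \<omega>)" using s by (simp add: add_pos_nonneg)
          ultimately have "(\<lambda>n. ennreal ((1 + s * (LINT x|P \<omega>. \<phi> n x)) powr - \<theta>)) \<longlonglongrightarrow> ennreal ((1 + s * enn2real (Y \<omega>)) powr - \<theta>)"
            by (intro tendsto_ennrealI tendsto_intros) auto
          then show ?thesis using False by (simp add: H_def)
        qed
      qed
    qed (use N.emeasure_space_1 in auto)
    moreover have "(\<integral>\<^sup>+\<omega>. ennreal ((1 + s * (LINT x|P \<omega>. \<phi> n x)) powr - \<theta>) \<partial>N) = ennreal (exp (- \<theta> * (LINT x|\<nu>. ln (1 + s * \<phi> n x))))" for n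
      by (rule dirichlet_process_simple_mean[OF P th nu(1,2) nu1 \<phi>(1,2)]) (use s in simp)
    moreover have "(\<lambda>n. ennreal (exp (- \<theta> * (LINT x|\<nu>. ln (1 + s * \<phi> n x))))) \<longlonglongrightarrow> ennreal (exp (- \<theta> * psi \<nu> s))"
      by (intro tendsto_ennrealI tendsto_intros log_integral_simple_approximation(1)[OF nu \<phi>(1-4) s int[OF s]])
    ultimately show ?thesis by (simp add: LIMSEQ_unique)
  qed
  have "AE \<omega> in N. Y \<omega> \<noteq> \<infinity>"
  proof -
    define A where "A = {\<omega> \<in> space N. Y \<omega> \<noteq> \<infinity>}"
    have [measurable]: "A \<in> sets N" unfolding A_def by measurable
    have le: "exp (- \<theta> * psi \<nu> s) \<le> measure N A" if s: "0 < s" for s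
    proof -
      have "ennreal (exp (- \<theta> * psi \<nu> s)) = (\<integral>\<^sup>+\<omega>. H s \<omega> \<partial>N)" using EH[OF s] by simp
      also have "\<dots> \<le> (\<integral>\<^sup>+\<omega>. indicator A \<omega> \<partial>N)"
      proof (rule nn_integral_mono)
        fix \<omega> assume w: "\<omega> \<in> space N"
        have "ennreal ((1 + s * enn2real (Y \<omega>)) powr - \<theta>) \<le> 1"
          using s th by (intro one_plus_powr_minus_le_1) auto
        then show "H s \<omega> \<le> indicator A \<omega>" using w by (auto simp: H_def A_def)
      qed
      also have "\<dots> = ennreal (measure N A)" by (simp add: N.emeasure_eq_measure)
      finally show ?thesis by simp
    qed
    have "(\<lambda>n. exp (- \<theta> * psi \<nu> (inverse (real (Suc n))))) \<longlonglongrightarrow> exp (- \<theta> * 0)"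
      using int[of 1] by (intro tendsto_intros psi_limit_zero nu) simp
    then have "exp (- \<theta> * 0) \<le> measure N A"
      by (rule LIMSEQ_le_const2) (use le in \<open>auto simp del: of_nat_Suc\<close>)
    then have "measure N A = 1" using N.prob_le_1[of A] by simp
    from N.AE_prob_1[OF this] show ?thesis by (auto simp: A_def elim: eventually_mono)
  qed
  then have "AE \<omega> in N. ennreal ((1 + l * (LINT x|P \<omega>. x)) powr - \<theta>) = H l \<omega>"
    using AE_space by eventually_elim (simp add: mean H_def)
  then have "(\<integral>\<^sup>+\<omega>. ennreal ((1 + l * (LINT x|P \<omega>. x)) powr - \<theta>) \<partial>N) = (\<integral>\<^sup>+\<omega>. H l \<omega> \<partial>N)"
    by (rule nn_integral_cong_AE)
  then show ?thesis using EH[OF l] by simp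
qed

lemma mean_law_basic:
  assumes P: "dirichlet_process N \<theta> \<nu> P"
  shows "(\<lambda>\<omega>. LINT x|P \<omega>. x) \<in> borel_measurable N"
    and "prob_space (mean_law N P)" and "sets (mean_law N P) = sets borel"
    and "AE x in mean_law N P. 0 \<le> x"
proof -
  note P1 = dirichlet_processD[OF P] and Pw = dirichlet_processD(4,5)[OF P]
  interpret N: prob_space N by (rule P1)
  note Ps[measurable] = P1(2)
  show [measurable]: "(\<lambda>\<omega>. LINT x|P \<omega>. x) \<in> borel_measurable N"
    by (rule measurable_compose[OF Ps integral_measurable_subprob_algebra]) simp
  show "prob_space (mean_law N P)" unfolding mean_law_def by (rule N.prob_space_distr) measurable
  show "sets (mean_law N P) = sets borel" by (simp add: mean_law_def)
  have "AE \<omega> in N. 0 \<le> (LINT x|P \<omega>. x)"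
  proof (rule AE_I2)
    fix \<omega> assume w: "\<omega> \<in> space N"
    interpret W: prob_space "P \<omega>" by (rule Pw[OF w])
    from W.AE_prob_1[OF P1(3)[OF w]] show "0 \<le> (LINT x|P \<omega>. x)" by (intro integral_nonneg_AE) simp
  qed
  then show "AE x in mean_law N P. 0 \<le> x" unfolding mean_law_def by (subst AE_distr_iff) auto
qed

corollary mean_law_transform:
  assumes P: "dirichlet_process N \<theta> \<nu> P" and th: "0 < \<theta>"
    and nu: "prob_space \<nu>" "sets \<nu> = sets borel" "AE x in \<nu>. 0 \<le> x"
    and int: "\<And>l. 0 < l \<Longrightarrow> integrable \<nu> (\<lambda>x. ln (1 + l * x))"
    and l: "0 < l"
  shows "(\<integral>\<^sup>+x. ennreal ((1 + l * x) powr - \<theta>) \<partial>mean_law N P) = ennreal (exp (- \<theta> * psi \<nu> l))"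
  using dirichlet_process_mean_transform[OF assms] mean_law_basic(1)[OF P]
  unfolding mean_law_def by (subst nn_integral_distr) auto

lemma Stieltjes_kernel_le_1:
  fixes l x :: real
  assumes "0 \<le> l" "0 \<le> x"
  shows "norm (1 / (1 + l * x)) \<le> 1"
proof -
  have "1 \<le> 1 + l * x" using assms by simp
  then show ?thesis unfolding real_norm_def by (subst abs_of_nonneg) (auto simp: divide_le_eq_1)
qed

text \<open>For a simple function in place of the identity such a \<open>\<mu>\<close> is the law of a mean of a Dirichlet
  vector. These laws are tight because their transforms near 0 are bounded below by that of the limit,
  which tends to 1. A weak limit of a subsequence has the right transform, as the Stieltjes kernel is
  bounded and continuous on the half-line.\<close>
theorem Stieltjes_pair_exists:
  assumes nu: "prob_space \<nu>" "sets \<nu> = sets borel" "AE x in \<nu>. 0 \<le> x"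
    and int: "\<And>l. 0 < l \<Longrightarrow> integrable \<nu> (\<lambda>x. ln (1 + l * x))"
  obtains \<mu> :: "real measure" where "prob_space \<mu>" "sets \<mu> = sets borel" "AE x in \<mu>. 0 \<le> x"
    "\<And>l. 0 < l \<Longrightarrow> (LINT x|\<mu>. 1 / (1 + l * x)) = exp (- psi \<nu> l)"
proof -
  interpret n: prob_space \<nu> by fact
  have nu1: "measure \<nu> {0..} = 1" by (rule AE_nonneg_imp_measure_1[OF nu(3,1,2)])
  obtain \<phi> :: "nat \<Rightarrow> real \<Rightarrow> real" where \<phi>: "\<And>n. simple_function borel (\<phi> n)" "\<And>n x. 0 \<le> \<phi> n x"
    "\<And>n x. 0 \<le> x \<Longrightarrow> \<phi> n x \<le> x" "\<And>x. 0 \<le> x \<Longrightarrow> (\<lambda>n. \<phi> n x) \<longlonglongrightarrow> x" "\<And>x. incseq (\<lambda>n. \<phi> n x)"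
    "\<And>x. (\<lambda>n. ennreal (\<phi> n x)) \<longlonglongrightarrow> ennreal x"
    by (rule simple_approximation_identity, rule that)
  have [measurable]: "\<phi> n \<in> borel_measurable borel" for n using \<phi>(1) by (rule borel_measurable_simple_function)
  have ex: "\<exists>\<mu>::real measure. real_distribution \<mu> \<and> (AE x in \<mu>. 0 \<le> x) \<and>
      (\<forall>l\<ge>0. (LINT x|\<mu>. 1 / (1 + l * \<bar>x\<bar>)) = exp (- (LINT x|\<nu>. ln (1 + l * \<phi> n x))))" for n
  proof -
    obtain m D c where LP: "level_partition (\<phi> n) m D c"
      using simple_function_level_partition[OF \<phi>(1,2)] by blast
    note D = level_partitionD(1-3)[OF LP] and c = level_partitionD(4,5)[OF LP]
    define a where "a j = 1 * measure \<nu> (D j)" for j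
    have a: "0 \<le> a j" for j by (simp add: a_def)
    let ?L = "dirichlet_law m a"
    let ?P = "\<Pi>\<^sub>M j\<in>{1..m}. gamma_law (a j)"
    interpret P: prob_space ?P by (intro prob_space_PiM prob_space_gamma_law a)
    have [measurable_cong]: "sets ?P = sets (\<Pi>\<^sub>M j\<in>{1..m}. borel)" by (intro sets_PiM_cong) auto
    have [measurable]: "(\<lambda>g. \<Sum>j=1..m. g j) \<in> borel_measurable (\<Pi>\<^sub>M j\<in>{1..m}. borel :: real measure)"
      by (intro borel_measurable_sum measurable_component_singleton)
    have N[measurable]: "(\<lambda>G. \<lambda>j\<in>{1..m}. G j / (\<Sum>l=1..m. G l)) \<in> ?P \<rightarrow>\<^sub>M (\<Pi>\<^sub>M j\<in>{1..m}. borel)"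
      by measurable
    interpret L: prob_space ?L unfolding dirichlet_law_def by (rule P.prob_space_distr[OF N])
    have [measurable_cong]: "sets ?L = sets (\<Pi>\<^sub>M j\<in>{1..m}. borel)" by (simp add: dirichlet_law_def)
    define R where "R d = (\<Sum>j=1..m. c j * d j)" for d :: "nat \<Rightarrow> real"
    have [measurable]: "R \<in> borel_measurable (\<Pi>\<^sub>M j\<in>{1..m}. borel)"
      unfolding R_def[abs_def]
      by (intro borel_measurable_sum borel_measurable_times borel_measurable_const measurable_component_singleton)
    have gpos: "AE g in ?P. \<forall>j\<in>{1..m}. 0 \<le> g j"
      by (intro AE_finite_allI AE_PiM_component prob_space_gamma_law a AE_gamma_law_nonneg finite_atLeastAtMost)
    have R0: "AE d in ?L. 0 \<le> R d"
      unfolding dirichlet_law_def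
    proof (subst AE_distr_iff[OF N])
      show "AE g in ?P. 0 \<le> R (\<lambda>j\<in>{1..m}. g j / (\<Sum>l=1..m. g l))"
        using gpos by eventually_elim (auto simp: R_def intro!: sum_nonneg mult_nonneg_nonneg c divide_nonneg_nonneg)
    qed measurable
    have mk: "(\<integral>\<^sup>+d. ennreal ((1 + l * R d) powr - 1) \<partial>?L) = ennreal (exp (- (LINT x|\<nu>. ln (1 + l * \<phi> n x))))" if "0 \<le> l" for l
      using Markov_Krein_partition[OF nu(1,2) nu1 D c _ zero_less_one that] unfolding a_def R_def by simp
    define \<mu> where "\<mu> = distr ?L borel R"
    interpret m: prob_space \<mu> unfolding \<mu>_def by (rule L.prob_space_distr) measurable
    have [measurable_cong]: "sets \<mu> = sets borel" by (simp add: \<mu>_def)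
    have "(LINT x|\<mu>. 1 / (1 + l * \<bar>x\<bar>)) = exp (- (LINT x|\<nu>. ln (1 + l * \<phi> n x)))" if l: "0 \<le> l" for l
    proof -
      have p: "0 < 1 + l * \<bar>x\<bar>" for x using l by (simp add: add_pos_nonneg)
      have "(\<integral>\<^sup>+x. ennreal (1 / (1 + l * \<bar>x\<bar>)) \<partial>\<mu>) = (\<integral>\<^sup>+d. ennreal (1 / (1 + l * \<bar>R d\<bar>)) \<partial>?L)"
        unfolding \<mu>_def by (rule nn_integral_distr) measurable
      also have "\<dots> = (\<integral>\<^sup>+d. ennreal ((1 + l * R d) powr - 1) \<partial>?L)"
      proof (rule nn_integral_cong_AE)
        show "AE d in ?L. ennreal (1 / (1 + l * \<bar>R d\<bar>)) = ennreal ((1 + l * R d) powr - 1)"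
          using R0
        proof eventually_elim
          case (elim d)
          then have "0 < 1 + l * R d" using p[of "R d"] by simp
          then show ?case using elim by (simp add: powr_minus inverse_eq_divide)
        qed
      qed
      finally have "(\<integral>\<^sup>+x. ennreal (1 / (1 + l * \<bar>x\<bar>)) \<partial>\<mu>) = ennreal (exp (- (LINT x|\<nu>. ln (1 + l * \<phi> n x))))"
        unfolding mk[OF l] .
      then show ?thesis using p by (subst integral_eq_nn_integral) (auto simp: less_imp_le)
    qed
    moreover have "AE x in \<mu>. 0 \<le> x" unfolding \<mu>_def using R0 by (subst AE_distr_iff) auto
    moreover have "real_distribution \<mu>"
      using m.prob_space_axioms by (simp add: real_distribution_def real_distribution_axioms_def \<mu>_def)
    ultimately show ?thesis by blast
  qed
  obtain M where M: "\<And>n. real_distribution (M n)" "\<And>n. AE x in M n. 0 \<le> x"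
      "\<And>n l. 0 \<le> l \<Longrightarrow> (LINT x|M n. 1 / (1 + l * \<bar>x\<bar>)) = exp (- (LINT x|\<nu>. ln (1 + l * \<phi> n x)))"
  proof -
    from choice[OF allI[OF ex]] obtain M where A: "\<forall>n. real_distribution (M n) \<and> (AE x in M n. 0 \<le> x) \<and>
      (\<forall>l\<ge>0. (LINT x|M n. 1 / (1 + l * \<bar>x\<bar>)) = exp (- (LINT x|\<nu>. ln (1 + l * \<phi> n x))))" by (rule exE)
    show thesis by (rule that[of M]) (use A in auto)
  qed
  have "tight M"
    unfolding tight_def
  proof (intro conjI allI impI)
    show "real_distribution (M n)" for n by (rule M(1))
    fix e :: real assume e: "0 < e"
    have "(\<lambda>n. 1 - exp (- psi \<nu> (inverse (real (Suc n))))) \<longlonglongrightarrow> 1 - exp (- 0)"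
      using int[of 1] by (intro tendsto_intros psi_limit_zero nu) simp
    then have "eventually (\<lambda>n. 1 - exp (- psi \<nu> (inverse (real (Suc n)))) < e / 2) sequentially"
      using e by (intro order_tendstoD(2)) auto
    then obtain n0 where n0: "1 - exp (- psi \<nu> (inverse (real (Suc n0)))) < e / 2" by (auto simp: eventually_sequentially)
    \<comment> \<open>For \<open>x > 1 / l\<close> the function \<open>1 - 1 / (1 + l * x)\<close> is at least \<open>1 / 2\<close>, so it bounds the mass
      there.\<close>
    define l where "l = inverse (real (Suc n0))"
    have l: "0 < l" by (simp add: l_def)
    show "\<exists>a b. a < b \<and> (\<forall>n. 1 - e < measure (M n) {a<..b})"
    proof (intro exI conjI allI)
      show "-1 < 1 / l" using l by (meson less_trans neg_less_0_iff_less zero_less_divide_1_iff zero_less_one)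
      fix n
      interpret m: real_distribution "M n" by (rule M(1))
      have "indicator (UNIV - {-1<..1/l}) x / 2 \<le> 1 - 1 / (1 + l * \<bar>x\<bar>)" if "0 \<le> x" for x
      proof (cases "x \<le> 1 / l")
        case True
        have "1 \<le> 1 + l * x" using that l by simp
        then have "1 / (1 + l * x) \<le> 1" by (simp add: divide_le_eq_1)
        then show ?thesis using that True by (simp add: indicator_def)
      next
        case False
        then have "2 \<le> 1 + l * x" using l by (simp add: field_simps)
        then have "1 / (1 + l * x) \<le> 1 / 2" by (intro divide_left_mono) auto
        then show ?thesis using that False by (simp add: indicator_def)
      qed
      then have "AE x in M n. indicator (UNIV - {-1<..1/l}) x / 2 \<le> 1 - 1 / (1 + l * \<bar>x\<bar>)"
        using M(2)[of n] by (auto elim: eventually_mono)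
      moreover have i1: "integrable (M n) (\<lambda>x. 1 / (1 + l * \<bar>x\<bar>))"
      proof (rule m.integrable_const_bound[where B=1])
        show "AE x in M n. norm (1 / (1 + l * \<bar>x\<bar>)) \<le> 1"
          by (intro AE_I2 Stieltjes_kernel_le_1) (use l in auto)
      qed simp
      moreover have "integrable (M n) (\<lambda>x. indicator (UNIV - {-1<..1/l}) x / 2 :: real)"
        by (intro Bochner_Integration.integrable_divide m.integrable_const_bound[where B=1] AE_I2) (auto simp: indicator_def)
      ultimately have "(LINT x|M n. indicator (UNIV - {-1<..1/l}) x / 2) \<le> (LINT x|M n. 1 - 1 / (1 + l * \<bar>x\<bar>))"
        by (intro integral_mono_AE Bochner_Integration.integrable_diff m.integrable_const)
      also have "\<dots> = 1 - exp (- (LINT x|\<nu>. ln (1 + l * \<phi> n x)))"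
        using i1 M(3)[of l n] l by (simp add: m.prob_space[simplified])
      also have "\<dots> \<le> 1 - exp (- psi \<nu> l)"
        using log_integral_simple_approximation(2)[OF nu \<phi>(1-4) l int[OF l]] by simp
      also have "\<dots> < e / 2" using n0 by (simp add: l_def)
      finally have "measure (M n) (UNIV - {-1<..1/l}) < e" by simp
      moreover have "measure (M n) (UNIV - {-1<..1/l}) = 1 - measure (M n) {-1<..1/l}"
        using m.prob_compl[of "{-1<..1/l}"] by simp
      ultimately show "1 - e < measure (M n) {-1<..1/l}" by simp
    qed
  qed
  from tight_imp_convergent_subsubsequence[OF this strict_mono_id]
  obtain r \<mu> where r: "strict_mono r" and mu: "real_distribution \<mu>" and w: "weak_conv_m (M \<circ> r) \<mu>" by (auto simp: o_def)
  interpret m: real_distribution \<mu> by (rule mu)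
  have wi: "(\<lambda>n. LINT x|(M \<circ> r) n. f x) \<longlonglongrightarrow> (LINT x|\<mu>. f x)" if "\<And>x. isCont f x" "\<And>x. \<bar>f x\<bar> \<le> 1" for f :: "real \<Rightarrow> real"
    using weak_conv_imp_integral_bdd_continuous_conv[of "M \<circ> r" \<mu> f 1] M(1) mu w that by simp
  have nn: "AE x in \<mu>. 0 \<le> x"
  proof -
    define f :: "real \<Rightarrow> real" where "f x = min 1 (max 0 (- x))" for x
    have [measurable]: "f \<in> borel_measurable borel" unfolding f_def[abs_def] by measurable
    have "(LINT x|M n. f x) = (LINT x|M n. 0)" for n
    proof -
      interpret mn: real_distribution "M n" by (rule M(1))
      show ?thesis using M(2)[of n] by (intro integral_cong_AE) (auto simp: f_def elim: eventually_mono)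
    qed
    then have "(\<lambda>n. LINT x|(M \<circ> r) n. f x) \<longlonglongrightarrow> 0" by simp
    moreover have "(\<lambda>n. LINT x|(M \<circ> r) n. f x) \<longlonglongrightarrow> (LINT x|\<mu>. f x)"
      by (rule wi) (auto simp: f_def intro!: continuous_intros)
    ultimately have "(LINT x|\<mu>. f x) = 0" by (simp add: LIMSEQ_unique)
    moreover have "integrable \<mu> f" by (rule m.integrable_const_bound[where B=1]) (auto simp: f_def)
    ultimately have "AE x in \<mu>. f x = 0" by (subst (asm) integral_nonneg_eq_0_iff_AE) (auto simp: f_def)
    then show ?thesis by eventually_elim (auto simp: f_def min_def max_def split: if_splits)
  qed
  have st: "(LINT x|\<mu>. 1 / (1 + l * x)) = exp (- psi \<nu> l)" if l: "0 < l" for l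
  proof -
    have p: "0 < 1 + l * \<bar>x\<bar>" for x using l by (simp add: add_pos_nonneg)
    have "(\<lambda>n. LINT x|(M \<circ> r) n. 1 / (1 + l * \<bar>x\<bar>)) \<longlonglongrightarrow> (LINT x|\<mu>. 1 / (1 + l * \<bar>x\<bar>))"
      by (rule wi) (use p l in \<open>auto intro!: continuous_intros simp: less_imp_neq[symmetric]\<close>)
    moreover have "(\<lambda>n. exp (- (LINT x|\<nu>. ln (1 + l * \<phi> n x)))) \<longlonglongrightarrow> exp (- psi \<nu> l)"
      by (intro tendsto_intros log_integral_simple_approximation(1)[OF nu \<phi>(1-4) l int[OF l]])
    then have "(\<lambda>n. LINT x|(M \<circ> r) n. 1 / (1 + l * \<bar>x\<bar>)) \<longlonglongrightarrow> exp (- psi \<nu> l)"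
      using M(3)[of l] l LIMSEQ_subseq_LIMSEQ[OF _ r] by (fastforce simp: o_def)
    ultimately have "(LINT x|\<mu>. 1 / (1 + l * \<bar>x\<bar>)) = exp (- psi \<nu> l)" by (rule LIMSEQ_unique)
    moreover have "(LINT x|\<mu>. 1 / (1 + l * \<bar>x\<bar>)) = (LINT x|\<mu>. 1 / (1 + l * x))"
    proof (rule integral_cong_AE)
      show "AE x in \<mu>. 1 / (1 + l * \<bar>x\<bar>) = 1 / (1 + l * x)" using nn by eventually_elim simp
    qed auto
    ultimately show ?thesis by simp
  qed
  show thesis using that[OF m.prob_space_axioms _ nn st] by simp
qed

section \<open>Products of independent variables\<close>

lemma nn_integral_indep_prod_law:
  assumes M: "prob_space \<mu>" "sets \<mu> = sets borel" and N: "prob_space \<nu>" "sets \<nu> = sets borel"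
    and f[measurable]: "f \<in> borel_measurable borel"
  shows "(\<integral>\<^sup>+x. f x \<partial>indep_prod_law \<mu> \<nu>) = (\<integral>\<^sup>+v. (\<integral>\<^sup>+u. f (u * v) \<partial>\<mu>) \<partial>\<nu>)"
proof -
  interpret m: prob_space \<mu> by fact
  interpret n: prob_space \<nu> by fact
  interpret P: pair_sigma_finite \<mu> \<nu> by unfold_locales
  have [measurable_cong]: "sets \<mu> = sets borel" "sets \<nu> = sets borel" by fact+
  have "(\<integral>\<^sup>+x. f x \<partial>indep_prod_law \<mu> \<nu>) = (\<integral>\<^sup>+p. f (fst p * snd p) \<partial>(\<mu> \<Otimes>\<^sub>M \<nu>))"
    unfolding indep_prod_law_def by (subst nn_integral_distr) (auto simp: case_prod_beta')
  also have "\<dots> = (\<integral>\<^sup>+v. (\<integral>\<^sup>+u. f (fst (u, v) * snd (u, v)) \<partial>\<mu>) \<partial>\<nu>)"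
    by (rule P.nn_integral_snd[symmetric]) measurable
  finally show ?thesis by simp
qed

lemma indep_prod_law_basic:
  assumes M: "prob_space \<mu>" "sets \<mu> = sets borel" "AE x in \<mu>. 0 \<le> x"
    and N: "prob_space \<nu>" "sets \<nu> = sets borel" "AE x in \<nu>. 0 \<le> x"
  shows "prob_space (indep_prod_law \<mu> \<nu>)" "sets (indep_prod_law \<mu> \<nu>) = sets borel"
    "AE x in indep_prod_law \<mu> \<nu>. 0 \<le> x"
proof -
  interpret m: prob_space \<mu> by fact
  interpret n: prob_space \<nu> by fact
  interpret P: pair_prob_space \<mu> \<nu> by unfold_locales
  have [measurable_cong]: "sets \<mu> = sets borel" "sets \<nu> = sets borel" by fact+
  show "prob_space (indep_prod_law \<mu> \<nu>)" unfolding indep_prod_law_def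
    by (rule P.prob_space_distr) measurable
  show s: "sets (indep_prod_law \<mu> \<nu>) = sets borel" by (simp add: indep_prod_law_def)
  have "(\<integral>\<^sup>+x. indicator {..<0} x \<partial>indep_prod_law \<mu> \<nu>) = (\<integral>\<^sup>+v. (\<integral>\<^sup>+u. indicator {..<0} (u * v) \<partial>\<mu>) \<partial>\<nu>)"
    by (rule nn_integral_indep_prod_law[OF M(1,2) N(1,2)]) measurable
  also have "\<dots> = (\<integral>\<^sup>+v. 0 \<partial>\<nu>)"
  proof (rule nn_integral_cong_AE)
    show "AE v in \<nu>. (\<integral>\<^sup>+u. indicator {..<0} (u * v) \<partial>\<mu>) = (0::ennreal)"
      using N(3)
    proof eventually_elim
      case (elim v)
      have "(\<integral>\<^sup>+u. indicator {..<0} (u * v) \<partial>\<mu>) = (\<integral>\<^sup>+u. (0::ennreal) \<partial>\<mu>)"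
      proof (rule nn_integral_cong_AE)
        show "AE u in \<mu>. indicator {..<0} (u * v) = (0::ennreal)"
          using M(3) by eventually_elim (use elim in \<open>simp add: indicator_def not_less\<close>)
      qed
      then show ?case by simp
    qed
  qed
  finally have "{..<0} \<in> null_sets (indep_prod_law \<mu> \<nu>)" by (auto simp: s null_sets_def)
  from AE_not_in[OF this] show "AE x in indep_prod_law \<mu> \<nu>. 0 \<le> x" by (auto simp: not_less elim: eventually_mono)
qed

lemma bernoulli_law_basic: "prob_space (bernoulli_law s)" "sets (bernoulli_law s) = sets borel" "AE x in bernoulli_law s. 0 \<le> x"
proof -
  show "prob_space (bernoulli_law s)" unfolding bernoulli_law_def
    by (rule measure_pmf.prob_space_distr) simp
  show "sets (bernoulli_law s) = sets borel" by (simp add: bernoulli_law_def)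
  show "AE x in bernoulli_law s. 0 \<le> x" unfolding bernoulli_law_def by (subst AE_distr_iff) auto
qed

lemma nn_integral_XY_law:
  assumes F: "prob_space F" "sets F = sets borel" and s: "0 \<le> s" "s \<le> 1"
    and f[measurable]: "f \<in> borel_measurable borel"
  shows "(\<integral>\<^sup>+x. f x \<partial>XY_law F s) = ennreal s * (\<integral>\<^sup>+x. f x \<partial>F) + ennreal (1 - s) * f 0"
proof -
  interpret F: prob_space F by fact
  have [measurable_cong]: "sets F = sets borel" by fact
  define h where "h v = (\<integral>\<^sup>+u. f (u * v) \<partial>F)" for v
  have [measurable]: "h \<in> borel_measurable borel" unfolding h_def[abs_def] by measurable
  have "(\<integral>\<^sup>+x. f x \<partial>XY_law F s) = (\<integral>\<^sup>+v. h v \<partial>bernoulli_law s)"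
    unfolding XY_law_def h_def by (rule nn_integral_indep_prod_law[OF F bernoulli_law_basic(1,2)]) measurable
  also have "\<dots> = (\<integral>\<^sup>+b. h (of_bool b) \<partial>measure_pmf (bernoulli_pmf s))"
    unfolding bernoulli_law_def by (rule nn_integral_distr) auto
  also have "\<dots> = h 1 * ennreal s + h 0 * ennreal (1 - s)"
    using s by simp
  finally show ?thesis by (simp add: h_def F.emeasure_space_1 mult.commute)
qed

lemma XY_law_basic:
  assumes F: "prob_space F" "sets F = sets borel" "AE x in F. 0 \<le> x"
  shows "prob_space (XY_law F s)" "sets (XY_law F s) = sets borel" "AE x in XY_law F s. 0 \<le> x"
  unfolding XY_law_def using indep_prod_law_basic[OF F bernoulli_law_basic] by auto

lemma integral_XY_law:
  fixes f :: "real \<Rightarrow> real"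
  assumes F: "prob_space F" "sets F = sets borel" and s: "0 \<le> s" "s \<le> 1"
    and f[measurable]: "f \<in> borel_measurable borel" and int: "integrable F f"
  shows "integrable (XY_law F s) f" and "(LINT x|XY_law F s. f x) = s * (LINT x|F. f x) + (1 - s) * f 0"
proof -
  have [measurable_cong]: "sets F = sets borel" by fact
  have [measurable_cong]: "sets (XY_law F s) = sets borel" by (simp add: XY_law_def indep_prod_law_def)
  have "(\<integral>\<^sup>+x. ennreal (norm (f x)) \<partial>F) < \<infinity>"
    using int unfolding integrable_iff_bounded by blast
  moreover have "(\<integral>\<^sup>+x. ennreal (f x) \<partial>F) < \<infinity>" "(\<integral>\<^sup>+x. ennreal (- f x) \<partial>F) < \<infinity>"
    using int by (auto simp: real_integrable_def less_top[symmetric])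
  ultimately have fin: "(\<integral>\<^sup>+x. ennreal (f x) \<partial>F) < \<infinity>" "(\<integral>\<^sup>+x. ennreal (- f x) \<partial>F) < \<infinity>" "(\<integral>\<^sup>+x. ennreal (norm (f x)) \<partial>F) < \<infinity>"
    by blast+
  show i: "integrable (XY_law F s) f"
    unfolding integrable_iff_bounded using fin s
    by (auto simp: nn_integral_XY_law[OF F s] ennreal_mult_less_top)
  have R: "enn2real (\<integral>\<^sup>+x. ennreal (h x) \<partial>XY_law F s) = s * enn2real (\<integral>\<^sup>+x. ennreal (h x) \<partial>F) + (1 - s) * max 0 (h 0)"
    if [measurable]: "h \<in> borel_measurable borel" and "(\<integral>\<^sup>+x. ennreal (h x) \<partial>F) < \<infinity>" for h :: "real \<Rightarrow> real"
  proof -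
    have e: "enn2real (ennreal (h 0)) = max 0 (h 0)" by (simp add: max_def ennreal_neg)
    have fin: "ennreal s * (\<integral>\<^sup>+x. ennreal (h x) \<partial>F) < top" "ennreal (1 - s) * ennreal (h 0) < top"
      using that(2) by (auto simp: ennreal_mult_less_top)
    show ?thesis unfolding nn_integral_XY_law[OF F s, of "\<lambda>x. ennreal (h x)", simplified]
      using s e by (subst enn2real_plus) (use fin in \<open>auto simp: enn2real_mult\<close>)
  qed
  show "(LINT x|XY_law F s. f x) = s * (LINT x|F. f x) + (1 - s) * f 0"
  proof -
    have "s * P + (1 - s) * p - (s * Q + (1 - s) * q) = s * (P - Q) + (1 - s) * (p - q)" for P Q p q
      by (simp add: algebra_simps)
    moreover have "max 0 (f 0) - max 0 (- f 0) = f 0" by simp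
    ultimately show ?thesis
      unfolding real_lebesgue_integral_def[OF i] real_lebesgue_integral_def[OF int]
      using R[of f] R[of "\<lambda>x. - f x"] fin by simp
  qed
qed

lemma integrable_XY_lawD:
  fixes f :: "real \<Rightarrow> real"
  assumes F: "prob_space F" "sets F = sets borel" and s: "0 < s" "s \<le> 1"
    and f[measurable]: "f \<in> borel_measurable borel" and int: "integrable (XY_law F s) f"
  shows "integrable F f"
proof -
  have [measurable_cong]: "sets F = sets borel" by fact
  have "ennreal s * (\<integral>\<^sup>+x. ennreal (norm (f x)) \<partial>F) \<le> (\<integral>\<^sup>+x. ennreal (norm (f x)) \<partial>XY_law F s)"
    using s by (subst nn_integral_XY_law[OF F]) auto
  also have "\<dots> < \<infinity>" using int by (auto simp: integrable_iff_bounded)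
  finally have "(\<integral>\<^sup>+x. ennreal (norm (f x)) \<partial>F) < \<infinity>" using s by (auto simp: ennreal_mult_less_top)
  then show ?thesis by (auto simp: integrable_iff_bounded)
qed

lemma beta_law_density_integral:
  assumes a: "0 < a" "a < 1" and [measurable]: "f \<in> borel_measurable borel"
  shows "(\<integral>\<^sup>+u. f u \<partial>beta_law a (1 - a)) =
    (\<integral>\<^sup>+u. ennreal (u powr (a - 1) * (1 - u) powr - a / Beta a (1 - a)) * f u * indicator {0..1} u \<partial>lborel)"
proof -
  have "(\<integral>\<^sup>+u. f u \<partial>beta_law a (1 - a)) =
      (\<integral>\<^sup>+u. ennreal (indicator {0<..<1} u * u powr (a - 1) * (1 - u) powr (1 - a - 1) / Beta a (1 - a)) * f u \<partial>lborel)"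
    using a by (simp add: beta_law_def nn_integral_density)
  also have "\<dots> = (\<integral>\<^sup>+u. ennreal (u powr (a - 1) * (1 - u) powr - a / Beta a (1 - a)) * f u * indicator {0..1} u \<partial>lborel)"
  proof (rule nn_integral_cong_AE)
    have "AE u in lborel. u \<noteq> (0::real)" "AE u in lborel. u \<noteq> (1::real)" by (rule AE_lborel_singleton)+
    then show "AE u in lborel. ennreal (indicator {0<..<1} u * u powr (a - 1) * (1 - u) powr (1 - a - 1) / Beta a (1 - a)) * f u
       = ennreal (u powr (a - 1) * (1 - u) powr - a / Beta a (1 - a)) * f u * indicator {0..1} u"
      by eventually_elim (auto simp: indicator_def)
  qed
  finally show ?thesis .
qed

text \<open>The substitution \<open>v = u * (1 + c) / (1 + c * u)\<close> maps the unit interval onto itself and multiplies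
  the beta density by \<open>(1 + c) powr a / (1 + c * u)\<close>; hence the claim is that the density has total mass
  1.\<close>
lemma beta_law_Stieltjes:
  assumes a: "0 < a" "a \<le> 1" and c: "0 \<le> c"
  shows "(\<integral>\<^sup>+u. ennreal (1 / (1 + c * u)) \<partial>beta_law a (1 - a)) = ennreal ((1 + c) powr - a)"
proof (cases "a = 1")
  case True
  then show ?thesis using c by (simp add: beta_law_def nn_integral_return powr_minus inverse_eq_divide)
next
  case False
  with a have a: "0 < a" "a < 1" by auto
  have B: "Beta a (1 - a) > 0" using a by (simp add: Beta_def)
  define w where "w u = ennreal (u powr (a - 1) * (1 - u) powr - a / Beta a (1 - a))" for u :: real
  have [measurable]: "w \<in> borel_measurable borel" unfolding w_def[abs_def] by measurable
  have tot: "(\<integral>\<^sup>+u. w u * indicator {0..1} u \<partial>lborel) = 1"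
  proof -
    have "((\<lambda>t. t powr (a - 1) * (1 - t) powr (1 - a - 1) / Beta a (1 - a)) has_integral Beta a (1 - a) / Beta a (1 - a)) {0..1}"
      using a by (intro has_integral_divide has_integral_Beta_real) auto
    then have "((\<lambda>t. indicator {0..1} t * (t powr (a - 1) * (1 - t) powr - a / Beta a (1 - a))) has_integral 1) UNIV"
    proof -
      assume *: "((\<lambda>t. t powr (a - 1) * (1 - t) powr (1 - a - 1) / Beta a (1 - a)) has_integral Beta a (1 - a) / Beta a (1 - a)) {0..1}"
      have "(\<lambda>t. indicator {0..1} t * (t powr (a - 1) * (1 - t) powr - a / Beta a (1 - a)))
        = (\<lambda>t. if t \<in> {0..1} then t powr (a - 1) * (1 - t) powr (1 - a - 1) / Beta a (1 - a) else 0)"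
        by (auto simp: fun_eq_iff indicator_def)
      then show ?thesis using * B by (simp only: has_integral_restrict_UNIV) simp
    qed
    then have "(\<integral>\<^sup>+u. ennreal (indicator {0..1} u * (u powr (a - 1) * (1 - u) powr - a / Beta a (1 - a))) \<partial>lborel) = ennreal 1"
      using B by (intro nn_integral_has_integral_lborel) (auto intro!: divide_nonneg_pos mult_nonneg_nonneg)
    also have "(\<integral>\<^sup>+u. ennreal (indicator {0..1} u * (u powr (a - 1) * (1 - u) powr - a / Beta a (1 - a))) \<partial>lborel)
      = (\<integral>\<^sup>+u. w u * indicator {0..1} u \<partial>lborel)"
      by (intro nn_integral_cong) (simp add: w_def indicator_def)
    finally show ?thesis by simp
  qed
  define g where "g u = u * (1 + c) / (1 + c * u)" for u
  define g' where "g' u = (1 + c) / (1 + c * u)\<^sup>2" for u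
  have p: "0 < 1 + c * u" if "u \<in> {0..1}" for u using c that by (simp add: add_pos_nonneg)
  have "(\<integral>\<^sup>+u. w u * indicator {g 0..g 1} u \<partial>lborel) = (\<integral>\<^sup>+u. w (g u) * ennreal (g' u) * indicator {0..1} u \<partial>lborel)"
  proof (rule nn_integral_substitution_aux)
    show "(g has_real_derivative g' u) (at u)" if "u \<in> {0..1}" for u
    proof -
      have "(g has_real_derivative ((1 + c) * (1 + c * u) - u * (1 + c) * c) / ((1 + c * u) * (1 + c * u))) (at u)"
        unfolding g_def[abs_def] using p[OF that] by (auto intro!: derivative_eq_intros)
      also have "((1 + c) * (1 + c * u) - u * (1 + c) * c) / ((1 + c * u) * (1 + c * u)) = g' u"
        by (simp add: g'_def power2_eq_square algebra_simps)
      finally show ?thesis .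
    qed
    show "continuous_on {0..1} g'" unfolding g'_def[abs_def]
    proof (intro continuous_intros ballI)
      show "(1 + c * u)\<^sup>2 \<noteq> 0" if "u \<in> {0..1}" for u using p[OF that] by simp
    qed
    show "0 \<le> g' u" for u using c by (simp add: g'_def)
  qed auto
  also have "\<dots> = (\<integral>\<^sup>+u. ennreal ((1 + c) powr a) * (w u * ennreal (1 / (1 + c * u)) * indicator {0..1} u) \<partial>lborel)"
  proof (rule nn_integral_cong_AE)
    have "AE u in lborel. u \<noteq> (0::real)" "AE u in lborel. u \<noteq> (1::real)" by (rule AE_lborel_singleton)+
    then show "AE u in lborel. w (g u) * ennreal (g' u) * indicator {0..1} u = ennreal ((1 + c) powr a) * (w u * ennreal (1 / (1 + c * u)) * indicator {0..1} u)"
    proof eventually_elim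
      case (elim u)
      show ?case
      proof (cases "u \<in> {0..1}")
        case True
        define d where "d = 1 + c * u"
        have d: "0 < d" using p[OF True] by (simp add: d_def)
        have u: "0 < u" "0 < 1 - u" using True elim by auto
        have c1: "0 < 1 + c" using c by simp
        have gu: "g u = u * (1 + c) / d" by (simp add: g_def d_def)
        have "1 - g u = (d - u * (1 + c)) / d" using d unfolding gu by (simp add: diff_divide_distrib)
        moreover have "d - u * (1 + c) = 1 - u" by (simp add: d_def algebra_simps)
        ultimately have gu': "1 - g u = (1 - u) / d" by simp
        have "d powr (1 - a) = 1 / d powr (a - 1)" using powr_minus_divide[of d "a - 1"] by simp
        then have "g u powr (a - 1) = u powr (a - 1) * (1 + c) powr (a - 1) * d powr (1 - a)"
          unfolding gu using u d c1 by (simp add: powr_mult powr_divide)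
        moreover have "(1 - g u) powr - a = (1 - u) powr - a * d powr a"
          unfolding gu' using u d by (simp add: powr_divide powr_minus field_simps)
        ultimately have "g u powr (a - 1) * (1 - g u) powr - a * g' u
            = (u powr (a - 1) * (1 + c) powr (a - 1) * d powr (1 - a)) * ((1 - u) powr - a * d powr a) * ((1 + c) / d\<^sup>2)"
          by (simp add: g'_def d_def)
        also have "\<dots> = u powr (a - 1) * (1 - u) powr - a * ((1 + c) powr (a - 1) * (1 + c)) * (d powr (1 - a) * d powr a / d\<^sup>2)"
          by (simp add: field_simps)
        also have "(1 + c) powr (a - 1) * (1 + c) = (1 + c) powr a" using c1 by (simp add: powr_diff)
        also have "d powr (1 - a) * d powr a / d\<^sup>2 = 1 / d"
          using d by (simp add: powr_add[symmetric] power2_eq_square)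
        finally have E: "g u powr (a - 1) * (1 - g u) powr - a * g' u = u powr (a - 1) * (1 - u) powr - a * (1 + c) powr a * (1 / d)" .
        have "w (g u) * ennreal (g' u) = ennreal (g u powr (a - 1) * (1 - g u) powr - a / Beta a (1 - a) * g' u)"
          using B c by (simp add: w_def ennreal_mult'[symmetric] g'_def)
        also have "g u powr (a - 1) * (1 - g u) powr - a / Beta a (1 - a) * g' u = (g u powr (a - 1) * (1 - g u) powr - a * g' u) / Beta a (1 - a)"
          by simp
        also have "\<dots> = (1 + c) powr a * (u powr (a - 1) * (1 - u) powr - a / Beta a (1 - a) * (1 / d))"
          unfolding E by (simp add: mult_ac)
        also have "ennreal \<dots> = ennreal ((1 + c) powr a) * (w u * ennreal (1 / d))"
          using B d by (simp add: w_def ennreal_mult'[symmetric])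
        finally show ?thesis using True by (simp add: d_def)
      qed simp
    qed
  qed
  also have "\<dots> = ennreal ((1 + c) powr a) * (\<integral>\<^sup>+u. w u * ennreal (1 / (1 + c * u)) * indicator {0..1} u \<partial>lborel)"
    by (rule nn_integral_cmult) measurable
  also have "(\<integral>\<^sup>+u. w u * ennreal (1 / (1 + c * u)) * indicator {0..1} u \<partial>lborel) = (\<integral>\<^sup>+u. ennreal (1 / (1 + c * u)) \<partial>beta_law a (1 - a))"
    unfolding w_def by (rule beta_law_density_integral[OF a, symmetric]) measurable
  finally have "1 = ennreal ((1 + c) powr a) * (\<integral>\<^sup>+u. ennreal (1 / (1 + c * u)) \<partial>beta_law a (1 - a))"
    using c tot by (simp add: g_def)
  then have "ennreal ((1 + c) powr - a) * 1 = ennreal ((1 + c) powr - a) * (ennreal ((1 + c) powr a) * (\<integral>\<^sup>+u. ennreal (1 / (1 + c * u)) \<partial>beta_law a (1 - a)))"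
    by (rule arg_cong)
  also have "\<dots> = ennreal ((1 + c) powr - a * (1 + c) powr a) * (\<integral>\<^sup>+u. ennreal (1 / (1 + c * u)) \<partial>beta_law a (1 - a))"
    by (simp add: ennreal_mult' mult.assoc)
  also have "(1 + c) powr - a * (1 + c) powr a = 1" using c by (simp add: powr_add[symmetric])
  finally show ?thesis by simp
qed

lemma beta_law_basic:
  assumes a: "0 < a" "a \<le> 1"
  shows "prob_space (beta_law a (1 - a))" "sets (beta_law a (1 - a)) = sets borel" "AE x in beta_law a (1 - a). 0 \<le> x"
proof -
  show s: "sets (beta_law a (1 - a)) = sets borel" by (simp add: beta_law_def)
  have "emeasure (beta_law a (1 - a)) (space (beta_law a (1 - a))) = 1"
    using beta_law_Stieltjes[OF a, of 0] by simp
  then show "prob_space (beta_law a (1 - a))" by (rule prob_spaceI)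
  show "AE x in beta_law a (1 - a). 0 \<le> x"
  proof (cases "a = 1")
    case True
    then have eq: "beta_law a (1 - a) = return borel 1" by (simp add: beta_law_def)
    show ?thesis unfolding eq by (subst AE_return) auto
  next
    case False
    then have eq: "beta_law a (1 - a) = density lborel
       (\<lambda>x. ennreal (indicator {0<..<1} x * x powr (a - 1) * (1 - x) powr (1 - a - 1) / Beta a (1 - a)))"
      by (simp add: beta_law_def)
    show ?thesis unfolding eq by (subst AE_density) (auto simp: indicator_def)
  qed
qed

section \<open>Laws with a given Laplace exponent\<close>

lemma Stieltjes_transform_nn:
  assumes M: "prob_space \<mu>" "sets \<mu> = sets borel" "AE x in \<mu>. 0 \<le> x" and l: "0 \<le> l"
  shows "(\<integral>\<^sup>+x. ennreal (1 / (1 + l * x)) \<partial>\<mu>) = ennreal (LINT x|\<mu>. 1 / (1 + l * x))"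
proof -
  interpret prob_space \<mu> by fact
  have [measurable_cong]: "sets \<mu> = sets borel" by fact
  show ?thesis
  proof (rule nn_integral_eq_integral)
    show "integrable \<mu> (\<lambda>x. 1 / (1 + l * x))"
    proof (rule integrable_const_bound[where B=1])
      show "AE x in \<mu>. norm (1 / (1 + l * x)) \<le> 1"
        using M(3) by eventually_elim (rule Stieltjes_kernel_le_1[OF l])
    qed measurable
    show "AE x in \<mu>. 0 \<le> 1 / (1 + l * x)" using M(3) by eventually_elim (simp add: l)
  qed
qed

text \<open>The value at \<open>l = 0\<close> shows that both measures are finite.\<close>
lemma finite_measure_eqI_Laplace_nn:
  fixes \<mu> \<nu> :: "real measure"
  assumes sets: "sets \<mu> = sets borel" "sets \<nu> = sets borel"
    and nn: "AE x in \<mu>. 0 \<le> x" "AE x in \<nu>. 0 \<le> x"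
    and L: "\<And>l. 0 \<le> l \<Longrightarrow> (\<integral>\<^sup>+x. ennreal (exp (- l * x)) \<partial>\<mu>) = ennreal (c l)"
       "\<And>l. 0 \<le> l \<Longrightarrow> (\<integral>\<^sup>+x. ennreal (exp (- l * x)) \<partial>\<nu>) = ennreal (c l)"
  shows "\<mu> = \<nu>"
proof (rule finite_measure_eqI_Laplace[OF _ _ sets nn])
  note [measurable_cong] = sets
  show "finite_measure \<mu>" using L(1)[of 0] by (intro finite_measureI) simp
  show "finite_measure \<nu>" using L(2)[of 0] by (intro finite_measureI) simp
  fix n :: nat
  show "(LINT x|\<mu>. exp (- real n * x)) = (LINT x|\<nu>. exp (- real n * x))"
    using L(1,2)[of "real n"] by (subst (1 2) integral_eq_nn_integral) auto
qed

text \<open>The inner integral is the density of the product of a standard exponential variable and an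
  independent variable with law \<open>\<mu>\<close>.\<close>
lemma exponential_mixture_Laplace:
  assumes M: "prob_space \<mu>" "sets \<mu> = sets borel" "AE y in \<mu>. 0 < y" and l: "0 \<le> l"
  shows "(\<integral>\<^sup>+x. ennreal (exp (- l * x)) * ((\<integral>\<^sup>+y. ennreal (exp (- x / y) / y) \<partial>\<mu>) * indicator {0<..} x) \<partial>lborel) =
     (\<integral>\<^sup>+y. ennreal (1 / (1 + l * y)) \<partial>\<mu>)"
proof -
  interpret prob_space \<mu> by fact
  interpret P: pair_sigma_finite lborel \<mu> by unfold_locales
  have [measurable_cong]: "sets \<mu> = sets borel" by fact
  have "(\<integral>\<^sup>+x. ennreal (exp (- l * x)) * ((\<integral>\<^sup>+y. ennreal (exp (- x / y) / y) \<partial>\<mu>) * indicator {0<..} x) \<partial>lborel)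
     = (\<integral>\<^sup>+x. (\<integral>\<^sup>+y. ennreal (exp (- l * x)) * (ennreal (exp (- x / y) / y) * indicator {0<..} x) \<partial>\<mu>) \<partial>lborel)"
    by (intro nn_integral_cong) (simp add: nn_integral_cmult nn_integral_multc)
  also have "\<dots> = (\<integral>\<^sup>+y. (\<integral>\<^sup>+x. ennreal (exp (- l * x)) * (ennreal (exp (- x / y) / y) * indicator {0<..} x) \<partial>lborel) \<partial>\<mu>)"
    by (rule P.Fubini'[symmetric]) measurable
  also have "\<dots> = (\<integral>\<^sup>+y. ennreal (1 / (1 + l * y)) \<partial>\<mu>)"
  proof (rule nn_integral_cong_AE)
    show "AE y in \<mu>. (\<integral>\<^sup>+x. ennreal (exp (- l * x)) * (ennreal (exp (- x / y) / y) * indicator {0<..} x) \<partial>lborel) = ennreal (1 / (1 + l * y))"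
      using M(3)
    proof eventually_elim
      case (elim y)
      define k where "k = l + 1 / y"
      have k: "0 < k" using elim l by (simp add: k_def add_nonneg_pos)
      have "(\<integral>\<^sup>+x. ennreal (exp (- l * x)) * (ennreal (exp (- x / y) / y) * indicator {0<..} x) \<partial>lborel)
        = (\<integral>\<^sup>+x. ennreal (exp (- k * x) / y) * indicator {0..} x \<partial>lborel)"
      proof (rule nn_integral_cong_AE)
        have e: "exp (- l * x) * exp (- x / y) = exp (- k * x)" for x
          by (simp add: exp_add[symmetric] k_def algebra_simps)
        have "AE x in lborel. x \<noteq> (0::real)" by (rule AE_lborel_singleton)
        then show "AE x in lborel. ennreal (exp (- l * x)) * (ennreal (exp (- x / y) / y) * indicator {0<..} x) = ennreal (exp (- k * x) / y) * indicator {0..} x"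
          by eventually_elim (use elim e in \<open>auto simp: indicator_def ennreal_mult'[symmetric]\<close>)
      qed
      also have "\<dots> = ennreal (0 - (- (exp (- k * 0) / (k * y))))"
      proof (rule nn_integral_FTC_atLeast)
        show "((\<lambda>x. - (exp (- k * x) / (k * y))) has_real_derivative exp (- k * x) / y) (at x)" for x
          using k elim by (auto intro!: derivative_eq_intros)
        have "filterlim (\<lambda>x. - k * x) at_bot at_top"
          using k by (intro filterlim_tendsto_neg_mult_at_bot[OF tendsto_const] filterlim_ident) auto
        then have "((\<lambda>x. exp (- k * x)) \<longlongrightarrow> 0) at_top" by (rule filterlim_compose[OF exp_at_bot])
        then have "((\<lambda>x. - (exp (- k * x) / (k * y))) \<longlongrightarrow> - (0 / (k * y))) at_top"
          using k elim by (intro tendsto_intros) auto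
        then show "((\<lambda>x. - (exp (- k * x) / (k * y))) \<longlongrightarrow> 0) at_top" by simp
        show "0 \<le> exp (- k * x) / y" for x using elim by simp
      qed measurable
      also have "k * y = 1 + l * y" using elim by (simp add: k_def distrib_right)
      also have "0 - (- (exp (- k * 0) / (1 + l * y))) = 1 / (1 + l * y)" by simp
      finally show ?case .
    qed
  qed
  finally show ?thesis .
qed

text \<open>The Laplace transform of a standard exponential variable is \<open>1 / (1 + l)\<close>, so multiplication by an
  independent one turns the Stieltjes transform of \<open>\<mu>\<close> into a Laplace transform.\<close>
lemma gamma_law_1_product_Laplace:
  assumes M: "prob_space \<mu>" "sets \<mu> = sets borel" "AE y in \<mu>. 0 \<le> y" and l: "0 \<le> l"
  shows "(\<integral>\<^sup>+x. ennreal (exp (- l * x)) \<partial>indep_prod_law (gamma_law 1) \<mu>) = (\<integral>\<^sup>+y. ennreal (1 / (1 + l * y)) \<partial>\<mu>)"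
proof -
  have "(\<integral>\<^sup>+x. ennreal (exp (- l * x)) \<partial>indep_prod_law (gamma_law 1) \<mu>) = (\<integral>\<^sup>+v. (\<integral>\<^sup>+u. ennreal (exp (- l * (u * v))) \<partial>gamma_law 1) \<partial>\<mu>)"
    by (rule nn_integral_indep_prod_law[OF prob_space_gamma_law _ M(1,2)]) auto
  also have "\<dots> = (\<integral>\<^sup>+y. ennreal (1 / (1 + l * y)) \<partial>\<mu>)"
  proof (rule nn_integral_cong_AE)
    show "AE v in \<mu>. (\<integral>\<^sup>+u. ennreal (exp (- l * (u * v))) \<partial>gamma_law 1) = ennreal (1 / (1 + l * v))"
      using M(3)
    proof eventually_elim
      case (elim v)
      have "0 < 1 + l * v" using l elim by (simp add: add_pos_nonneg)
      then show ?case using gamma_law_Laplace[of 1 "l * v"] l elim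
        by (simp add: mult_ac powr_minus inverse_eq_divide)
    qed
  qed
  finally show ?thesis .
qed

text \<open>The common law of the Dirichlet mean with parameter \<open>XY_law F s\<close> and of the beta multiple of the
  one with parameter \<open>F\<close>. That its total mass is 1 is not visible from the formula; it is part of
  \<open>mean_dens_exists\<close>.\<close>
abbreviation mean_measure :: "real measure \<Rightarrow> real \<Rightarrow> real measure" where
  "mean_measure F s \<equiv> density lborel (\<lambda>x. ennreal (indicator {0<..} x * mean_dens s F x))"

locale log_integrable_law =
  fixes F :: "real measure"
  assumes F: "prob_space F" "sets F = sets borel" "AE x in F. 0 \<le> x"
    and F_int: "\<And>l. 0 < l \<Longrightarrow> integrable F (\<lambda>x. ln (1 + l * x))"

context log_integrable_law begin

lemma XY_int:
  assumes "0 < s" "s \<le> 1" "0 < l"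
  shows "integrable (XY_law F s) (\<lambda>x. ln (1 + l * x))" and "psi (XY_law F s) l = s * psi F l"
  using integral_XY_law[OF F(1,2), of s "\<lambda>x. ln (1 + l * x)"] F_int[of l] assms by (auto simp: psi_def)

text \<open>The unit mass at 0 in \<open>XY_law F s\<close> contributes \<open>ln \<bar>0 - y\<bar>\<close>. The exceptional points are those where
  the logarithmic integral diverges, and its value 0 there is only a default.\<close>
lemma AE_Phi_XY:
  assumes s: "0 < s" "s \<le> 1" and atom: "\<And>x. measure (XY_law F s) {x} \<noteq> 1"
  shows "AE y in lborel. 0 < y \<longrightarrow> Phi (XY_law F s) y = s * Phi F y + (1 - s) * ln y"
proof -
  note XY = XY_law_basic[OF F, of s]
  have [measurable_cong]: "sets (XY_law F s) = sets borel" by (rule XY)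
  have "integrable (XY_law F s) (\<lambda>x. ln (1 + \<bar>x\<bar>))"
    using XY_int(1)[OF s, of 1] XY(3)
    by (subst integrable_cong_AE[where g="\<lambda>x. ln (1 + 1 * x)"]) (auto elim: eventually_mono)
  then have "AE y in lborel. measure (XY_law F s) {y} = 0 \<and> integrable (XY_law F s) (\<lambda>x. ln \<bar>x - y\<bar>)"
    by (rule log_potential_domination[OF XY(1,2) atom]) assumption
  then show ?thesis
  proof eventually_elim
    case (elim y)
    then have "integrable (XY_law F s) (\<lambda>x. ln \<bar>x - y\<bar>)" by simp
    then have i: "integrable F (\<lambda>x. ln \<bar>x - y\<bar>)" by (rule integrable_XY_lawD[OF F(1,2) s, rotated]) measurable
    show ?case
      unfolding Phi_eq using integral_XY_law(2)[OF F(1,2) _ s(2) _ i] s by auto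
  qed
qed

lemma borel_measurable_mean_dens [measurable]: "mean_dens s F \<in> borel_measurable borel"
proof -
  note [measurable] = borel_measurable_Phi[OF F(1,2)] borel_measurable_cdf[OF XY_law_basic(1,2)[OF F]]
  show ?thesis unfolding mean_dens_def[abs_def] by measurable
qed

text \<open>The summand \<open>(1 - s) * ln x\<close> of \<open>Phi (XY_law F s)\<close> becomes the power of \<open>x\<close> in \<open>mean_dens\<close>.\<close>
lemma density_XY_eq_mean_measure:
  assumes s: "0 < s" "s \<le> 1" and atom: "\<And>x. measure (XY_law F s) {x} \<noteq> 1"
  shows "density lborel (\<lambda>x. ennreal (indicator {0<..} x * (1 / pi * exp (- Phi (XY_law F s) x) * sin (pi * cdf (XY_law F s) x))))
    = density lborel (\<lambda>x. ennreal (indicator {0<..} x * mean_dens s F x))"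
proof (rule density_cong)
  note [measurable] = borel_measurable_Phi[OF XY_law_basic(1,2)[OF F]] borel_measurable_cdf[OF XY_law_basic(1,2)[OF F]]
  show "(\<lambda>x. ennreal (indicator {0<..} x * (1 / pi * exp (- Phi (XY_law F s) x) * sin (pi * cdf (XY_law F s) x)))) \<in> borel_measurable lborel"
    by measurable
  show "(\<lambda>x. ennreal (indicator {0<..} x * mean_dens s F x)) \<in> borel_measurable lborel"
    by measurable
  show "AE x in lborel. ennreal (indicator {0<..} x * (1 / pi * exp (- Phi (XY_law F s) x) * sin (pi * cdf (XY_law F s) x)))
      = ennreal (indicator {0<..} x * mean_dens s F x)"
    using AE_Phi_XY[OF s atom]
  proof eventually_elim
    case (elim x)
    show ?case
    proof (cases "0 < x")
      case True
      have "- (s * Phi F x + (1 - s) * ln x) = (s - 1) * ln x + - s * Phi F x" by (simp add: algebra_simps)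
      then have "exp (- (s * Phi F x + (1 - s) * ln x)) = x powr (s - 1) * exp (- s * Phi F x)"
        using True by (simp only: exp_add) (simp add: powr_def)
      then show ?thesis using elim True by (simp add: mean_dens_def mult_ac)
    qed simp
  qed
qed

text \<open>This is \<open>Stieltjes_inversion\<close> with parameter \<open>XY_law F s\<close>, whose logarithmic integral is \<open>s * psi F
  l\<close>.\<close>
theorem mean_dens_unique:
  assumes s: "0 < s" "s \<le> 1" and atom: "\<And>x. measure (XY_law F s) {x} \<noteq> 1"
    and M: "prob_space \<mu>" "sets \<mu> = sets borel" "AE x in \<mu>. 0 \<le> x"
    and St: "\<And>l. 0 < l \<Longrightarrow> (\<integral>\<^sup>+x. ennreal (1 / (1 + l * x)) \<partial>\<mu>) = ennreal (exp (- s * psi F l))"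
  shows "\<mu> = mean_measure F s"
  unfolding density_XY_eq_mean_measure[OF s atom, symmetric]
proof (rule Stieltjes_inversion[OF M XY_law_basic[OF F] atom])
  fix l :: real assume l: "0 < l"
  show "integrable (XY_law F s) (\<lambda>x. ln (1 + l * x))" by (rule XY_int[OF s l])
  have "0 \<le> (LINT x|\<mu>. 1 / (1 + l * x))"
    using M(3) l by (intro integral_nonneg_AE) (auto elim!: eventually_mono)
  then have "(LINT x|\<mu>. 1 / (1 + l * x)) = exp (- s * psi F l)"
    using St[OF l] unfolding Stieltjes_transform_nn[OF M less_imp_le[OF l]] by simp
  then show "(LINT x|\<mu>. 1 / (1 + l * x)) = exp (- (LINT x|XY_law F s. ln (1 + l * x)))"
    using XY_int(2)[OF s l] by (simp add: psi_def)
qed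

text \<open>Inversion describes a solution of the Stieltjes equation that exists. With \<open>Stieltjes_pair_exists\<close>
  it shows that the explicit density is a probability density with this transform.\<close>
lemma mean_dens_exists:
  assumes s: "0 < s" "s \<le> 1" and atom: "\<And>x. measure (XY_law F s) {x} \<noteq> 1"
  shows "prob_space (mean_measure F s)"
    and "\<And>l. 0 \<le> l \<Longrightarrow> (\<integral>\<^sup>+x. ennreal (1 / (1 + l * x)) \<partial>mean_measure F s) = ennreal (exp (- s * psi F l))"
proof -
  obtain \<mu> :: "real measure" where M: "prob_space \<mu>" "sets \<mu> = sets borel" "AE x in \<mu>. 0 \<le> x"
    and St: "\<And>l. 0 < l \<Longrightarrow> (LINT x|\<mu>. 1 / (1 + l * x)) = exp (- psi (XY_law F s) l)"
    using Stieltjes_pair_exists[OF XY_law_basic[OF F] XY_int(1)[OF s]] by metis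
  have St': "(\<integral>\<^sup>+x. ennreal (1 / (1 + l * x)) \<partial>\<mu>) = ennreal (exp (- s * psi F l))" if "0 < l" for l
    using Stieltjes_transform_nn[OF M less_imp_le[OF that]] St[OF that] XY_int(2)[OF s that] by simp
  have eq: "\<mu> = mean_measure F s" by (rule mean_dens_unique[OF s atom M St'])
  show "prob_space (mean_measure F s)" using M(1) eq by simp
  show "(\<integral>\<^sup>+x. ennreal (1 / (1 + l * x)) \<partial>mean_measure F s) = ennreal (exp (- s * psi F l))" if "0 \<le> l" for l
  proof (cases "l = 0")
    case True
    interpret prob_space \<mu> by fact
    show ?thesis using True emeasure_space_1 unfolding eq[symmetric] by (simp add: psi_def)
  next
    case False
    then show ?thesis using St'[of l] that unfolding eq by simp
  qed
qed

lemma mean_dens_nonneg: "0 \<le> mean_dens s F x"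
proof -
  interpret D: real_distribution "XY_law F s"
    using XY_law_basic[OF F, of s] by (simp add: real_distribution_def real_distribution_axioms_def)
  have "0 \<le> sin (pi * cdf (XY_law F s) x)"
    using D.cdf_nonneg[of x] D.cdf_bounded_prob[of x] by (intro sin_ge_zero) (auto intro: mult_left_le)
  then show ?thesis by (simp add: mean_dens_def)
qed

lemma AE_mean_measure_pos: "AE x in mean_measure F s. 0 < x"
  by (subst AE_density) (auto simp: indicator_def)

text \<open>The integrand of \<open>g_dens\<close> is \<open>mean_dens s F y\<close> times \<open>exp (- x / y) / y\<close>, the density at \<open>x\<close> of \<open>y\<close>
  times a standard exponential variable. This kernel is bounded in \<open>y\<close> because \<open>t * exp (- t) \<le> 1\<close> for \<open>t
  = x / y\<close>.\<close>
lemma g_dens_mixture: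
  assumes s: "0 < s" "s \<le> 1" and atom: "\<And>x. measure (XY_law F s) {x} \<noteq> 1"
  shows "g_dens s F x = (LINT y|mean_measure F s. exp (- x / y) / y)"
    and "0 \<le> g_dens s F x"
    and "0 < x \<Longrightarrow> ennreal (g_dens s F x) = (\<integral>\<^sup>+y. ennreal (exp (- x / y) / y) \<partial>mean_measure F s)"
proof -
  interpret K: prob_space "mean_measure F s" by (rule mean_dens_exists[OF s atom])
  have "g_dens s F x = (LINT y|lborel. 1 / pi * (indicator {0<..} y *\<^sub>R (exp (- x / y) * y powr (s - 2)
                      * sin (pi * cdf (XY_law F s) y) * exp (- s * Phi F y))))"
    unfolding g_dens_def set_lebesgue_integral_def by (rule integral_mult_right_zero[symmetric])
  also have "\<dots> = (LINT y|lborel. (indicator {0<..} y * mean_dens s F y) *\<^sub>R (exp (- x / y) / y))"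
  proof (rule Bochner_Integration.integral_cong[OF refl])
    fix y :: real
    show "1 / pi * (indicator {0<..} y *\<^sub>R (exp (- x / y) * y powr (s - 2) * sin (pi * cdf (XY_law F s) y) * exp (- s * Phi F y)))
      = (indicator {0<..} y * mean_dens s F y) *\<^sub>R (exp (- x / y) / y)"
    proof (cases "0 < y")
      case True
      then have "y powr (s - 2) = y powr (s - 1) / y" using powr_diff[of y "s - 1" 1] by (simp add: algebra_simps)
      then show ?thesis using True by (simp add: mean_dens_def)
    qed simp
  qed
  also have "\<dots> = (LINT y|mean_measure F s. exp (- x / y) / y)"
    by (rule integral_density[symmetric]) (auto simp: mean_dens_nonneg)
  finally show eq: "g_dens s F x = (LINT y|mean_measure F s. exp (- x / y) / y)" .
  have nn: "AE y in mean_measure F s. 0 \<le> exp (- x / y) / y"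
    using AE_mean_measure_pos by eventually_elim simp
  show "0 \<le> g_dens s F x" unfolding eq by (rule integral_nonneg_AE[OF nn])
  assume x: "0 < x"
  have "integrable (mean_measure F s) (\<lambda>y. exp (- x / y) / y)"
  proof (rule K.integrable_const_bound[where B="1 / x"])
    show "AE y in mean_measure F s. norm (exp (- x / y) / y) \<le> 1 / x"
      using AE_mean_measure_pos
    proof eventually_elim
      case (elim y)
      have "x / y \<le> exp (x / y)" using exp_ge_add_one_self[of "x / y"] by linarith
      then have "x / y * exp (- x / y) \<le> exp (x / y) * exp (- x / y)" by (intro mult_right_mono) auto
      then have "x / y * exp (- x / y) \<le> 1" by (simp add: exp_add[symmetric])
      then have "exp (- x / y) / y \<le> 1 / x" using x elim by (simp add: field_simps)
      then show ?case using elim by simp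
    qed
  qed measurable
  then show "ennreal (g_dens s F x) = (\<integral>\<^sup>+y. ennreal (exp (- x / y) / y) \<partial>mean_measure F s)"
    unfolding eq by (rule nn_integral_eq_integral[symmetric]) (rule nn)
qed

lemma borel_measurable_g_dens [measurable]:
  assumes s: "0 < s" "s \<le> 1" and atom: "\<And>x. measure (XY_law F s) {x} \<noteq> 1"
  shows "g_dens s F \<in> borel_measurable borel"
proof -
  interpret K: prob_space "mean_measure F s" by (rule mean_dens_exists[OF s atom])
  show ?thesis unfolding g_dens_mixture(1)[OF s atom, abs_def] by measurable
qed

lemma g_dens_Laplace:
  assumes s: "0 < s" "s \<le> 1" and atom: "\<And>x. measure (XY_law F s) {x} \<noteq> 1" and l: "0 \<le> l"
  shows "(\<integral>\<^sup>+x. ennreal (exp (- l * x)) \<partial>density lborel (\<lambda>x. ennreal (indicator {0<..} x * g_dens s F x))) = ennreal (exp (- s * psi F l))"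
proof -
  note [measurable] = borel_measurable_g_dens[OF s atom]
  have "(\<integral>\<^sup>+x. ennreal (exp (- l * x)) \<partial>density lborel (\<lambda>x. ennreal (indicator {0<..} x * g_dens s F x)))
    = (\<integral>\<^sup>+x. ennreal (indicator {0<..} x * g_dens s F x) * ennreal (exp (- l * x)) \<partial>lborel)"
    by (rule nn_integral_density) measurable
  also have "\<dots> = (\<integral>\<^sup>+x. ennreal (exp (- l * x)) * ((\<integral>\<^sup>+y. ennreal (exp (- x / y) / y) \<partial>mean_measure F s) * indicator {0<..} x) \<partial>lborel)"
    by (intro nn_integral_cong) (auto simp: indicator_def g_dens_mixture(3)[OF s atom] mult.commute)
  also have "\<dots> = (\<integral>\<^sup>+y. ennreal (1 / (1 + l * y)) \<partial>mean_measure F s)"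
    by (rule exponential_mixture_Laplace[OF mean_dens_exists(1)[OF s atom] _ AE_mean_measure_pos l]) simp
  also have "\<dots> = ennreal (exp (- s * psi F l))" by (rule mean_dens_exists(2)[OF s atom l])
  finally show ?thesis .
qed

text \<open>Both measures on the right have Laplace transform \<open>exp (- s * psi F l)\<close>.\<close>
theorem Laplace_exponent_law:
  assumes s: "0 < s" "s \<le> 1" and atom: "\<And>x. measure (XY_law F s) {x} \<noteq> 1"
    and R: "sets \<rho> = sets borel" "AE x in \<rho>. 0 \<le> x"
    and L: "\<And>l. 0 \<le> l \<Longrightarrow> (\<integral>\<^sup>+x. ennreal (exp (- l * x)) \<partial>\<rho>) = ennreal (exp (- s * psi F l))"
  shows "\<rho> = density lborel (\<lambda>x. ennreal (indicator {0<..} x * g_dens s F x))"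
    and "\<rho> = indep_prod_law (gamma_law 1) (mean_measure F s)"
proof -
  note [measurable] = borel_measurable_g_dens[OF s atom]
  show "\<rho> = density lborel (\<lambda>x. ennreal (indicator {0<..} x * g_dens s F x))"
  proof (rule finite_measure_eqI_Laplace_nn[OF R(1) _ R(2) _ L g_dens_Laplace[OF s atom]])
    show "AE x in density lborel (\<lambda>x. ennreal (indicator {0<..} x * g_dens s F x)). 0 \<le> x"
      by (subst AE_density) (auto simp: indicator_def)
  qed auto
  have pos: "AE x in mean_measure F s. 0 \<le> x" using AE_mean_measure_pos by eventually_elim simp
  have sb: "sets (mean_measure F s) = sets borel" by simp
  have ps: "prob_space (mean_measure F s)" by (rule mean_dens_exists[OF s atom])
  note ip = indep_prod_law_basic[OF prob_space_gamma_law[of 1] sets_gamma_law AE_gamma_law_nonneg ps sb pos]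
  have LI: "(\<integral>\<^sup>+x. ennreal (exp (- l * x)) \<partial>indep_prod_law (gamma_law 1) (mean_measure F s)) = ennreal (exp (- s * psi F l))"
    if "0 \<le> l" for l
    unfolding gamma_law_1_product_Laplace[OF ps sb pos that] by (rule mean_dens_exists(2)[OF s atom that])
  show "\<rho> = indep_prod_law (gamma_law 1) (mean_measure F s)"
    by (rule finite_measure_eqI_Laplace_nn[OF R(1) _ R(2) _ L LI]) (use ip in auto)
qed

text \<open>Both laws have Stieltjes transform \<open>exp (- s * psi F l)\<close>: for the first the Markov--Krein identity
  has exponent 1 and parameter measure \<open>XY_law F s\<close>; for the second it has exponent \<open>s\<close>, and averaging
  over the beta variable restores the exponent 1.\<close>
theorem dirichlet_mean_laws:
  assumes s: "0 < s" "s \<le> 1" and atom: "\<And>x. measure (XY_law F s) {x} \<noteq> 1"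
  shows "dirichlet_process N 1 (XY_law F s) P \<Longrightarrow> mean_law N P = mean_measure F s"
    and "dirichlet_process N' s F Q \<Longrightarrow> indep_prod_law (beta_law s (1 - s)) (mean_law N' Q) = mean_measure F s"
proof -
  assume P: "dirichlet_process N 1 (XY_law F s) P"
  note b = mean_law_basic[OF P]
  show "mean_law N P = mean_measure F s"
  proof (rule mean_dens_unique[OF s atom b(2-4)])
    fix l :: real assume l: "0 < l"
    have "(\<integral>\<^sup>+x. ennreal (1 / (1 + l * x)) \<partial>mean_law N P) = (\<integral>\<^sup>+x. ennreal ((1 + l * x) powr - 1) \<partial>mean_law N P)"
    proof (rule nn_integral_cong_AE)
      show "AE x in mean_law N P. ennreal (1 / (1 + l * x)) = ennreal ((1 + l * x) powr - 1)"
        using b(4)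
      proof eventually_elim
        case (elim x)
        have "0 < 1 + l * x" using l elim by (simp add: add_pos_nonneg)
        then show ?case by (simp add: powr_minus inverse_eq_divide)
      qed
    qed
    also have "\<dots> = ennreal (exp (- 1 * psi (XY_law F s) l))"
      by (rule mean_law_transform[OF P _ XY_law_basic[OF F] XY_int(1)[OF s] l]) auto
    finally show "(\<integral>\<^sup>+x. ennreal (1 / (1 + l * x)) \<partial>mean_law N P) = ennreal (exp (- s * psi F l))"
      using XY_int(2)[OF s l] by simp
  qed
next
  assume Q: "dirichlet_process N' s F Q"
  note b = mean_law_basic[OF Q]
  note be = beta_law_basic[OF s]
  show "indep_prod_law (beta_law s (1 - s)) (mean_law N' Q) = mean_measure F s"
  proof (rule mean_dens_unique[OF s atom indep_prod_law_basic[OF be b(2-4)]])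
    fix l :: real assume l: "0 < l"
    have "(\<integral>\<^sup>+x. ennreal (1 / (1 + l * x)) \<partial>indep_prod_law (beta_law s (1 - s)) (mean_law N' Q))
      = (\<integral>\<^sup>+v. (\<integral>\<^sup>+u. ennreal (1 / (1 + l * (u * v))) \<partial>beta_law s (1 - s)) \<partial>mean_law N' Q)"
      by (rule nn_integral_indep_prod_law[OF be(1,2) b(2,3)]) measurable
    also have "\<dots> = (\<integral>\<^sup>+v. ennreal ((1 + l * v) powr - s) \<partial>mean_law N' Q)"
    proof (rule nn_integral_cong_AE)
      show "AE v in mean_law N' Q. (\<integral>\<^sup>+u. ennreal (1 / (1 + l * (u * v))) \<partial>beta_law s (1 - s)) = ennreal ((1 + l * v) powr - s)"
        using b(4)
      proof eventually_elim
        case (elim v)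
        have eq: "l * (u * v) = (l * v) * u" for u by simp
        show ?case unfolding eq using beta_law_Stieltjes[OF s, of "l * v"] l elim by simp
      qed
    qed
    also have "\<dots> = ennreal (exp (- s * psi F l))"
      by (rule mean_law_transform[OF Q s(1) F F_int l])
    finally show "(\<integral>\<^sup>+x. ennreal (1 / (1 + l * x)) \<partial>indep_prod_law (beta_law s (1 - s)) (mean_law N' Q)) = ennreal (exp (- s * psi F l))" .
  qed
qed

end

section \<open>Bounded limits of dyadic step functions\<close>

text \<open>The cells of a coarser dyadic grid are unions of cells of a finer one.\<close>
lemma ceiling_divide_pow2_cong:
  fixes a b :: real
  assumes "\<lceil>a\<rceil> = \<lceil>b\<rceil>"
  shows "\<lceil>a / 2 ^ k\<rceil> = \<lceil>b / 2 ^ k\<rceil>"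
proof -
  have *: "\<lceil>r / 2 ^ k\<rceil> \<le> i \<longleftrightarrow> \<lceil>r\<rceil> \<le> 2 ^ k * i" for r :: real and i
    by (simp add: ceiling_le_iff divide_le_eq mult.commute)
  have "\<lceil>a / 2 ^ k\<rceil> \<le> i \<longleftrightarrow> \<lceil>b / 2 ^ k\<rceil> \<le> i" for i unfolding * assms ..
  then show ?thesis by (metis order_antisym order_refl)
qed

text \<open>The condition says that \<open>f\<close> is constant on the cells \<open>{j T / 2^n <.. (j + 1) T / 2^n}\<close>, which are
  half-open on the left like the increments of a right-continuous path. The cells cover the whole line,
  so that no boundary case arises.\<close>
definition dyadic_step :: "real \<Rightarrow> nat \<Rightarrow> (real \<Rightarrow> real) \<Rightarrow> bool" where
  "dyadic_step T n f \<longleftrightarrow> (\<forall>x y. \<lceil>2 ^ n * x / T\<rceil> = \<lceil>2 ^ n * y / T\<rceil> \<longrightarrow> f x = f y)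
     \<and> (\<forall>x. 0 \<le> f x) \<and> (\<exists>B. \<forall>x. f x \<le> B)"

text \<open>The class is built from bounded pointwise limits of arbitrary, not only monotone, sequences: the
  identity to be proved by induction over it involves \<open>exp\<close> and \<open>psi F\<close>, so it is stable under such
  limits but not under linear combinations, as the monotone class theorem would require. Closure under
  algebraic operations is proved for the class itself.\<close>
inductive step_limit :: "real \<Rightarrow> (real \<Rightarrow> real) \<Rightarrow> bool" for T where
  step: "dyadic_step T n f \<Longrightarrow> step_limit T f"
| lim: "(\<And>n. step_limit T (f n)) \<Longrightarrow> (\<And>n x. f n x \<le> B) \<Longrightarrow> (\<And>x. (\<lambda>n. f n x) \<longlonglongrightarrow> g x) \<Longrightarrow> step_limit T g"

lemma dyadic_step_refine:
  assumes "dyadic_step T n f" "n \<le> m"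
  shows "dyadic_step T m f"
proof -
  have "f x = f y" if "\<lceil>2 ^ m * x / T\<rceil> = \<lceil>2 ^ m * y / T\<rceil>" for x y
  proof -
    have pow: "(2::real) ^ m = 2 ^ n * 2 ^ (m - n)" using power_add[of "2::real" n "m - n"] assms(2) by simp
    have eq: "2 ^ m * z / T / 2 ^ (m - n) = 2 ^ n * z / T" for z :: real unfolding pow by simp
    have "\<lceil>2 ^ n * x / T\<rceil> = \<lceil>2 ^ n * y / T\<rceil>"
      using ceiling_divide_pow2_cong[OF that, of "m - n"] unfolding eq .
    then show ?thesis using assms(1) unfolding dyadic_step_def by blast
  qed
  then show ?thesis using assms(1) unfolding dyadic_step_def by blast
qed

lemma dyadic_step_measurable:
  assumes "dyadic_step T n f" "0 < T"
  shows "f \<in> borel_measurable borel"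
proof -
  have "f x = f (T * of_int \<lceil>2 ^ n * x / T\<rceil> / 2 ^ n)" for x
  proof -
    have "2 ^ n * (T * of_int \<lceil>2 ^ n * x / T\<rceil> / 2 ^ n) / T = of_int \<lceil>2 ^ n * x / T\<rceil>"
      using assms(2) by simp
    then have "\<lceil>2 ^ n * x / T\<rceil> = \<lceil>2 ^ n * (T * of_int \<lceil>2 ^ n * x / T\<rceil> / 2 ^ n) / T\<rceil>"
      by (simp only: ceiling_of_int)
    then show ?thesis using assms(1) unfolding dyadic_step_def by blast
  qed
  then have eq: "f = (\<lambda>k::int. f (T * of_int k / 2 ^ n)) \<circ> (\<lambda>x. \<lceil>2 ^ n * x / T\<rceil>)"
    unfolding comp_def by (rule ext)
  have c: "(\<lambda>x::real. \<lceil>2 ^ n * x / T\<rceil>) \<in> borel \<rightarrow>\<^sub>M count_space UNIV" by measurable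
  have "(\<lambda>k::int. f (T * of_int k / 2 ^ n)) \<in> count_space UNIV \<rightarrow>\<^sub>M borel" unfolding measurable_count_space_eq1
    by (rule Pi_I) (simp only: space_borel UNIV_I)
  from measurable_comp[OF c this] show ?thesis unfolding eq[symmetric] .
qed

lemma step_limitD:
  assumes "step_limit T f" "0 < T"
  shows "\<And>x. 0 \<le> f x" "\<exists>B. \<forall>x. f x \<le> B" "f \<in> borel_measurable borel"
proof -
  have "(\<forall>x. 0 \<le> f x) \<and> (\<exists>B. \<forall>x. f x \<le> B) \<and> f \<in> borel_measurable borel"
    using assms(1)
  proof induction
    case (step n f)
    show ?case using dyadic_step_measurable[OF step assms(2)] step unfolding dyadic_step_def by blast
  next
    case (lim f B g)
    have "0 \<le> g x" for x using lim.IH by (intro LIMSEQ_le_const[OF lim.hyps(3)]) auto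
    moreover have "g x \<le> B" for x using lim.hyps(2) by (intro LIMSEQ_le_const2[OF lim.hyps(3)]) auto
    moreover have "g \<in> borel_measurable borel"
      using lim.IH by (intro borel_measurable_LIMSEQ_real[OF lim.hyps(3)]) auto
    ultimately show ?case by blast
  qed
  then show "\<And>x. 0 \<le> f x" "\<exists>B. \<forall>x. f x \<le> B" "f \<in> borel_measurable borel" by auto
qed

text \<open>Induction on the first function with a step function as second, then on the second function. The
  bound \<open>a + b + a * b\<close> is one form that covers sums, products, maxima and truncated differences alike.\<close>
lemma step_limit_combine:
  assumes T: "0 < T"
    and cont: "\<And>u v a b. u \<longlonglongrightarrow> a \<Longrightarrow> v \<longlonglongrightarrow> b \<Longrightarrow> (\<lambda>n::nat. op (u n) (v n)) \<longlonglongrightarrow> op a b"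
    and bd: "\<And>a b. 0 \<le> a \<Longrightarrow> 0 \<le> b \<Longrightarrow> 0 \<le> op a b \<and> op a b \<le> a + b + a * b"
    and f: "step_limit T f" and g: "step_limit T g"
  shows "step_limit T (\<lambda>x. op (f x) (g x) :: real)"
proof -
  have bnd: "op a b \<le> A + B + A * B" if "0 \<le> a" "a \<le> A" "0 \<le> b" "b \<le> B" for a b A B
  proof -
    have "a * b \<le> A * B" using that by (intro mult_mono) auto
    then show ?thesis using bd[of a b] that by linarith
  qed
  have ss: "step_limit T (\<lambda>x. op (f x) (g x))" if f: "dyadic_step T n f" and g: "dyadic_step T m g" for f g n m
  proof -
    have f': "dyadic_step T (max n m) f" and g': "dyadic_step T (max n m) g"
      using dyadic_step_refine[OF f, of "max n m"] dyadic_step_refine[OF g, of "max n m"] by auto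
    obtain A B where AB: "\<And>x. f x \<le> A" "\<And>x. g x \<le> B" using f g unfolding dyadic_step_def by blast
    have nn: "\<And>x. 0 \<le> f x" "\<And>x. 0 \<le> g x" using f g unfolding dyadic_step_def by blast+
    have "dyadic_step T (max n m) (\<lambda>x. op (f x) (g x))"
      unfolding dyadic_step_def
    proof (intro conjI allI impI exI)
      fix x y assume "\<lceil>2 ^ max n m * x / T\<rceil> = \<lceil>2 ^ max n m * y / T\<rceil>"
      then have "f x = f y" "g x = g y" using f' g' unfolding dyadic_step_def by blast+
      then show "op (f x) (g x) = op (f y) (g y)" by simp
    next
      fix x show "0 \<le> op (f x) (g x)" using bd nn by blast
      show "op (f x) (g x) \<le> A + B + A * B" using bnd AB nn by blast
    qed
    then show ?thesis by (rule step_limit.step)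
  qed
  have sl: "step_limit T (\<lambda>x. op (f x) (g x))" if g: "dyadic_step T m g" and "step_limit T f" for f g m
    using that(2)
  proof induction
    case (step n f)
    then show ?case using ss g by blast
  next
    case (lim f A f')
    obtain B where B: "\<And>x. g x \<le> B" using g unfolding dyadic_step_def by blast
    have nn: "\<And>x. 0 \<le> g x" using g unfolding dyadic_step_def by blast
    have fn: "0 \<le> f n x" for n x by (rule step_limitD(1)[OF _ T]) (rule lim.hyps)
    show ?case
    proof (rule step_limit.lim)
      show "step_limit T (\<lambda>x. op (f n x) (g x))" for n by (rule lim.IH)
      show "op (f n x) (g x) \<le> A + B + A * B" for n x using bnd[OF fn lim.hyps(2) nn B] .
      show "(\<lambda>n. op (f n x) (g x)) \<longlonglongrightarrow> op (f' x) (g x)" for x by (rule cont[OF lim.hyps(3) tendsto_const])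
    qed
  qed
  show ?thesis
    using g
  proof induction
    case (step n g)
    then show ?case using sl f by blast
  next
    case (lim g B g')
    obtain A where A: "\<And>x. f x \<le> A" using step_limitD(2)[OF f T] by blast
    have gn: "0 \<le> g n x" for n x by (rule step_limitD(1)[OF _ T]) (rule lim.hyps)
    show ?case
    proof (rule step_limit.lim)
      show "step_limit T (\<lambda>x. op (f x) (g n x))" for n by (rule lim.IH)
      show "op (f x) (g n x) \<le> A + B + A * B" for n x using bnd[OF step_limitD(1)[OF f T] A gn lim.hyps(2)] .
      show "(\<lambda>n. op (f x) (g n x)) \<longlonglongrightarrow> op (f x) (g' x)" for x by (rule cont[OF tendsto_const lim.hyps(3)])
    qed
  qed
qed

lemma step_limit_const: "0 \<le> c \<Longrightarrow> step_limit T (\<lambda>x. c)"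
  by (rule step_limit.step[of _ 0]) (auto simp: dyadic_step_def)

lemma step_limit_add: "0 < T \<Longrightarrow> step_limit T f \<Longrightarrow> step_limit T g \<Longrightarrow> step_limit T (\<lambda>x. f x + g x)"
  by (rule step_limit_combine[where op="(+)"]) (auto intro: tendsto_add)

lemma step_limit_mult: "0 < T \<Longrightarrow> step_limit T f \<Longrightarrow> step_limit T g \<Longrightarrow> step_limit T (\<lambda>x. f x * g x)"
  by (rule step_limit_combine[where op="(*)"]) (auto intro: tendsto_mult)

lemma step_limit_max:
  assumes "0 < T" "step_limit T f" "step_limit T g"
  shows "step_limit T (\<lambda>x. max (f x) (g x))"
proof (rule step_limit_combine[where op=max])
  show "0 \<le> max a b \<and> max a b \<le> a + b + a * b" if "0 \<le> a" "0 \<le> b" for a b :: real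
    using that mult_nonneg_nonneg[OF that] by (simp add: max_def)
qed (use assms in \<open>auto intro: tendsto_max\<close>)

lemma step_limit_diff:
  assumes "0 < T" "step_limit T f" "step_limit T g"
  shows "step_limit T (\<lambda>x. max 0 (f x - g x))"
proof (rule step_limit_combine[where op="\<lambda>a b. max 0 (a - b)"])
  show "0 \<le> max 0 (a - b) \<and> max 0 (a - b) \<le> a + b + a * b" if "0 \<le> a" "0 \<le> b" for a b :: real
    using that mult_nonneg_nonneg[OF that] by (simp add: max_def)
  show "(\<lambda>n. max 0 (u n - v n)) \<longlonglongrightarrow> max 0 (a - b)" if "u \<longlonglongrightarrow> a" "v \<longlonglongrightarrow> b" for u v :: "nat \<Rightarrow> real" and a b
    by (intro tendsto_max tendsto_const tendsto_diff that)
qed (use assms in auto)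

text \<open>The sets with this property contain the half-lines and are closed under complements, finite unions
  and monotone limits, by truncated differences, maxima and bounded limits of indicators.\<close>
theorem step_limit_indicator:
  assumes T: "0 < T" and A: "A \<in> sets borel"
  shows "step_limit T (indicator A)"
proof -
  have "A \<in> sigma_sets UNIV (range (\<lambda>a::real. {..a}))"
    using A by (simp add: borel_eq_atMost)
  then show ?thesis
  proof induction
    case (Basic A)
    then obtain a where A: "A = {..a}" by auto
    define f where "f n x = (if \<lceil>2 ^ n * x / T\<rceil> \<le> \<lceil>2 ^ n * a / T\<rceil> then 1 else 0 :: real)" for n :: nat and x
    show ?case unfolding A
    proof (rule step_limit.lim)
      show "step_limit T (f n)" for n
        by (rule step_limit.step[of _ n]) (auto simp: dyadic_step_def f_def)
      show "f n x \<le> 1" for n x by (simp add: f_def)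
      show "(\<lambda>n. f n x) \<longlonglongrightarrow> indicator {..a} x" for x
      proof (cases "x \<le> a")
        case True
        then have "2 ^ n * x / T \<le> 2 ^ n * a / T" for n :: nat using T by (simp add: divide_right_mono)
        then have "f n x = 1" for n by (simp add: f_def ceiling_mono)
        then show ?thesis using True by simp
      next
        case False
        then obtain n0 :: nat where n0: "T / (x - a) < 2 ^ n0" using real_arch_pow[of 2 "T / (x - a)"] by auto
        have "f n x = 0" if "n0 \<le> n" for n
        proof -
          have "(2::real) ^ n0 \<le> 2 ^ n" using that by (intro power_increasing) auto
          then have "T / (x - a) < 2 ^ n" using n0 by linarith
          then have "T < 2 ^ n * (x - a)" using False by (simp add: pos_divide_less_eq)
          then have "1 < 2 ^ n * (x - a) / T" using T by simp
          then have "2 ^ n * a / T + 1 < 2 ^ n * x / T" using T by (simp add: right_diff_distrib diff_divide_distrib)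
          then have "\<not> \<lceil>2 ^ n * x / T\<rceil> \<le> \<lceil>2 ^ n * a / T\<rceil>" by linarith
          then show ?thesis by (simp add: f_def)
        qed
        then have "eventually (\<lambda>n. f n x = 0) sequentially" by (auto simp: eventually_sequentially)
        then show ?thesis using False by (simp add: tendsto_eventually)
      qed
    qed
  next
    case Empty
    then show ?case using step_limit_const[of 0 T] by (simp add: indicator_def[abs_def])
  next
    case (Compl A)
    have "step_limit T (\<lambda>x. max 0 (1 - indicator A x))"
      by (intro step_limit_diff[OF T] step_limit_const Compl.IH) auto
    moreover have "(\<lambda>x. max 0 (1 - indicator A x)) = (indicator (UNIV - A) :: real \<Rightarrow> real)"
      by (auto simp: fun_eq_iff indicator_def)
    ultimately show ?case by simp
  next
    case (Union A)
    have fin: "step_limit T (indicator (\<Union>i<n. A i))" for n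
    proof (induction n)
      case 0
      then show ?case using step_limit_const[of 0 T] by (simp add: indicator_def[abs_def])
    next
      case (Suc n)
      have "step_limit T (\<lambda>x. max (indicator (\<Union>i<n. A i) x) (indicator (A n) x))"
        by (intro step_limit_max[OF T] Suc.IH Union.IH)
      moreover have "(\<lambda>x. max (indicator (\<Union>i<n. A i) x) (indicator (A n) x)) = (indicator (\<Union>i<Suc n. A i) :: real \<Rightarrow> real)"
        by (auto simp: fun_eq_iff indicator_def less_Suc_eq)
      ultimately show ?case by simp
    qed
    show ?case
    proof (rule step_limit.lim[OF fin])
      show "indicator (\<Union>i<n. A i) x \<le> (1::real)" for n x by (simp add: indicator_def)
      show "(\<lambda>n. indicator (\<Union>i<n. A i) x) \<longlonglongrightarrow> (indicator (\<Union>i. A i) x :: real)" for x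
        by (rule LIMSEQ_indicator_UN)
    qed
  qed
qed

lemma step_limit_linear_combination:
  assumes T: "0 < T" and "finite I" and "\<And>i. i \<in> I \<Longrightarrow> C i \<in> sets borel" "\<And>i. i \<in> I \<Longrightarrow> 0 \<le> l i"
  shows "step_limit T (\<lambda>x. \<Sum>i\<in>I. l i * indicator (C i) x)"
  using assms(2-4)
proof (induction I)
  case empty
  then show ?case using step_limit_const[of 0 T] by simp
next
  case (insert i I)
  have "step_limit T (\<lambda>x. l i * indicator (C i) x + (\<Sum>i\<in>I. l i * indicator (C i) x))"
    using insert by (intro step_limit_add[OF T] step_limit_mult[OF T] step_limit_const step_limit_indicator[OF T]) auto
  then show ?case by (simp only: sum.insert[OF insert.hyps])
qed

text \<open>A functional of the paths can behave arbitrarily on the null set of irregular paths, so it is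
  measurable only with respect to the completion.\<close>
lemma measurable_completion_AE_eq:
  assumes g: "g \<in> borel_measurable M" and N: "N \<in> null_sets M"
    and eq: "\<And>\<omega>. \<omega> \<in> space M - N \<Longrightarrow> f \<omega> = g \<omega>"
  shows "f \<in> borel_measurable (completion M)"
proof (rule measurableI)
  fix A :: "'b set" assume "A \<in> sets borel"
  then have "g -` A \<inter> space M - N \<in> sets M" using measurable_sets[OF g] N by auto
  then have "(g -` A \<inter> space M - N) \<union> (f -` A \<inter> space M \<inter> N) \<in> sets (completion M)"
    using N by (intro sets_completionI[OF refl, of _ N]) auto
  moreover have "f -` A \<inter> space M = (g -` A \<inter> space M - N) \<union> (f -` A \<inter> space M \<inter> N)"
    using eq by auto
  ultimately show "f -` A \<inter> space (completion M) \<in> sets (completion M)" by simp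
qed auto

text \<open>One coordinate at a time, the exponential is exchanged for an indicator. With the other factors
  absorbed into a weight \<open>W\<close>, the hypothesis says that two finite measures on the line have proportional
  Laplace transforms in this coordinate; so they are proportional, and the factorisation holds for every
  Borel set.\<close>
lemma (in prob_space) Laplace_imp_product_moments:
  fixes X :: "'i \<Rightarrow> 'a \<Rightarrow> real"
  assumes I: "finite I" and X: "\<And>i. i \<in> I \<Longrightarrow> X i \<in> borel_measurable M" and nn: "\<And>i. i \<in> I \<Longrightarrow> AE \<omega> in M. 0 \<le> X i \<omega>"
    and L: "\<And>l. (\<And>i. i \<in> I \<Longrightarrow> 0 \<le> l i) \<Longrightarrow> (\<integral>\<^sup>+\<omega>. (\<Prod>i\<in>I. ennreal (exp (- l i * X i \<omega>))) \<partial>M) = (\<Prod>i\<in>I. (\<integral>\<^sup>+\<omega>. ennreal (exp (- l i * X i \<omega>)) \<partial>M))"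
    and J: "J \<subseteq> I" and A: "\<And>i. i \<in> J \<Longrightarrow> A i \<in> sets borel" and l: "\<And>i. i \<in> I \<Longrightarrow> 0 \<le> l i"
  shows "(\<integral>\<^sup>+\<omega>. (\<Prod>i\<in>J. indicator (A i) (X i \<omega>)) * (\<Prod>i\<in>I - J. ennreal (exp (- l i * X i \<omega>))) \<partial>M) =
    (\<Prod>i\<in>J. (\<integral>\<^sup>+\<omega>. indicator (A i) (X i \<omega>) \<partial>M)) * (\<Prod>i\<in>I - J. (\<integral>\<^sup>+\<omega>. ennreal (exp (- l i * X i \<omega>)) \<partial>M))"
proof -
  note [measurable] = X
  have "finite J" using J I by (rule finite_subset)
  then show ?thesis using J A l
  proof (induction J arbitrary: l)
    case empty
    then show ?case using L[of l] by simp
  next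
    case (insert j J)
    have j: "j \<in> I" "j \<notin> J" and IJ: "I - J = insert j (I - insert j J)" using insert.prems insert.hyps by auto
    have fin: "finite (I - insert j J)" using I by simp
    have JI: "\<And>i. i \<in> J \<Longrightarrow> i \<in> I" using insert.prems by auto
    note [measurable] = insert.prems(2)
    have Xj[measurable]: "X j \<in> borel_measurable M" using X j by blast
    define W where "W \<omega> = (\<Prod>i\<in>J. indicator (A i) (X i \<omega>)) * (\<Prod>i\<in>I - insert j J. ennreal (exp (- l i * X i \<omega>)))" for \<omega>
    have [measurable]: "W \<in> borel_measurable M" unfolding W_def[abs_def]
    proof (intro borel_measurable_times_ennreal borel_measurable_prod_ennreal)
      fix i assume i: "i \<in> J"
      have [measurable]: "A i \<in> sets borel" "X i \<in> borel_measurable M" using insert.prems(2) X JI i by auto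
      show "(\<lambda>\<omega>. indicator (A i) (X i \<omega>) :: ennreal) \<in> borel_measurable M" by measurable
    next
      fix i assume i: "i \<in> I - insert j J"
      have [measurable]: "X i \<in> borel_measurable M" using X i by auto
      show "(\<lambda>\<omega>. ennreal (exp (- l i * X i \<omega>))) \<in> borel_measurable M" by measurable
    qed
    define c where "c = (\<Prod>i\<in>J. (\<integral>\<^sup>+\<omega>. indicator (A i) (X i \<omega>) \<partial>M)) * (\<Prod>i\<in>I - insert j J. (\<integral>\<^sup>+\<omega>. ennreal (exp (- l i * X i \<omega>)) \<partial>M))"
    have cfin: "c \<le> 1"
    proof -
      have "(\<integral>\<^sup>+\<omega>. indicator (A i) (X i \<omega>) \<partial>M) \<le> (\<integral>\<^sup>+\<omega>. 1 \<partial>M)" for i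
        by (intro nn_integral_mono) (simp add: indicator_def)
      moreover have "(\<integral>\<^sup>+\<omega>. ennreal (exp (- l i * X i \<omega>)) \<partial>M) \<le> (\<integral>\<^sup>+\<omega>. 1 \<partial>M)" if i: "i \<in> I - insert j J" for i
      proof (rule nn_integral_mono_AE)
        show "AE \<omega> in M. ennreal (exp (- l i * X i \<omega>)) \<le> 1"
          using nn[of i] i by (auto elim!: eventually_mono intro!: mult_nonneg_nonneg insert.prems(3))
      qed
      ultimately have "c \<le> 1 * 1" unfolding c_def
        by (intro mult_mono prod_le_1) (auto simp: emeasure_space_1)
      then show ?thesis by simp
    qed
    have base: "(\<integral>\<^sup>+\<omega>. ennreal (exp (- t * X j \<omega>)) * W \<omega> \<partial>M) = c * (\<integral>\<^sup>+\<omega>. ennreal (exp (- t * X j \<omega>)) \<partial>M)" if t: "0 \<le> t" for t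
    proof -
      have "(\<integral>\<^sup>+\<omega>. (\<Prod>i\<in>J. indicator (A i) (X i \<omega>)) * (\<Prod>i\<in>I - J. ennreal (exp (- (l(j := t)) i * X i \<omega>))) \<partial>M) =
        (\<Prod>i\<in>J. (\<integral>\<^sup>+\<omega>. indicator (A i) (X i \<omega>) \<partial>M)) * (\<Prod>i\<in>I - J. (\<integral>\<^sup>+\<omega>. ennreal (exp (- (l(j := t)) i * X i \<omega>)) \<partial>M))"
        using insert.prems t by (intro insert.IH) auto
      then show ?thesis
        unfolding IJ W_def c_def using fin by (simp add: mult_ac)
    qed
    define k1 where "k1 = distr (density M W) borel (X j)"
    define k2 where "k2 = density (distr M borel (X j)) (\<lambda>_. c)"
    have "k1 = k2"
    proof (rule finite_measure_eqI_Laplace_nn)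
      show "sets k1 = sets borel" "sets k2 = sets borel" by (auto simp: k1_def k2_def)
      have AEx: "AE x in distr M borel (X j). 0 \<le> x" using nn[OF j(1)] by (subst AE_distr_iff) auto
      show "AE x in k1. 0 \<le> x" unfolding k1_def using nn[OF j(1)] by (subst AE_distr_iff) (auto simp: AE_density)
      show "AE x in k2. 0 \<le> x" unfolding k2_def using AEx by (subst AE_density) auto
      define d where "d t = enn2real (c * (\<integral>\<^sup>+\<omega>. ennreal (exp (- t * X j \<omega>)) \<partial>M))" for t
      fix t :: real assume t: "0 \<le> t"
      have "(\<integral>\<^sup>+\<omega>. ennreal (exp (- t * X j \<omega>)) \<partial>M) \<le> (\<integral>\<^sup>+\<omega>. 1 \<partial>M)"
      proof (rule nn_integral_mono_AE)
        show "AE \<omega> in M. ennreal (exp (- t * X j \<omega>)) \<le> 1"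
          using nn[OF j(1)] t by (auto elim!: eventually_mono)
      qed
      then have "c * (\<integral>\<^sup>+\<omega>. ennreal (exp (- t * X j \<omega>)) \<partial>M) \<le> 1 * 1"
        using cfin by (intro mult_mono) (auto simp: emeasure_space_1)
      then have d: "c * (\<integral>\<^sup>+\<omega>. ennreal (exp (- t * X j \<omega>)) \<partial>M) = ennreal (d t)"
      proof -
        assume "c * (\<integral>\<^sup>+\<omega>. ennreal (exp (- t * X j \<omega>)) \<partial>M) \<le> 1 * 1"
        also have "1 * 1 < (top::ennreal)" by simp
        finally show ?thesis unfolding d_def by (intro ennreal_enn2real[symmetric])
      qed
      have "(\<integral>\<^sup>+x. ennreal (exp (- t * x)) \<partial>k1) = (\<integral>\<^sup>+\<omega>. W \<omega> * ennreal (exp (- t * X j \<omega>)) \<partial>M)"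
        unfolding k1_def by (simp add: nn_integral_distr nn_integral_density)
      then show "(\<integral>\<^sup>+x. ennreal (exp (- t * x)) \<partial>k1) = ennreal (d t)"
        using base[OF t] d by (simp add: mult.commute)
      have "(\<integral>\<^sup>+x. ennreal (exp (- t * x)) \<partial>k2) = c * (\<integral>\<^sup>+\<omega>. ennreal (exp (- t * X j \<omega>)) \<partial>M)"
        unfolding k2_def by (simp add: nn_integral_distr nn_integral_density nn_integral_cmult)
      then show "(\<integral>\<^sup>+x. ennreal (exp (- t * x)) \<partial>k2) = ennreal (d t)" unfolding d .
    qed
    then have "(\<integral>\<^sup>+x. indicator (A j) x \<partial>k1) = (\<integral>\<^sup>+x. indicator (A j) x \<partial>k2)" by simp
    moreover have [measurable]: "A j \<in> sets borel" using insert.prems by auto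
    have "(\<integral>\<^sup>+x. indicator (A j) x \<partial>k1) = (\<integral>\<^sup>+\<omega>. W \<omega> * indicator (A j) (X j \<omega>) \<partial>M)"
      unfolding k1_def by (subst nn_integral_distr) (auto simp: nn_integral_density)
    moreover have "(\<integral>\<^sup>+x. indicator (A j) x \<partial>k2) = c * (\<integral>\<^sup>+\<omega>. indicator (A j) (X j \<omega>) \<partial>M)"
    proof -
      have "(\<integral>\<^sup>+x. indicator (A j) x \<partial>k2) = (\<integral>\<^sup>+x. c * indicator (A j) x \<partial>distr M borel (X j))"
        unfolding k2_def by (rule nn_integral_density) measurable
      also have "\<dots> = c * (\<integral>\<^sup>+x. indicator (A j) x \<partial>distr M borel (X j))"
        by (rule nn_integral_cmult) measurable
      also have "(\<integral>\<^sup>+x. indicator (A j) x \<partial>distr M borel (X j)) = (\<integral>\<^sup>+\<omega>. indicator (A j) (X j \<omega>) \<partial>M)"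
        by (rule nn_integral_distr) measurable
      finally show ?thesis .
    qed
    ultimately have "(\<integral>\<^sup>+\<omega>. W \<omega> * indicator (A j) (X j \<omega>) \<partial>M) = c * (\<integral>\<^sup>+\<omega>. indicator (A j) (X j \<omega>) \<partial>M)" by simp
    then show ?case unfolding W_def c_def using insert.hyps by (simp add: mult_ac)
  qed
qed

section \<open>Subordinator paths as random measures\<close>

context log_integrable_law begin

text \<open>Dominated by \<open>ln (1 + max 1 B * x)\<close>; the maximum with 1 keeps the constant positive, as the
  integrability hypothesis requires.\<close>
lemma psi_tendsto:
  assumes u: "u \<longlonglongrightarrow> a" and nn: "\<And>n. 0 \<le> u n" and B: "\<And>n. u n \<le> B"
  shows "(\<lambda>n. psi F (u n)) \<longlonglongrightarrow> psi F a"
  unfolding psi_def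
proof (rule integral_dominated_convergence[where w="\<lambda>x. ln (1 + max 1 B * x)"])
  have [measurable_cong]: "sets F = sets borel" by (rule F)
  show "(\<lambda>x. ln (1 + a * x)) \<in> borel_measurable F" "(\<lambda>x. ln (1 + u n * x)) \<in> borel_measurable F" for n by measurable
  show "integrable F (\<lambda>x. ln (1 + max 1 B * x))" by (intro F_int) simp
  have a: "0 \<le> a" using nn by (intro LIMSEQ_le_const[OF u]) auto
  show "AE x in F. (\<lambda>n. ln (1 + u n * x)) \<longlonglongrightarrow> ln (1 + a * x)"
    using F(3)
  proof eventually_elim
    case (elim x)
    have "0 < 1 + a * x" using a elim by (simp add: add_pos_nonneg)
    then show ?case by (intro tendsto_intros u) simp
  qed
  show "AE x in F. norm (ln (1 + u n * x)) \<le> ln (1 + max 1 B * x)" for n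
    using F(3)
  proof eventually_elim
    case (elim x)
    have "u n * x \<le> max 1 B * x" using B[of n] elim by (intro mult_right_mono) auto
    moreover have "0 \<le> u n * x" using nn elim by simp
    ultimately have "0 \<le> ln (1 + u n * x)" "ln (1 + u n * x) \<le> ln (1 + max 1 B * x)"
      by (auto intro!: ln_mono)
    then show ?case by simp
  qed
qed

lemma psi_nonneg: "0 \<le> l \<Longrightarrow> 0 \<le> psi F l"
  unfolding psi_def using F(3) by (intro integral_nonneg_AE) (auto elim!: eventually_mono)

lemma psi_mono:
  assumes "0 \<le> a" "a \<le> b"
  shows "psi F a \<le> psi F b"
proof (cases "a = b")
  case False
  then have b: "0 < b" using assms by simp
  show ?thesis
  proof (cases "a = 0")
    case True
    then show ?thesis using psi_nonneg[of b] b by (simp add: psi_def)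
  next
    case False
    then have a: "0 < a" using assms by simp
    show ?thesis unfolding psi_def
    proof (rule integral_mono_AE[OF F_int[OF a] F_int[OF b]])
      show "AE x in F. ln (1 + a * x) \<le> ln (1 + b * x)"
        using F(3)
      proof eventually_elim
        case (elim x)
        have "a * x \<le> b * x" using assms elim by (intro mult_right_mono)
        moreover have "0 \<le> a * x" using assms elim by simp
        ultimately show ?case by (intro ln_mono) auto
      qed
    qed
  qed
qed simp

lemma borel_measurable_psi [measurable]: "psi F \<in> borel_measurable borel"
proof -
  have [measurable_cong]: "sets F = sets borel" by (rule F)
  interpret prob_space F by (rule F)
  show ?thesis unfolding psi_def[abs_def] by measurable
qed

end

text \<open>A cell \<open>{j T / 2^n <.. (j + 1) T / 2^n}\<close> is the set where the ceiling equals \<open>j + 1\<close>, so it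
  contains its right end point, at which the step function may be evaluated. The form with \<open>q\<close> covers the
  measure of a path, with \<open>q\<close> the identity, and Lebesgue measure, with \<open>q = psi F\<close>.\<close>
lemma integral_dyadic_step:
  assumes K: "finite_measure \<kappa>" "sets \<kappa> = sets borel" "AE x in \<kappa>. x \<in> {0<..T}" and T: "0 < T"
    and h: "dyadic_step T n h" and q: "q \<in> borel_measurable borel"
  shows "(LINT x|\<kappa>. q (h x) :: real) = (\<Sum>j<2^n. q (h (real (Suc j) * T / 2^n)) * measure \<kappa> {real j * T / 2^n <.. real (Suc j) * T / 2^n})"
proof -
  interpret finite_measure \<kappa> by fact
  have [measurable_cong]: "sets \<kappa> = sets borel" by fact
  have sp: "space \<kappa> = UNIV" using K(2)[THEN sets_eq_imp_space_eq] by simp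
  note [measurable] = dyadic_step_measurable[OF h T] q
  define I where "I j = {real j * T / 2^n <.. real (Suc j) * T / 2^n}" for j
  have ceil: "\<lceil>2^n * x / T\<rceil> = int j + 1" if "x \<in> I j" for x j
  proof -
    have "real j * T / 2^n < x" "x \<le> real (Suc j) * T / 2^n" using that by (auto simp: I_def)
    then have "real j < 2^n * x / T" "2^n * x / T \<le> real (Suc j)" using T by (simp_all add: field_simps)
    then show ?thesis by (simp add: ceiling_eq_iff)
  qed
  have right: "real (Suc j) * T / 2^n \<in> I j" for j
    using T by (simp add: I_def divide_strict_right_mono)
  have hI: "h x = h (real (Suc j) * T / 2^n)" if "x \<in> I j" for x j
    using h ceil[OF that] ceil[OF right] unfolding dyadic_step_def by metis
  have disj: "disjoint_family_on I {..<2^n}"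
    unfolding disjoint_family_on_def using ceil by (metis disjoint_iff add_right_imp_eq of_nat_eq_iff)
  have cover: "\<exists>j<2^n. x \<in> I j" if x: "x \<in> {0<..T}" for x
  proof -
    define c where "c = \<lceil>2^n * x / T\<rceil>"
    have c: "of_int c - 1 < 2^n * x / T" "2^n * x / T \<le> of_int c" unfolding c_def by linarith+
    have "0 < 2^n * x / T" using x T by simp
    then have c0: "0 < c" using c(2) by linarith
    have "2^n * x / T \<le> 2^n * 1" using x T by (simp add: divide_le_eq)
    then have "c \<le> 2^n" unfolding c_def by (simp add: ceiling_le_iff)
    then have "nat (c - 1) < 2^n" using c0 by (simp add: nat_less_iff)
    moreover have "x \<in> I (nat (c - 1))"
    proof -
      have "real (nat (c - 1)) = of_int c - 1" using c0 by simp
      then show ?thesis using c T unfolding I_def by (simp add: field_simps)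
    qed
    ultimately show ?thesis by blast
  qed
  have "AE x in \<kappa>. q (h x) = (\<Sum>j<2^n. q (h (real (Suc j) * T / 2^n)) * indicator (I j) x)"
    using K(3)
  proof eventually_elim
    case (elim x)
    obtain i where i: "i < 2^n" "x \<in> I i" using cover[OF elim] by blast
    then show ?case
      using sum_indicator_disjoint_family[OF disj i(2), of "\<lambda>j. q (h (real (Suc j) * T / 2^n))"] hI by simp
  qed
  then have "(LINT x|\<kappa>. q (h x)) = (LINT x|\<kappa>. (\<Sum>j<2^n. q (h (real (Suc j) * T / 2^n)) * indicator (I j) x))"
  proof (rule integral_cong_AE[rotated 2])
    have [measurable]: "I j \<in> sets borel" for j by (simp add: I_def)
    show "(\<lambda>x. \<Sum>j<2^n. q (h (real (Suc j) * T / 2^n)) * indicator (I j) x) \<in> borel_measurable \<kappa>" by measurable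
  qed measurable
  also have "\<dots> = (\<Sum>j<2^n. q (h (real (Suc j) * T / 2^n)) * measure \<kappa> (I j))"
    by (subst Bochner_Integration.integral_sum) (auto intro!: integrable_mult_right integrable_const_bound[where B=1] simp: sp I_def)
  finally show ?thesis by (simp add: I_def)
qed

definition path_measure :: "real \<Rightarrow> (real \<Rightarrow> real) \<Rightarrow> real measure" where
  "path_measure T z = interval_measure (\<lambda>s. z (max 0 (min T s)))"

text \<open>The constant extension of the path has no increments outside \<open>{0..T}\<close>, hence no mass there; it is
  continuous at 0 from the left because it is constant up to 0 with the value at 0, hence there is no
  mass at 0 either.\<close>
lemma path_measure_basic:
  assumes T: "0 < T" and mono: "mono_on {0..T} z" and rc: "\<And>t. t \<in> {0..<T} \<Longrightarrow> continuous (at_right t) z"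
  shows "sets (path_measure T z) = sets borel" "finite_measure (path_measure T z)"
    "AE x in path_measure T z. x \<in> {0<..T}"
    "\<And>a b. 0 \<le> a \<Longrightarrow> a \<le> b \<Longrightarrow> b \<le> T \<Longrightarrow> measure (path_measure T z) {a<..b} = z b - z a"
proof -
  define e where "e s = z (max 0 (min T s))" for s
  have P: "path_measure T z = interval_measure e" by (simp add: path_measure_def e_def[abs_def])
  have em: "e x \<le> e y" if "x \<le> y" for x y
    unfolding e_def using T that by (intro mono_onD[OF mono]) auto
  have ec: "continuous (at_right a) e" for a
  proof -
    consider "a < 0" | "0 \<le> a" "a < T" | "T \<le> a" by linarith
    then show ?thesis
    proof cases
      case 1
      have "eventually (\<lambda>x. e x = e a) (at_right a)"
        using eventually_at_right_less[of a] eventually_at_right_real[OF 1]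
        by eventually_elim (use 1 T in \<open>auto simp: e_def max_def min_def\<close>)
      then show ?thesis by (simp add: continuous_within tendsto_eventually)
    next
      case 2
      have "(z \<longlongrightarrow> z a) (at_right a)" using rc[of a] 2 by (simp add: continuous_within)
      moreover have "eventually (\<lambda>x. z x = e x) (at_right a)"
        using eventually_at_right_real[OF 2(2)]
        by eventually_elim (use 2 in \<open>auto simp: e_def max_def min_def\<close>)
      moreover have "e a = z a" using 2 by (simp add: e_def)
      ultimately show ?thesis by (simp add: continuous_within) (metis (mono_tags, lifting) Lim_transform_eventually)
    next
      case 3
      have "eventually (\<lambda>x. e x = e a) (at_right a)"
        using eventually_at_right_less[of a]
        by eventually_elim (use 3 T in \<open>auto simp: e_def max_def min_def\<close>)
      then show ?thesis by (simp add: continuous_within tendsto_eventually)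
    qed
  qed
  show s: "sets (path_measure T z) = sets borel" unfolding P by simp
  have Ioc: "emeasure (path_measure T z) {a<..b} = ennreal (e b - e a)" if "a \<le> b" for a b
    unfolding P by (rule emeasure_interval_measure_Ioc[OF that em ec])
  have sp: "space (path_measure T z) = UNIV" unfolding P by simp
  have z1: "emeasure (path_measure T z) {..0} = 0"
  proof -
    have "{..0::real} = (\<Union>n. {- real n<..0})"
    proof (intro equalityI subsetI)
      fix x :: real assume "x \<in> {..0}"
      moreover obtain n where "- x < real n" using reals_Archimedean2 by blast
      ultimately show "x \<in> (\<Union>n. {- real n<..0})" by (auto intro!: exI[of _ n])
    qed auto
    moreover have "emeasure (path_measure T z) (\<Union>n. {- real n<..0}) \<le> (\<Sum>n. emeasure (path_measure T z) {- real n<..0})"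
      by (rule emeasure_subadditive_countably) (auto simp: s)
    moreover have "emeasure (path_measure T z) {- real n<..0} = 0" for n
      using T by (subst Ioc) (auto simp: e_def)
    ultimately show ?thesis by simp
  qed
  have z2: "emeasure (path_measure T z) {T<..} = 0"
  proof -
    have "{T<..} = (\<Union>n. {T<..T + real n})"
    proof (intro equalityI subsetI)
      fix x :: real assume "x \<in> {T<..}"
      moreover obtain n where "x - T < real n" using reals_Archimedean2 by blast
      ultimately show "x \<in> (\<Union>n. {T<..T + real n})" by (auto intro!: exI[of _ n])
    qed auto
    moreover have "emeasure (path_measure T z) (\<Union>n. {T<..T + real n}) \<le> (\<Sum>n. emeasure (path_measure T z) {T<..T + real n})"
      by (rule emeasure_subadditive_countably) (auto simp: s)
    moreover have "emeasure (path_measure T z) {T<..T + real n} = 0" for n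
      using T by (subst Ioc) (auto simp: e_def)
    ultimately show ?thesis by simp
  qed
  have "UNIV = {..0} \<union> {0<..T} \<union> {T<..}" using T by auto
  then have "emeasure (path_measure T z) UNIV \<le> emeasure (path_measure T z) ({..0} \<union> {0<..T}) + emeasure (path_measure T z) {T<..}"
    by (metis emeasure_subadditive s sets.Un borel_singleton atMost_borel greaterThan_borel greaterThanAtMost_borel)
  also have "emeasure (path_measure T z) ({..0} \<union> {0<..T}) \<le> emeasure (path_measure T z) {..0} + emeasure (path_measure T z) {0<..T}"
    by (rule emeasure_subadditive) (auto simp: s)
  finally have "emeasure (path_measure T z) UNIV \<le> ennreal (e T - e 0)" using z1 z2 Ioc[of 0 T] T by (simp add: add_right_mono)
  then show fin: "finite_measure (path_measure T z)"
    by (intro finite_measureI) (metis sp ennreal_less_top infinity_ennreal_def leD)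
  have "{..0} \<in> null_sets (path_measure T z)" "{T<..} \<in> null_sets (path_measure T z)"
    using z1 z2 by (auto simp: null_sets_def s)
  from this[THEN AE_not_in] have "AE x in path_measure T z. x \<notin> {..0}" "AE x in path_measure T z. x \<notin> {T<..}" by auto
  then show "AE x in path_measure T z. x \<in> {0<..T}" by eventually_elim auto
  show "measure (path_measure T z) {a<..b} = z b - z a" if "0 \<le> a" "a \<le> b" "b \<le> T" for a b
  proof -
    have "e b = z b" "e a = z a" using that by (auto simp: e_def)
    then show ?thesis using Ioc[OF that(2)] em[OF that(2)] by (simp add: measure_def)
  qed
qed

text \<open>Rule induction over bounded limits of step functions. For a dyadic step function the path integral
  is a finite combination of increments, and independence, stationarity and the Laplace transform of a
  single increment give the product formula, whose exponent is a Riemann sum that equals the integral.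
  Both sides are continuous under bounded pointwise limits. The paths \<open>Z\<close> are a version of \<open>\<zeta>\<close> regular on
  the whole sample space, so that measurability in \<open>M\<close> itself is part of the induction.\<close>
theorem GGC_Laplace_functional:
  fixes F :: "real measure" and M :: "'a measure"
  assumes FF: "log_integrable_law F" and th: "0 < \<theta>"
    and GGC: "GGC_subordinator_on M (1 / \<theta>) \<theta> F \<zeta>"
    and Z: "\<And>t. t \<in> {0..1/\<theta>} \<Longrightarrow> Z t \<in> borel_measurable M" "AE \<omega> in M. \<forall>t\<in>{0..1/\<theta>}. Z t \<omega> = \<zeta> t \<omega>"
    and mono: "\<And>\<omega>. \<omega> \<in> space M \<Longrightarrow> mono_on {0..1/\<theta>} (\<lambda>t. Z t \<omega>)"
    and rc: "\<And>\<omega> t. \<omega> \<in> space M \<Longrightarrow> t \<in> {0..<1/\<theta>} \<Longrightarrow> continuous (at_right t) (\<lambda>t. Z t \<omega>)"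
    and f: "step_limit (1/\<theta>) f"
  defines "m \<equiv> \<lambda>\<omega>. path_measure (1/\<theta>) (\<lambda>t. Z t \<omega>)"
  shows "(\<lambda>\<omega>. LINT x|m \<omega>. f x) \<in> borel_measurable M \<and>
    (LINT \<omega>|M. exp (- (LINT x|m \<omega>. f x))) = exp (- \<theta> * (LINT x|lborel. indicator {0<..1/\<theta>} x * psi F (f x)))"
proof -
  interpret log_integrable_law F by fact
  define T where "T = 1 / \<theta>"
  have T: "0 < T" using th by (simp add: T_def)
  have levy: "levy_process_on M T \<zeta>"
    and LT: "\<And>t l. t \<in> {0..T} \<Longrightarrow> 0 \<le> l \<Longrightarrow> (LINT \<omega>|M. exp (- l * \<zeta> t \<omega>)) = exp (- t * \<theta> * psi F l)"
    using GGC by (auto simp: GGC_subordinator_on_def T_def)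
  interpret M: prob_space M using levy by (simp add: levy_process_on_def)
  have zm: "\<And>t. t \<in> {0..T} \<Longrightarrow> \<zeta> t \<in> borel_measurable M" using levy by (simp add: levy_process_on_def)
  note Z' = Z[folded T_def] and mono' = mono[folded T_def] and rc' = rc[folded T_def]
  note pb = path_measure_basic[OF T mono' rc']
  have mb: "sets (m \<omega>) = sets borel" "finite_measure (m \<omega>)" "AE x in m \<omega>. x \<in> {0<..T}"
     "\<And>a b. 0 \<le> a \<Longrightarrow> a \<le> b \<Longrightarrow> b \<le> T \<Longrightarrow> measure (m \<omega>) {a<..b} = Z b \<omega> - Z a \<omega>"
    if "\<omega> \<in> space M" for \<omega>
    unfolding m_def T_def[symmetric] using pb[OF that] that by auto
  show ?thesis
    using f unfolding T_def[symmetric]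
  proof induction
    case (step n f)
    define h where "h = T / 2 ^ n"
    have h: "0 \<le> h" "h \<le> T" using T by (auto simp: h_def divide_le_eq)
    define t where "t j = real j * T / 2 ^ n" for j
    have tmono: "mono_on {..2^n} t" unfolding t_def using T by (intro mono_onI divide_right_mono mult_right_mono) auto
    have tT: "t j \<in> {0..T}" if "j \<le> 2^n" for j
    proof -
      have "real j \<le> 2 ^ n" using that by (metis of_nat_le_iff of_nat_numeral of_nat_power)
      then have "real j * T \<le> T * 2 ^ n" using T by (simp add: mult.commute)
      then show ?thesis using T by (simp add: t_def divide_le_eq)
    qed
    have tS: "t (Suc j) = t j + h" for j by (simp add: t_def h_def field_simps)
    define c where "c j = f (t (Suc j))" for j
    have c0: "0 \<le> c j" for j using step unfolding dyadic_step_def c_def by blast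
    have ts: "t j \<in> {0..T}" "t (Suc j) \<in> {0..T}" "t j \<le> t (Suc j)" if "j < 2^n" for j
      using tT[of j] tT[of "Suc j"] that h tS[of j] by auto
    have I: "(LINT x|m \<omega>. f x) = (\<Sum>j<2^n. c j * (Z (t (Suc j)) \<omega> - Z (t j) \<omega>))" if w: "\<omega> \<in> space M" for \<omega>
    proof -
      have "(LINT x|m \<omega>. f x) = (\<Sum>j<2^n. f (real (Suc j) * T / 2^n) * measure (m \<omega>) {real j * T / 2^n <.. real (Suc j) * T / 2^n})"
        by (rule integral_dyadic_step[OF mb(2)[OF w] mb(1)[OF w] mb(3)[OF w] T step, of "\<lambda>x. x"]) simp
      also have "\<dots> = (\<Sum>j<2^n. c j * (Z (t (Suc j)) \<omega> - Z (t j) \<omega>))"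
      proof (rule sum.cong[OF refl])
        fix j :: nat assume "j \<in> {..<2^n}"
        then have "j < 2^n" by simp
        from ts[OF this] have "measure (m \<omega>) {t j <.. t (Suc j)} = Z (t (Suc j)) \<omega> - Z (t j) \<omega>"
          by (intro mb(4)[OF w]) auto
        then show "f (real (Suc j) * T / 2^n) * measure (m \<omega>) {real j * T / 2^n <.. real (Suc j) * T / 2^n} = c j * (Z (t (Suc j)) \<omega> - Z (t j) \<omega>)"
          unfolding c_def t_def by (simp only:)
      qed
      finally show ?thesis .
    qed
    have meas: "(\<lambda>\<omega>. \<Sum>j<2^n. c j * (Z (t (Suc j)) \<omega> - Z (t j) \<omega>)) \<in> borel_measurable M"
      by (intro borel_measurable_sum borel_measurable_times borel_measurable_diff borel_measurable_const Z'(1) ts) auto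
    have indep: "M.indep_vars (\<lambda>_. borel) (\<lambda>j \<omega>. \<zeta> (t (Suc j)) \<omega> - \<zeta> (t j) \<omega>) {..<2^n}"
      using levy tmono tT unfolding levy_process_on_def by (auto simp: image_subset_iff)
    have indep2: "M.indep_vars (\<lambda>_. borel) (\<lambda>j \<omega>. exp (- c j * (\<zeta> (t (Suc j)) \<omega> - \<zeta> (t j) \<omega>))) {..<2^n}"
      by (rule M.indep_vars_compose2[OF indep]) measurable
    have inc: "(LINT \<omega>|M. exp (- c j * (\<zeta> (t (Suc j)) \<omega> - \<zeta> (t j) \<omega>))) = exp (- h * \<theta> * psi F (c j))"
      and incint: "integrable M (\<lambda>\<omega>. exp (- c j * (\<zeta> (t (Suc j)) \<omega> - \<zeta> (t j) \<omega>)))" if j: "j < 2^n" for j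
    proof -
      have [measurable]: "\<zeta> (t (Suc j)) \<in> borel_measurable M" "\<zeta> (t j) \<in> borel_measurable M" "\<zeta> h \<in> borel_measurable M"
        using ts[OF j] h by (auto intro!: zm)
      have "distr M borel (\<lambda>\<omega>. \<zeta> (t j + h) \<omega> - \<zeta> (t j) \<omega>) = distr M borel (\<zeta> h)"
        using levy ts[OF j] h tS[of j] unfolding levy_process_on_def by auto
      then have d: "distr M borel (\<lambda>\<omega>. \<zeta> (t (Suc j)) \<omega> - \<zeta> (t j) \<omega>) = distr M borel (\<zeta> h)" by (simp only: tS)
      have "(LINT \<omega>|M. exp (- c j * (\<zeta> (t (Suc j)) \<omega> - \<zeta> (t j) \<omega>))) = (LINT x|distr M borel (\<lambda>\<omega>. \<zeta> (t (Suc j)) \<omega> - \<zeta> (t j) \<omega>). exp (- c j * x))"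
        by (rule integral_distr[symmetric]) measurable
      also have "\<dots> = (LINT x|distr M borel (\<zeta> h). exp (- c j * x))" unfolding d ..
      also have "\<dots> = (LINT \<omega>|M. exp (- c j * \<zeta> h \<omega>))" by (rule integral_distr) measurable
      also have "\<dots> = exp (- h * \<theta> * psi F (c j))" using h by (intro LT c0) auto
      finally show E: "(LINT \<omega>|M. exp (- c j * (\<zeta> (t (Suc j)) \<omega> - \<zeta> (t j) \<omega>))) = exp (- h * \<theta> * psi F (c j))" .
      then show "integrable M (\<lambda>\<omega>. exp (- c j * (\<zeta> (t (Suc j)) \<omega> - \<zeta> (t j) \<omega>)))"
        by (metis exp_not_eq_zero not_integrable_integral_eq)
    qed
    have "(LINT \<omega>|M. exp (- (LINT x|m \<omega>. f x))) = (LINT \<omega>|M. exp (- (\<Sum>j<2^n. c j * (Z (t (Suc j)) \<omega> - Z (t j) \<omega>))))"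
      by (intro Bochner_Integration.integral_cong refl) (simp add: I)
    also have "\<dots> = (LINT \<omega>|M. (\<Prod>j<2^n. exp (- c j * (\<zeta> (t (Suc j)) \<omega> - \<zeta> (t j) \<omega>))))"
    proof (rule integral_cong_AE)
      show "(\<lambda>\<omega>. exp (- (\<Sum>j<2^n. c j * (Z (t (Suc j)) \<omega> - Z (t j) \<omega>)))) \<in> borel_measurable M"
        using meas by measurable
      show "(\<lambda>\<omega>. (\<Prod>j<2^n. exp (- c j * (\<zeta> (t (Suc j)) \<omega> - \<zeta> (t j) \<omega>)))) \<in> borel_measurable M"
      proof (rule borel_measurable_prod)
        fix j :: nat assume "j \<in> {..<2^n}"
        then show "(\<lambda>\<omega>. exp (- c j * (\<zeta> (t (Suc j)) \<omega> - \<zeta> (t j) \<omega>))) \<in> borel_measurable M"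
          using incint[of j] by auto
      qed
      show "AE \<omega> in M. exp (- (\<Sum>j<2^n. c j * (Z (t (Suc j)) \<omega> - Z (t j) \<omega>))) = (\<Prod>j<2^n. exp (- c j * (\<zeta> (t (Suc j)) \<omega> - \<zeta> (t j) \<omega>)))"
        using Z'(2)
      proof eventually_elim
        case (elim \<omega>)
        have "(\<Sum>j<2^n. c j * (Z (t (Suc j)) \<omega> - Z (t j) \<omega>)) = (\<Sum>j<2^n. c j * (\<zeta> (t (Suc j)) \<omega> - \<zeta> (t j) \<omega>))"
          using elim ts by (intro sum.cong refl) auto
        then show ?case by (simp add: exp_sum[symmetric] sum_negf)
      qed
    qed
    also have "\<dots> = (\<Prod>j<2^n. (LINT \<omega>|M. exp (- c j * (\<zeta> (t (Suc j)) \<omega> - \<zeta> (t j) \<omega>))))"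
    proof (rule M.indep_vars_lebesgue_integral[OF _ indep2])
      fix j :: nat assume "j \<in> {..<2^n}"
      then have "j < 2^n" by simp
      then show "integrable M (\<lambda>\<omega>. exp (- c j * (\<zeta> (t (Suc j)) \<omega> - \<zeta> (t j) \<omega>)))" by (rule incint)
    qed simp
    also have "\<dots> = (\<Prod>j<2^n. exp (- h * \<theta> * psi F (c j)))" using inc by (intro prod.cong) auto
    also have "\<dots> = exp (- \<theta> * (\<Sum>j<2^n. psi F (c j) * h))"
      by (simp add: exp_sum[symmetric] sum_distrib_left sum_negf mult_ac)
    also have "(\<Sum>j<2^n. psi F (c j) * h) = (LINT x|lborel. indicator {0<..T} x * psi F (f x))"
    proof -
      \<comment> \<open>Lebesgue measure on \<open>{0<..T}\<close>, to evaluate the right-hand integral by the same lemma as the path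
        integral.\<close>
      define k where "k = density lborel (\<lambda>x::real. ennreal (indicator {0<..T} x))"
      have ks: "sets k = sets borel" by (simp add: k_def)
      have ke: "emeasure k A = emeasure lborel ({0<..T} \<inter> A)" if "A \<in> sets borel" for A
        unfolding k_def using that
        by (subst emeasure_density) (auto simp: nn_integral_set_ennreal[symmetric] ennreal_indicator indicator_inter_arith[symmetric])
      have kf: "finite_measure k" by (rule finite_measureI) (use T ke[of UNIV] in \<open>auto simp: k_def\<close>)
      have ka: "AE x in k. x \<in> {0<..T}" unfolding k_def by (subst AE_density) (auto simp: indicator_def)
      have km: "measure k {real j * T / 2^n <.. real (Suc j) * T / 2^n} = h" if "j < 2^n" for j
      proof -
        have "{0<..T} \<inter> {t j <.. t (Suc j)} = {t j <.. t (Suc j)}" using ts[OF that] by auto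
        then have "emeasure k {t j <.. t (Suc j)} = ennreal (t (Suc j) - t j)" using ts[OF that] by (simp add: ke)
        then have "measure k {t j <.. t (Suc j)} = h" using h tS[of j] by (simp add: measure_def)
        then show ?thesis by (simp add: t_def)
      qed
      have "(LINT x|lborel. indicator {0<..T} x * psi F (f x)) = (LINT x|k. psi F (f x))"
        unfolding k_def using dyadic_step_measurable[OF step T] by (subst integral_density) auto
      also have "\<dots> = (\<Sum>j<2^n. psi F (f (real (Suc j) * T / 2^n)) * measure k {real j * T / 2^n <.. real (Suc j) * T / 2^n})"
        by (rule integral_dyadic_step[OF kf ks ka T step]) measurable
      also have "\<dots> = (\<Sum>j<2^n. psi F (c j) * h)"
        using km by (intro sum.cong refl) (simp add: c_def t_def)
      finally show ?thesis by simp
    qed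
    finally have "(LINT \<omega>|M. exp (- (LINT x|m \<omega>. f x))) = exp (- \<theta> * (LINT x|lborel. indicator {0<..T} x * psi F (f x)))" .
    moreover have "(\<lambda>\<omega>. LINT x|m \<omega>. f x) \<in> borel_measurable M"
      using meas by (subst measurable_cong[OF I])
    ultimately show ?case by blast
  next
    case (lim f B g)
    have fm: "f n \<in> borel_measurable borel" and f0: "0 \<le> f n x" for n x
      using step_limitD[OF lim.hyps(1) T] by auto
    have gm: "g \<in> borel_measurable borel" by (rule borel_measurable_LIMSEQ_real[OF lim.hyps(3) fm])
    have g0: "0 \<le> g x" for x using f0 by (intro LIMSEQ_le_const[OF lim.hyps(3)]) auto
    have B0: "0 \<le> B" using f0[of 0 0] lim.hyps(2)[of 0 0] by linarith
    have cv: "(\<lambda>n. LINT x|m \<omega>. f n x) \<longlonglongrightarrow> (LINT x|m \<omega>. g x)" if w: "\<omega> \<in> space M" for \<omega>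
    proof (rule integral_dominated_convergence[where w="\<lambda>_. B"])
      interpret mw: finite_measure "m \<omega>" by (rule mb[OF w])
      show "g \<in> borel_measurable (m \<omega>)" "f n \<in> borel_measurable (m \<omega>)" for n
        using gm fm by (simp_all add: measurable_cong_sets[OF mb(1)[OF w] refl])
      show "integrable (m \<omega>) (\<lambda>_. B)" by simp
      show "AE x in m \<omega>. (\<lambda>n. f n x) \<longlonglongrightarrow> g x" using lim.hyps(3) by simp
      show "AE x in m \<omega>. norm (f n x) \<le> B" for n using lim.hyps(2) f0 by simp
    qed
    have mg: "(\<lambda>\<omega>. LINT x|m \<omega>. g x) \<in> borel_measurable M"
      using lim.IH by (intro borel_measurable_LIMSEQ_real[OF cv]) auto
    have nn: "0 \<le> (LINT x|m \<omega>. f n x)" for n \<omega> using f0 by (intro integral_nonneg_AE) auto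
    have "(\<lambda>n. LINT \<omega>|M. exp (- (LINT x|m \<omega>. f n x))) \<longlonglongrightarrow> (LINT \<omega>|M. exp (- (LINT x|m \<omega>. g x)))"
    proof (rule integral_dominated_convergence[where w="\<lambda>_. 1"])
      show "(\<lambda>\<omega>. exp (- (LINT x|m \<omega>. g x))) \<in> borel_measurable M" using mg by measurable
      show "(\<lambda>\<omega>. exp (- (LINT x|m \<omega>. f n x))) \<in> borel_measurable M" for n
      proof -
        have [measurable]: "(\<lambda>\<omega>. LINT x|m \<omega>. f n x) \<in> borel_measurable M" using lim.IH[of n] by blast
        show ?thesis by measurable
      qed
      show "AE \<omega> in M. (\<lambda>n. exp (- (LINT x|m \<omega>. f n x))) \<longlonglongrightarrow> exp (- (LINT x|m \<omega>. g x))"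
        by (rule AE_I2) (intro tendsto_intros cv)
      show "AE \<omega> in M. norm (exp (- (LINT x|m \<omega>. f n x))) \<le> 1" for n using nn by simp
    qed simp
    moreover have "(\<lambda>n. exp (- \<theta> * (LINT x|lborel. indicator {0<..T} x * psi F (f n x)))) \<longlonglongrightarrow> exp (- \<theta> * (LINT x|lborel. indicator {0<..T} x * psi F (g x)))"
    proof (intro tendsto_intros integral_dominated_convergence[where w="\<lambda>x. psi F B * indicator {0<..T} x"])
      show "(\<lambda>x. indicator {0<..T} x * psi F (g x)) \<in> borel_measurable lborel" using gm by measurable
      show "(\<lambda>x. indicator {0<..T} x * psi F (f n x)) \<in> borel_measurable lborel" for n using fm[of n] by measurable
      show "integrable lborel (\<lambda>x. psi F B * indicator {0<..T} x)" using T by (intro integrable_mult_right integrable_real_indicator) auto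
      show "AE x in lborel. (\<lambda>n. indicator {0<..T} x * psi F (f n x)) \<longlonglongrightarrow> indicator {0<..T} x * psi F (g x)"
        by (intro AE_I2 tendsto_intros psi_tendsto[OF lim.hyps(3) f0 lim.hyps(2)])
      show "AE x in lborel. norm (indicator {0<..T} x * psi F (f n x)) \<le> psi F B * indicator {0<..T} x" for n
        using psi_mono[OF f0 lim.hyps(2)] psi_nonneg[OF f0] by (intro AE_I2) (simp add: indicator_def)
    qed
    ultimately have "(LINT \<omega>|M. exp (- (LINT x|m \<omega>. g x))) = exp (- \<theta> * (LINT x|lborel. indicator {0<..T} x * psi F (g x)))"
      using lim.IH by (intro LIMSEQ_unique) auto
    with mg show ?case by blast
  qed
qed

section \<open>The joint law\<close>

lemma PiM_density_lborel:
  fixes g :: "'i \<Rightarrow> real \<Rightarrow> ennreal"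
  assumes I: "finite I" and g[measurable]: "\<And>i. g i \<in> borel_measurable borel" and fin: "\<And>i x. g i x \<noteq> \<infinity>"
  shows "density (\<Pi>\<^sub>M i\<in>I. lborel) (\<lambda>x. \<Prod>i\<in>I. g i (x i)) = (\<Pi>\<^sub>M i\<in>I. density lborel (g i))"
proof -
  interpret L: product_sigma_finite "\<lambda>i::'i. lborel :: real measure" by unfold_locales
  interpret D: product_sigma_finite "\<lambda>i. density lborel (g i)"
    unfolding product_sigma_finite_def using fin
    by (auto simp: sigma_finite_measure.sigma_finite_iff_density_finite[OF lborel.sigma_finite_measure_axioms])
  have sD: "sets (\<Pi>\<^sub>M i\<in>I. density lborel (g i)) = sets (\<Pi>\<^sub>M i\<in>I. lborel :: real measure)"
    by (intro sets_PiM_cong) auto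
  have G[measurable]: "(\<lambda>x. \<Prod>i\<in>I. g i (x i)) \<in> borel_measurable (\<Pi>\<^sub>M i\<in>I. lborel)"
    by (intro borel_measurable_prod_ennreal measurable_compose[OF measurable_component_singleton]) auto
  show ?thesis
  proof (rule D.PiM_eqI[OF I])
    show "sets (density (\<Pi>\<^sub>M i\<in>I. lborel) (\<lambda>x. \<Prod>i\<in>I. g i (x i))) = sets (\<Pi>\<^sub>M i\<in>I. density lborel (g i))"
      using sD by simp
    fix A assume A: "\<And>i. i \<in> I \<Longrightarrow> A i \<in> sets (density lborel (g i))"
    then have A': "\<And>i. i \<in> I \<Longrightarrow> A i \<in> sets lborel" by simp
    have PA: "Pi\<^sub>E I A \<in> sets (\<Pi>\<^sub>M i\<in>I. lborel)" using I A' by (intro sets_PiM_I_finite)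
    have "emeasure (density (\<Pi>\<^sub>M i\<in>I. lborel) (\<lambda>x. \<Prod>i\<in>I. g i (x i))) (Pi\<^sub>E I A)
       = (\<integral>\<^sup>+x. (\<Prod>i\<in>I. g i (x i)) * indicator (Pi\<^sub>E I A) x \<partial>(\<Pi>\<^sub>M i\<in>I. lborel))"
      using PA by (rule emeasure_density[OF G])
    also have "\<dots> = (\<integral>\<^sup>+x. (\<Prod>i\<in>I. g i (x i) * indicator (A i) (x i)) \<partial>(\<Pi>\<^sub>M i\<in>I. lborel))"
    proof (rule nn_integral_cong)
      fix x :: "'i \<Rightarrow> real" assume "x \<in> space (\<Pi>\<^sub>M i\<in>I. lborel)"
      then have x: "x \<in> extensional I" by (auto simp: space_PiM PiE_def)
      have "indicator (Pi\<^sub>E I A) x = (\<Prod>i\<in>I. indicator (A i) (x i) :: ennreal)"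
      proof (cases "x \<in> Pi\<^sub>E I A")
        case True
        then have "(\<Prod>i\<in>I. indicator (A i) (x i) :: ennreal) = 1" by (intro prod.neutral ballI) (auto simp: PiE_iff)
        then show ?thesis using True by simp
      next
        case False
        then obtain i where "i \<in> I" "x i \<notin> A i" using x by (auto simp: PiE_def)
        then have "(\<Prod>i\<in>I. indicator (A i) (x i) :: ennreal) = 0" using I by (intro prod_zero) (auto intro!: bexI[of _ i])
        then show ?thesis using False by simp
      qed
      then show "(\<Prod>i\<in>I. g i (x i)) * indicator (Pi\<^sub>E I A) x = (\<Prod>i\<in>I. g i (x i) * indicator (A i) (x i))"
        by (simp add: prod.distrib)
    qed
    also have "\<dots> = (\<Prod>i\<in>I. (\<integral>\<^sup>+x. g i x * indicator (A i) x \<partial>lborel))"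
      using A' by (intro L.product_nn_integral_prod[OF I]) auto
    also have "\<dots> = (\<Prod>i\<in>I. emeasure (density lborel (g i)) (A i))"
      using A' by (intro prod.cong refl emeasure_density[symmetric]) auto
    finally show "emeasure (density (\<Pi>\<^sub>M i\<in>I. lborel) (\<lambda>x. \<Prod>i\<in>I. g i (x i))) (Pi\<^sub>E I A) = (\<Prod>i\<in>I. emeasure (density lborel (g i)) (A i))" .
  qed
qed

text \<open>The case \<open>J = I\<close> of \<open>Laplace_imp_product_moments\<close> is factorisation on measurable boxes.\<close>
lemma (in prob_space) Laplace_imp_distr_eq_PiM:
  fixes X :: "'i \<Rightarrow> 'a \<Rightarrow> real"
  assumes I: "finite I" and X: "\<And>i. i \<in> I \<Longrightarrow> X i \<in> borel_measurable M" and nn: "\<And>i. i \<in> I \<Longrightarrow> AE \<omega> in M. 0 \<le> X i \<omega>"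
    and L: "\<And>l. (\<And>i. i \<in> I \<Longrightarrow> 0 \<le> l i) \<Longrightarrow> (\<integral>\<^sup>+\<omega>. (\<Prod>i\<in>I. ennreal (exp (- l i * X i \<omega>))) \<partial>M) = (\<Prod>i\<in>I. (\<integral>\<^sup>+\<omega>. ennreal (exp (- l i * X i \<omega>)) \<partial>M))"
  shows "distr M (\<Pi>\<^sub>M i\<in>I. borel) (\<lambda>\<omega>. \<lambda>i\<in>I. X i \<omega>) = (\<Pi>\<^sub>M i\<in>I. distr M borel (X i))"
proof -
  \<comment> \<open>Product measures are taken over families defined for every index, also outside \<open>I\<close>.\<close>
  define Y where "Y i = (if i \<in> I then X i else (\<lambda>_. 0))" for i
  have Y[measurable]: "Y i \<in> borel_measurable M" for i using X by (simp add: Y_def)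
  have YP: "prob_space (distr M borel (Y i))" for i by (rule prob_space_distr) measurable
  interpret D: product_sigma_finite "\<lambda>i. distr M borel (Y i)"
    unfolding product_sigma_finite_def using YP prob_space_imp_sigma_finite by blast
  have XY: "(\<lambda>\<omega>. \<lambda>i\<in>I. X i \<omega>) = (\<lambda>\<omega>. \<lambda>i\<in>I. Y i \<omega>)" by (auto simp: Y_def fun_eq_iff)
  have V[measurable]: "(\<lambda>\<omega>. \<lambda>i\<in>I. Y i \<omega>) \<in> M \<rightarrow>\<^sub>M (\<Pi>\<^sub>M i\<in>I. borel)" by (intro measurable_restrict) measurable
  have "distr M (\<Pi>\<^sub>M i\<in>I. borel) (\<lambda>\<omega>. \<lambda>i\<in>I. Y i \<omega>) = (\<Pi>\<^sub>M i\<in>I. distr M borel (Y i))"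
  proof (rule D.PiM_eqI[OF I])
    show "sets (distr M (\<Pi>\<^sub>M i\<in>I. borel) (\<lambda>\<omega>. \<lambda>i\<in>I. Y i \<omega>)) = sets (\<Pi>\<^sub>M i\<in>I. distr M borel (Y i))"
      unfolding sets_distr by (intro sets_PiM_cong) auto
    fix A assume "\<And>i. i \<in> I \<Longrightarrow> A i \<in> sets (distr M borel (Y i))"
    then have A: "\<And>i. i \<in> I \<Longrightarrow> A i \<in> sets borel" by simp
    have PA: "Pi\<^sub>E I A \<in> sets (\<Pi>\<^sub>M i\<in>I. borel)" using I A by (intro sets_PiM_I_finite)
    have "emeasure (distr M (\<Pi>\<^sub>M i\<in>I. borel) (\<lambda>\<omega>. \<lambda>i\<in>I. Y i \<omega>)) (Pi\<^sub>E I A)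
      = (\<integral>\<^sup>+x. indicator (Pi\<^sub>E I A) x \<partial>distr M (\<Pi>\<^sub>M i\<in>I. borel) (\<lambda>\<omega>. \<lambda>i\<in>I. Y i \<omega>))" using PA by simp
    also have "\<dots> = (\<integral>\<^sup>+\<omega>. indicator (Pi\<^sub>E I A) (\<lambda>i\<in>I. Y i \<omega>) \<partial>M)"
      using PA by (intro nn_integral_distr V) auto
    also have "\<dots> = (\<integral>\<^sup>+\<omega>. (\<Prod>i\<in>I. indicator (A i) (X i \<omega>)) * (\<Prod>i\<in>I - I. ennreal (exp (- 0 * X i \<omega>))) \<partial>M)"
    proof (rule nn_integral_cong)
      fix \<omega>
      have "indicator (Pi\<^sub>E I A) (\<lambda>i\<in>I. Y i \<omega>) = (\<Prod>i\<in>I. indicator (A i) (X i \<omega>) :: ennreal)"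
      proof (cases "\<forall>i\<in>I. X i \<omega> \<in> A i")
        case True
        then show ?thesis by (auto simp: Y_def intro!: prod.neutral[symmetric])
      next
        case False
        then obtain i where i: "i \<in> I" "X i \<omega> \<notin> A i" by blast
        then have "(\<Prod>i\<in>I. indicator (A i) (X i \<omega>) :: ennreal) = 0" using I by (intro prod_zero) (auto intro!: bexI[of _ i])
        moreover have "(\<lambda>i\<in>I. Y i \<omega>) \<notin> Pi\<^sub>E I A" using i by (auto simp: Y_def PiE_def Pi_def intro!: bexI[of _ i])
        ultimately show ?thesis by simp
      qed
      then show "indicator (Pi\<^sub>E I A) (\<lambda>i\<in>I. Y i \<omega>) = (\<Prod>i\<in>I. indicator (A i) (X i \<omega>)) * (\<Prod>i\<in>I - I. ennreal (exp (- 0 * X i \<omega>)))" by simp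
    qed
    also have "\<dots> = (\<Prod>i\<in>I. (\<integral>\<^sup>+\<omega>. indicator (A i) (X i \<omega>) \<partial>M)) * (\<Prod>i\<in>I - I. (\<integral>\<^sup>+\<omega>. ennreal (exp (- 0 * X i \<omega>)) \<partial>M))"
      by (rule Laplace_imp_product_moments[OF I X nn L subset_refl A, where l="\<lambda>_. 0"]) auto
    also have "\<dots> = (\<Prod>i\<in>I. emeasure (distr M borel (Y i)) (A i))"
    proof -
      have "(\<integral>\<^sup>+\<omega>. indicator (A i) (X i \<omega>) \<partial>M) = emeasure (distr M borel (Y i)) (A i)" if i: "i \<in> I" for i
      proof -
        have [measurable]: "A i \<in> sets borel" using A i by blast
        have "(\<integral>\<^sup>+x. indicator (A i) x \<partial>distr M borel (Y i)) = (\<integral>\<^sup>+\<omega>. indicator (A i) (Y i \<omega>) \<partial>M)"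
          by (rule nn_integral_distr) measurable
        then show ?thesis using i by (simp add: Y_def)
      qed
      then show ?thesis by simp
    qed
    finally show "emeasure (distr M (\<Pi>\<^sub>M i\<in>I. borel) (\<lambda>\<omega>. \<lambda>i\<in>I. Y i \<omega>)) (Pi\<^sub>E I A) = (\<Prod>i\<in>I. emeasure (distr M borel (Y i)) (A i))" .
  qed
  also have "(\<Pi>\<^sub>M i\<in>I. distr M borel (Y i)) = (\<Pi>\<^sub>M i\<in>I. distr M borel (X i))" by (intro PiM_cong) (auto simp: Y_def)
  finally show ?thesis unfolding XY .
qed

theorem proposition2p1:
  fixes S :: "'s measure" and X :: "'s \<Rightarrow> real" and F :: "real measure"
    and M :: "'a measure" and \<zeta> :: "real \<Rightarrow> 'a \<Rightarrow> real" and \<theta> :: real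
    and k :: nat and C :: "nat \<Rightarrow> real set" and \<sigma> :: "nat \<Rightarrow> real"
  assumes "prob_space S" and "X \<in> borel_measurable S" and "AE \<omega> in S. 0 \<le> X \<omega>"
    and F: "F = distr S borel X"
    and "\<And>l. l > 0 \<Longrightarrow> integrable S (\<lambda>\<omega>. ln (1 + l * X \<omega>))"
    and "\<theta> > 0"
    and "GGC_subordinator_on M (1 / \<theta>) \<theta> F \<zeta>"
    and "\<And>i. i \<in> {1..k} \<Longrightarrow> C i \<in> sets borel"
    and "disjoint_family_on C {1..k}"
    and "(\<Union>i\<in>{1..k}. C i) = {0..1 / \<theta>}"
    and \<sigma>: "\<And>i. i \<in> {1..k} \<Longrightarrow> \<sigma> i = \<theta> * measure lborel (C i)"
    and "\<And>i. i \<in> {1..k} \<Longrightarrow> \<sigma> i > 0"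
    and "\<And>i x. i \<in> {1..k} \<Longrightarrow> measure (XY_law F (\<sigma> i)) {x} \<noteq> 1"
  shows "distributed (completion M) (\<Pi>\<^sub>M i\<in>{1..k}. lborel)
           (\<lambda>\<omega>. \<lambda>i\<in>{1..k}. stieltjes_on (1 / \<theta>) \<zeta> (C i) \<omega>)
           (\<lambda>x. ennreal (\<Prod>i\<in>{1..k}. indicator {0<..} (x i) * g_dens (\<sigma> i) F (x i)))
       \<and> prob_space.indep_vars (completion M) (\<lambda>_. borel)
           (\<lambda>i. stieltjes_on (1 / \<theta>) \<zeta> (C i)) {1..k}
       \<and> (\<forall>i\<in>{1..k}. \<forall>(N :: 'b measure) P. dirichlet_process N 1 (XY_law F (\<sigma> i)) P \<longrightarrow>
            distr (completion M) borel (stieltjes_on (1 / \<theta>) \<zeta> (C i))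
              = indep_prod_law (gamma_law 1) (mean_law N P)
          \<and> distributed N lborel (\<lambda>\<omega>. LINT x|P \<omega>. x)
              (\<lambda>x. ennreal (indicator {0<..} x * mean_dens (\<sigma> i) F x))
          \<and> (\<forall>(N' :: 'c measure) Q. dirichlet_process N' (\<sigma> i) F Q \<longrightarrow>
               mean_law N P = indep_prod_law (beta_law (\<sigma> i) (1 - \<sigma> i)) (mean_law N' Q)))"
proof -
  interpret S: prob_space S by fact
  have FP: "prob_space F" "sets F = sets borel" unfolding F using assms(2) by (auto intro: S.prob_space_distr)
  have FN: "AE x in F. 0 \<le> x" unfolding F using assms(2,3) by (subst AE_distr_iff) auto
  have Fint: "integrable F (\<lambda>x. ln (1 + l * x))" if "0 < l" for l
    unfolding F using assms(2) assms(5)[OF that] by (subst integrable_distr_eq) auto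
  have LF: "log_integrable_law F" by (rule log_integrable_law.intro[OF FP FN Fint])
  interpret log_integrable_law F by (rule LF)
  define I where "I = {1..k}"
  have fI: "finite I" by (simp add: I_def)
  have th: "0 < \<theta>" by fact
  have C: "\<And>i. i \<in> I \<Longrightarrow> C i \<in> sets borel" and disj: "disjoint_family_on C I" and UC: "(\<Union>i\<in>I. C i) = {0..1/\<theta>}"
    and sig: "\<And>i. i \<in> I \<Longrightarrow> \<sigma> i = \<theta> * measure lborel (C i)" and sp: "\<And>i. i \<in> I \<Longrightarrow> 0 < \<sigma> i"
    and atom: "\<And>i x. i \<in> I \<Longrightarrow> measure (XY_law F (\<sigma> i)) {x} \<noteq> 1"
    using assms(8-13) by (auto simp: I_def)
  define T where "T = 1 / \<theta>"
  have T: "0 < T" using th by (simp add: T_def)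
  have CT: "C i \<subseteq> {0..T}" if "i \<in> I" for i using UC that unfolding T_def by blast
  have Cfin: "emeasure lborel (C i) \<noteq> \<infinity>" if "i \<in> I" for i
  proof -
    have "emeasure lborel (C i) \<le> emeasure lborel {0..T}" using CT[OF that] by (intro emeasure_mono) auto
    then show ?thesis using T by (auto simp: top_unique)
  qed
  \<comment> \<open>Hence every \<open>\<sigma> i\<close> is at most 1, and \<open>I\<close> is not empty.\<close>
  have sum1: "(\<Sum>i\<in>I. \<sigma> i) = 1"
  proof -
    have "measure lborel (\<Union>i\<in>I. C i) = (\<Sum>i\<in>I. measure lborel (C i))"
      using fI C disj Cfin by (intro measure_finite_Union) auto
    then have "(\<Sum>i\<in>I. measure lborel (C i)) = T" using T unfolding UC T_def[symmetric] by simp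
    then show ?thesis using th by (simp add: sig sum_distrib_left[symmetric] T_def)
  qed
  have s1: "\<sigma> i \<le> 1" if "i \<in> I" for i
    unfolding sum1[symmetric] using that fI sp by (intro member_le_sum) (auto intro: less_imp_le)
  have GGC: "GGC_subordinator_on M T \<theta> F \<zeta>" using assms(7) by (simp add: T_def)
  have levy: "levy_process_on M T \<zeta>" using GGC by (simp add: GGC_subordinator_on_def)
  interpret M: prob_space M using levy by (simp add: levy_process_on_def)
  interpret D: prob_space "completion M"
    by (rule prob_spaceI) (simp add: M.emeasure_space_1)
  have "AE \<omega> in M. cadlag_on T (\<lambda>t. \<zeta> t \<omega>)" using levy by (simp add: levy_process_on_def)
  moreover have "AE \<omega> in M. mono_on {0..T} (\<lambda>t. \<zeta> t \<omega>)"
    using GGC by (auto simp: GGC_subordinator_on_def)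
  ultimately have "AE \<omega> in M. cadlag_on T (\<lambda>t. \<zeta> t \<omega>) \<and> mono_on {0..T} (\<lambda>t. \<zeta> t \<omega>)" by eventually_elim simp
  then obtain N0 where N0: "N0 \<in> null_sets M"
    and good: "\<And>\<omega>. \<omega> \<in> space M - N0 \<Longrightarrow> cadlag_on T (\<lambda>t. \<zeta> t \<omega>) \<and> mono_on {0..T} (\<lambda>t. \<zeta> t \<omega>)"
    by (auto elim!: AE_E3)
  \<comment> \<open>Replacing the irregular paths by 0 yields random variables on \<open>M\<close>; the given process is recovered
    off \<open>N0\<close>.\<close>
  define Z where "Z t \<omega> = (if \<omega> \<in> N0 then 0 else \<zeta> t \<omega>)" for t \<omega>
  have Zm: "Z t \<in> borel_measurable M" if "t \<in> {0..T}" for t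
  proof -
    have [measurable]: "\<zeta> t \<in> borel_measurable M" using levy that by (simp add: levy_process_on_def)
    have [measurable]: "N0 \<in> sets M" using N0 by auto
    show ?thesis unfolding Z_def[abs_def] by measurable
  qed
  have AEN: "AE \<omega> in M. \<omega> \<notin> N0" using N0 by (rule AE_not_in)
  have ZAE: "AE \<omega> in M. \<forall>t\<in>{0..T}. Z t \<omega> = \<zeta> t \<omega>" using AEN by eventually_elim (simp add: Z_def)
  have Zmono: "mono_on {0..T} (\<lambda>t. Z t \<omega>)" if "\<omega> \<in> space M" for \<omega>
    using good[of \<omega>] that by (cases "\<omega> \<in> N0") (auto simp: Z_def mono_on_def)
  have Zrc: "continuous (at_right t) (\<lambda>t. Z t \<omega>)" if "\<omega> \<in> space M" "t \<in> {0..<T}" for \<omega> t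
    using good[of \<omega>] that by (cases "\<omega> \<in> N0") (auto simp: Z_def cadlag_on_def)
  define m where "m \<omega> = path_measure T (\<lambda>t. Z t \<omega>)" for \<omega>
  note mb = path_measure_basic[OF T Zmono Zrc, folded m_def]
  define V where "V i \<omega> = measure (m \<omega>) (C i)" for i \<omega>
  define X' where "X' i = stieltjes_on T \<zeta> (C i)" for i
  have XV: "X' i \<omega> = V i \<omega>" if "\<omega> \<in> space M - N0" for i \<omega>
    using that by (simp add: X'_def V_def stieltjes_on_def m_def path_measure_def Z_def)
  have functional: "(\<lambda>\<omega>. LINT x|m \<omega>. f x) \<in> borel_measurable M \<and>
    (LINT \<omega>|M. exp (- (LINT x|m \<omega>. f x))) = exp (- \<theta> * (LINT x|lborel. indicator {0<..T} x * psi F (f x)))"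
    if "step_limit T f" for f
    using GGC_Laplace_functional[OF LF th assms(7) Zm[unfolded T_def] ZAE[unfolded T_def] Zmono[unfolded T_def] Zrc[unfolded T_def] that[unfolded T_def]]
    by (simp add: m_def T_def)
  have mi: "integrable (m \<omega>) (indicator (C i) :: real \<Rightarrow> real)" and mi': "(LINT x|m \<omega>. indicator (C i) x) = V i \<omega>" if "\<omega> \<in> space M" "i \<in> I" for \<omega> i
  proof -
    interpret mw: finite_measure "m \<omega>" by (rule mb(2)[OF that(1)]) (use that in auto)
    have s: "sets (m \<omega>) = sets borel" by (rule mb(1)[OF that(1)]) (use that in auto)
    show "integrable (m \<omega>) (indicator (C i) :: real \<Rightarrow> real)"
      using C[OF that(2)] s by (intro integrable_real_indicator) (auto simp: mw.emeasure_eq_measure)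
    show "(LINT x|m \<omega>. indicator (C i) x) = V i \<omega>"
      using s[THEN sets_eq_imp_space_eq] by (simp add: V_def)
  qed
  have V0: "0 \<le> V i \<omega>" for i \<omega> by (simp add: V_def)
  have lin: "(LINT x|m \<omega>. (\<Sum>i\<in>I. l i * indicator (C i) x)) = (\<Sum>i\<in>I. l i * V i \<omega>)" if "\<omega> \<in> space M" for \<omega> l
    using mi[OF that] mi'[OF that] by (subst Bochner_Integration.integral_sum) (auto intro!: integrable_mult_right)
  have Vm: "V i \<in> borel_measurable M" if i: "i \<in> I" for i
  proof -
    have "(\<lambda>\<omega>. LINT x|m \<omega>. (indicator (C i) x :: real)) \<in> borel_measurable M"
      using functional[OF step_limit_indicator[OF T C[OF i]]] by blast
    then show ?thesis using mi'[OF _ i] by (subst (asm) measurable_cong) auto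
  qed
  \<comment> \<open>The point 0 lies in some \<open>C i\<close> but not in \<open>{0<..T}\<close>; it is a Lebesgue null set.\<close>
  have expo: "(LINT x|lborel. indicator {0<..T} x * psi F (\<Sum>i\<in>I. l i * indicator (C i) x)) = (\<Sum>i\<in>I. psi F (l i) * measure lborel (C i))" for l
  proof -
    have "AE x in lborel. x \<noteq> (0::real)" by (rule AE_lborel_singleton)
    then have "AE x in lborel. indicator {0<..T} x * psi F (\<Sum>i\<in>I. l i * indicator (C i) x) = (\<Sum>i\<in>I. psi F (l i) * indicator (C i) x)"
    proof eventually_elim
      case (elim x)
      show ?case
      proof (cases "x \<in> {0..T}")
        case True
        then obtain i where i: "i \<in> I" "x \<in> C i" using UC unfolding T_def by blast
        have sum_eq: "(\<Sum>j\<in>I. b j * indicator (C j) x) = b i" for b :: "nat \<Rightarrow> real"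
          by (rule sum_indicator_disjoint_family[OF disj i(2) fI i(1)])
        show ?thesis unfolding sum_eq using True elim by simp
      next
        case False
        then have "x \<notin> C i" if "i \<in> I" for i using CT[OF that] by blast
        then show ?thesis using False by (auto simp: indicator_def)
      qed
    qed
    then have "(LINT x|lborel. indicator {0<..T} x * psi F (\<Sum>i\<in>I. l i * indicator (C i) x)) = (LINT x|lborel. (\<Sum>i\<in>I. psi F (l i) * indicator (C i) x))"
    proof (rule integral_cong_AE[rotated 2])
      have b: "(\<lambda>x. \<Sum>i\<in>I. b i * indicator (C i) x) \<in> borel_measurable lborel" for b :: "nat \<Rightarrow> real"
        using C by (intro borel_measurable_sum borel_measurable_times borel_measurable_const borel_measurable_indicator) auto
      show "(\<lambda>x. \<Sum>i\<in>I. psi F (l i) * indicator (C i) x) \<in> borel_measurable lborel" by (rule b)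
      show "(\<lambda>x. indicator {0<..T} x * psi F (\<Sum>i\<in>I. l i * indicator (C i) x)) \<in> borel_measurable lborel"
        by (intro borel_measurable_times borel_measurable_indicator measurable_compose[OF b borel_measurable_psi]) auto
    qed
    also have "\<dots> = (\<Sum>i\<in>I. psi F (l i) * measure lborel (C i))"
      using C Cfin by (subst Bochner_Integration.integral_sum)
        (auto intro!: integrable_mult_right integrable_real_indicator simp: less_top)
    finally show ?thesis .
  qed
  have jointV: "(LINT \<omega>|M. exp (- (\<Sum>i\<in>I. l i * V i \<omega>))) = exp (- (\<Sum>i\<in>I. \<sigma> i * psi F (l i)))" if l: "\<And>i. i \<in> I \<Longrightarrow> 0 \<le> l i" for l
  proof -
    have "(LINT \<omega>|M. exp (- (\<Sum>i\<in>I. l i * V i \<omega>))) = (LINT \<omega>|M. exp (- (LINT x|m \<omega>. (\<Sum>i\<in>I. l i * indicator (C i) x))))"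
      by (intro Bochner_Integration.integral_cong refl) (simp only: lin)
    also have "\<dots> = exp (- \<theta> * (\<Sum>i\<in>I. psi F (l i) * measure lborel (C i)))"
    proof -
      have "step_limit T (\<lambda>x. \<Sum>i\<in>I. l i * indicator (C i) x)"
        by (rule step_limit_linear_combination[OF T fI]) (use C l in auto)
      from functional[OF this] show ?thesis unfolding expo by blast
    qed
    also have "- \<theta> * (\<Sum>i\<in>I. psi F (l i) * measure lborel (C i)) = - (\<Sum>i\<in>I. \<sigma> i * psi F (l i))"
      by (simp add: sig sum_distrib_left sum_negf mult_ac)
    finally show ?thesis .
  qed
  have X'm: "X' i \<in> borel_measurable (completion M)" if "i \<in> I" for i
    by (rule measurable_completion_AE_eq[OF Vm[OF that] N0 XV])
  have AEX: "AE \<omega> in M. \<forall>i. X' i \<omega> = V i \<omega>"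
    using AEN AE_space by eventually_elim (simp add: XV)
  have joint: "(\<integral>\<^sup>+\<omega>. (\<Prod>i\<in>I. ennreal (exp (- l i * X' i \<omega>))) \<partial>completion M) = ennreal (exp (- (\<Sum>i\<in>I. \<sigma> i * psi F (l i))))" if l: "\<And>i. i \<in> I \<Longrightarrow> 0 \<le> l i" for l
  proof -
    have "(\<integral>\<^sup>+\<omega>. (\<Prod>i\<in>I. ennreal (exp (- l i * X' i \<omega>))) \<partial>completion M) = (\<integral>\<^sup>+\<omega>. (\<Prod>i\<in>I. ennreal (exp (- l i * X' i \<omega>))) \<partial>M)"
      by (rule nn_integral_completion)
    also have "\<dots> = (\<integral>\<^sup>+\<omega>. ennreal (exp (- (\<Sum>i\<in>I. l i * V i \<omega>))) \<partial>M)"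
    proof (rule nn_integral_cong_AE)
      show "AE \<omega> in M. (\<Prod>i\<in>I. ennreal (exp (- l i * X' i \<omega>))) = ennreal (exp (- (\<Sum>i\<in>I. l i * V i \<omega>)))"
        using AEX by eventually_elim (simp add: prod_ennreal exp_sum[OF fI, symmetric] sum_negf)
    qed
    also have "\<dots> = ennreal (LINT \<omega>|M. exp (- (\<Sum>i\<in>I. l i * V i \<omega>)))"
    proof (rule nn_integral_eq_integral)
      have "(\<lambda>\<omega>. \<Sum>i\<in>I. l i * V i \<omega>) \<in> borel_measurable M"
        by (intro borel_measurable_sum borel_measurable_times borel_measurable_const Vm)
      moreover have "0 \<le> (\<Sum>i\<in>I. l i * V i \<omega>)" for \<omega> using l V0 by (intro sum_nonneg mult_nonneg_nonneg) auto
      ultimately show "integrable M (\<lambda>\<omega>. exp (- (\<Sum>i\<in>I. l i * V i \<omega>)))"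
        by (intro M.integrable_const_bound[where B=1]) auto
    qed simp
    also have "(LINT \<omega>|M. exp (- (\<Sum>i\<in>I. l i * V i \<omega>))) = exp (- (\<Sum>i\<in>I. \<sigma> i * psi F (l i)))"
      by (rule jointV) (rule l)
    finally show ?thesis .
  qed
  have single: "(\<integral>\<^sup>+\<omega>. ennreal (exp (- a * X' i \<omega>)) \<partial>completion M) = ennreal (exp (- \<sigma> i * psi F a))" if i: "i \<in> I" and a: "0 \<le> a" for i a
  proof -
    define l where "l j = (if j = i then a else 0)" for j
    have p0: "psi F 0 = 0" by (simp add: psi_def)
    have "(\<Prod>j\<in>I. ennreal (exp (- l j * X' j \<omega>))) = ennreal (exp (- a * X' i \<omega>))" for \<omega>
    proof -
      have "(\<Prod>j\<in>I. ennreal (exp (- l j * X' j \<omega>))) = (\<Prod>j\<in>{i}. ennreal (exp (- l j * X' j \<omega>)))"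
        using fI i by (intro prod.mono_neutral_right) (auto simp: l_def)
      then show ?thesis by (simp add: l_def)
    qed
    moreover have "(\<Sum>j\<in>I. \<sigma> j * psi F (l j)) = \<sigma> i * psi F a"
    proof -
      have "(\<Sum>j\<in>I. \<sigma> j * psi F (l j)) = (\<Sum>j\<in>{i}. \<sigma> j * psi F (l j))"
        using fI i p0 by (intro sum.mono_neutral_right) (auto simp: l_def)
      then show ?thesis by (simp add: l_def)
    qed
    ultimately show ?thesis using joint[of l] a by (simp add: l_def)
  qed
  have X'nn: "AE \<omega> in completion M. 0 \<le> X' i \<omega>" for i
    using AE_completion[OF AEX] by eventually_elim (simp add: V0)
  have prodL: "(\<integral>\<^sup>+\<omega>. (\<Prod>i\<in>I. ennreal (exp (- l i * X' i \<omega>))) \<partial>completion M) = (\<Prod>i\<in>I. (\<integral>\<^sup>+\<omega>. ennreal (exp (- l i * X' i \<omega>)) \<partial>completion M))"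
    if l: "\<And>i. i \<in> I \<Longrightarrow> 0 \<le> l i" for l
  proof -
    have "(\<Prod>i\<in>I. (\<integral>\<^sup>+\<omega>. ennreal (exp (- l i * X' i \<omega>)) \<partial>completion M)) = (\<Prod>i\<in>I. ennreal (exp (- \<sigma> i * psi F (l i))))"
      using l by (intro prod.cong refl single) auto
    also have "\<dots> = ennreal (exp (- (\<Sum>i\<in>I. \<sigma> i * psi F (l i))))"
      by (simp add: prod_ennreal exp_sum[OF fI, symmetric] sum_negf)
    finally show ?thesis using joint[OF l] by simp
  qed
  have dist: "distr (completion M) (\<Pi>\<^sub>M i\<in>I. borel) (\<lambda>\<omega>. \<lambda>i\<in>I. X' i \<omega>) = (\<Pi>\<^sub>M i\<in>I. distr (completion M) borel (X' i))"
    by (rule D.Laplace_imp_distr_eq_PiM[OF fI X'm X'nn prodL])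
  have Ine: "I \<noteq> {}" using sum1 by auto
  have indep: "D.indep_vars (\<lambda>_. borel) X' I"
    using dist by (subst D.indep_vars_iff_distr_eq_PiM'[OF Ine]) (auto intro: X'm)
  have law: "distr (completion M) borel (X' i) = density lborel (\<lambda>x. ennreal (indicator {0<..} x * g_dens (\<sigma> i) F x))"
    and lawG: "distr (completion M) borel (X' i) = indep_prod_law (gamma_law 1) (mean_measure F (\<sigma> i))" if i: "i \<in> I" for i
  proof -
    note [measurable] = X'm[OF i]
    have R: "sets (distr (completion M) borel (X' i)) = sets borel" by simp
    have nn: "AE x in distr (completion M) borel (X' i). 0 \<le> x" using X'nn by (subst AE_distr_iff) auto
    have L: "(\<integral>\<^sup>+x. ennreal (exp (- l * x)) \<partial>distr (completion M) borel (X' i)) = ennreal (exp (- \<sigma> i * psi F l))" if "0 \<le> l" for l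
      unfolding single[OF i that, symmetric] by (rule nn_integral_distr) measurable
    show "distr (completion M) borel (X' i) = density lborel (\<lambda>x. ennreal (indicator {0<..} x * g_dens (\<sigma> i) F x))"
      "distr (completion M) borel (X' i) = indep_prod_law (gamma_law 1) (mean_measure F (\<sigma> i))"
      by (rule Laplace_exponent_law[OF sp[OF i] s1[OF i] atom[OF i] R nn L], assumption)+
  qed
  \<comment> \<open>Again the factors need to be measurable and finite for every index.\<close>
  define g where "g i x = (if i \<in> I then ennreal (indicator {0<..} x * g_dens (\<sigma> i) F x) else 0)" for i x
  have gm: "g i \<in> borel_measurable borel" for i
  proof (cases "i \<in> I")
    case True
    note [measurable] = borel_measurable_g_dens[OF sp[OF True] s1[OF True] atom[OF True]]
    show ?thesis using True unfolding g_def[abs_def] by simp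
  qed (simp add: g_def[abs_def])
  have gprod: "ennreal (\<Prod>i\<in>I. indicator {0<..} (x i) * g_dens (\<sigma> i) F (x i)) = (\<Prod>i\<in>I. g i (x i))" for x
  proof -
    have "(\<Prod>i\<in>I. g i (x i)) = (\<Prod>i\<in>I. ennreal (indicator {0<..} (x i) * g_dens (\<sigma> i) F (x i)))"
      by (intro prod.cong) (auto simp: g_def)
    also have "\<dots> = ennreal (\<Prod>i\<in>I. indicator {0<..} (x i) * g_dens (\<sigma> i) F (x i))"
      using g_dens_mixture(2)[OF sp s1 atom] by (intro prod_ennreal) auto
    finally show ?thesis by simp
  qed
  have one: "distributed (completion M) (\<Pi>\<^sub>M i\<in>I. lborel) (\<lambda>\<omega>. \<lambda>i\<in>I. X' i \<omega>)
     (\<lambda>x. ennreal (\<Prod>i\<in>I. indicator {0<..} (x i) * g_dens (\<sigma> i) F (x i)))"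
    unfolding distributed_def gprod
  proof (intro conjI)
    have sl: "sets (\<Pi>\<^sub>M i\<in>I. lborel :: real measure) = sets (\<Pi>\<^sub>M i\<in>I. borel)" by (intro sets_PiM_cong) auto
    have "distr (completion M) (\<Pi>\<^sub>M i\<in>I. lborel) (\<lambda>\<omega>. \<lambda>i\<in>I. X' i \<omega>) = distr (completion M) (\<Pi>\<^sub>M i\<in>I. borel) (\<lambda>\<omega>. \<lambda>i\<in>I. X' i \<omega>)"
      by (rule distr_cong[OF refl sl refl])
    also have "\<dots> = (\<Pi>\<^sub>M i\<in>I. density lborel (g i))"
      unfolding dist using law by (intro PiM_cong refl) (simp add: g_def[abs_def])
    also have "\<dots> = density (\<Pi>\<^sub>M i\<in>I. lborel) (\<lambda>x. \<Prod>i\<in>I. g i (x i))"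
      by (rule PiM_density_lborel[OF fI gm, symmetric]) (simp add: g_def)
    finally show "distr (completion M) (\<Pi>\<^sub>M i\<in>I. lborel) (\<lambda>\<omega>. \<lambda>i\<in>I. X' i \<omega>) = density (\<Pi>\<^sub>M i\<in>I. lborel) (\<lambda>x. \<Prod>i\<in>I. g i (x i))" .
    show "(\<lambda>x. \<Prod>i\<in>I. g i (x i)) \<in> borel_measurable (\<Pi>\<^sub>M i\<in>I. lborel)"
      by (intro borel_measurable_prod_ennreal measurable_compose[OF measurable_component_singleton]) (auto intro: gm)
    show "(\<lambda>\<omega>. \<lambda>i\<in>I. X' i \<omega>) \<in> completion M \<rightarrow>\<^sub>M (\<Pi>\<^sub>M i\<in>I. lborel)"
      by (intro measurable_restrict) (use X'm in simp)
  qed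
  have three: "distr (completion M) borel (X' i) = indep_prod_law (gamma_law 1) (mean_law N P)
      \<and> distributed N lborel (\<lambda>\<omega>. LINT x|P \<omega>. x) (\<lambda>x. ennreal (indicator {0<..} x * mean_dens (\<sigma> i) F x))
      \<and> (\<forall>(N' :: 'c measure) Q. dirichlet_process N' (\<sigma> i) F Q \<longrightarrow>
           mean_law N P = indep_prod_law (beta_law (\<sigma> i) (1 - \<sigma> i)) (mean_law N' Q))"
    if i: "i \<in> I" and P: "dirichlet_process N 1 (XY_law F (\<sigma> i)) P" for i and N :: "'b measure" and P
  proof (intro conjI allI impI)
    note s = sp[OF i] s1[OF i] atom[OF i]
    have mean_eq: "mean_law N P = mean_measure F (\<sigma> i)" by (rule dirichlet_mean_laws(1)[OF s P])
    show "distr (completion M) borel (X' i) = indep_prod_law (gamma_law 1) (mean_law N P)"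
      unfolding mean_eq by (rule lawG[OF i])
    show "distributed N lborel (\<lambda>\<omega>. LINT x|P \<omega>. x) (\<lambda>x. ennreal (indicator {0<..} x * mean_dens (\<sigma> i) F x))"
      unfolding distributed_def
    proof (intro conjI)
      have "distr N lborel (\<lambda>\<omega>. LINT x|P \<omega>. x) = mean_law N P"
        unfolding mean_law_def by (rule distr_cong) auto
      then show "distr N lborel (\<lambda>\<omega>. LINT x|P \<omega>. x) = mean_measure F (\<sigma> i)" unfolding mean_eq .
      show "(\<lambda>\<omega>. LINT x|P \<omega>. x) \<in> N \<rightarrow>\<^sub>M lborel" using mean_law_basic(1)[OF P] by simp
    qed measurable
    fix N' :: "'c measure" and Q assume "dirichlet_process N' (\<sigma> i) F Q"
    from dirichlet_mean_laws(2)[OF s this]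
    show "mean_law N P = indep_prod_law (beta_law (\<sigma> i) (1 - \<sigma> i)) (mean_law N' Q)" unfolding mean_eq by simp
  qed
  show ?thesis
    unfolding T_def[symmetric] I_def[symmetric] X'_def[symmetric]
    using one indep three by blast
qed

end
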